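(* Let $\mathbb{K}$ be a field with $\mathrm{char}(\mathbb{K})\neq 2$. All Hom-Lie algebras are multiplicative Hom-Lie algebras over $\mathbb{K}$. (a) Let $0 \to (M, \alpha_M) \stackrel{i}{\to} (K,\alpha_K) \stackrel{\pi}{\to} (L, \alpha_L) \to 0$ be a universal $\alpha$-central extension. Then $H_1^{\alpha}(K) = H_2^{\alpha}(K) = 0$. (b) Let $0 \to (M, \alpha_M) \stackrel{i}{\to} (K,\alpha_K) \stackrel{\pi}{\to} (L, \alpha_L) \to 0$ be a central extension such that $H_1^{\alpha}(K) = H_2^{\alpha}(K) = 0$. Then it is a universal central extension.
   Context: A (multiplicative) Hom-Lie algebra $(L,[-,-],\alpha_L)$, written $(L,\alpha_L)$, is a $\mathbb{K}$-vector space $L$ with a bilinear bracket $[-,-]:L\times L\to L$ and a linear map $\alpha_L:L\to L$ such that $[x,y]=-[y,x]$, $[\alpha_L(x),[y,z]]+[\alpha_L(z),[x,y]]+[\alpha_L(y),[z,x]]=0$ and $\alpha_L([x,y])=[\alpha_L(x),\alpha_L(y)]$ for all $x,y,z\in L$. A homomorphism $f:(L,\alpha_L)\to(L',\alpha_{L'})$ is a linear map with $f([x,y])=[f(x),f(y)]$ and $f\alpha_L=\alpha_{L'}f$. An extension of $(L,\alpha_L)$ is a short exact sequence of Hom-Lie algebras and homomorphisms $0 \to (M, \alpha_M) \stackrel{i}{\to} (K,\alpha_K) \stackrel{\pi}{\to} (L, \alpha_L) \to 0$; identify $M$ with $i(M)\subseteq K$. It is central if $[M,K]=0$, and $\alpha$-central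 if $[\alpha_M(M),K]=0$. A central extension $0 \to (M, \alpha_M) \stackrel{i}{\to} (K,\alpha_K) \stackrel{\pi}{\to} (L, \alpha_L) \to 0$ is a universal central (resp. universal $\alpha$-central) extension if for every central (resp. $\alpha$-central) extension $0 \to (M', \alpha_{M'}) \stackrel{i'}{\to} (K',\alpha_{K'}) \stackrel{\pi'}{\to} (L, \alpha_L) \to 0$ there is a unique homomorphism of Hom-Lie algebras $h:(K,\alpha_K)\to(K',\alpha_{K'})$ with $\pi'h=\pi$. (In particular a universal $\alpha$-central extension is by definition a central extension.) $H_n^{\alpha}(L)$ denotes the homology of $(L,\alpha_L)$ with trivial coefficients $\mathbb{K}$ (zero action, $\alpha_{\mathbb{K}}=\mathrm{Id}$): the homology of the complex $C_n^{\alpha}(L)=\Lambda^nL$ with differentials $$d_n(x_1\wedge\cdots\wedge x_n)=\sum_{1\le i<j\le n}(-1)^{i+j}[x_i,x_j]\wedge\alpha_L(x_1)\wedge\cdots\wedge\widehat{\alpha_L(x_i)}\wedge\cdots\wedge\widehat{\alpha_L(x_j)}\wedge\cdots\wedge\alpha_L(x_n).$$ *)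

theory Defs
  imports "HOL-Algebra.AbelCoset" "HOL-Algebra.Module"
begin

section \<open>Hom-Lie algebras\<close>

text \<open>Scalars form a \<^const>\<open>field\<close> record \<open>R\<close>, and vector spaces over \<open>R\<close> are instances of the
  library locale \<^locale>\<open>module\<close>.  As with every HOL-Algebra \<^typ>\<open>('k, 'v) module\<close>, the record
  fields \<^const>\<open>mult\<close> and \<^const>\<open>one\<close> are unused.\<close>

definition ring_char :: "('k, 'r) ring_scheme \<Rightarrow> nat" where
  "ring_char R =
     (if \<exists>n::nat. n > 0 \<and> [n] \<cdot>\<^bsub>R\<^esub> \<one>\<^bsub>R\<^esub> = \<zero>\<^bsub>R\<^esub>
      then LEAST n::nat. n > 0 \<and> [n] \<cdot>\<^bsub>R\<^esub> \<one>\<^bsub>R\<^esub> = \<zero>\<^bsub>R\<^esub> else 0)"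

record ('k, 'v) hom_lie = "('k, 'v) module" +
  bracket :: "'v \<Rightarrow> 'v \<Rightarrow> 'v"
  twist :: "'v \<Rightarrow> 'v"

locale hom_lie_algebra = R?: field R + L?: module R L
  for R :: "'k ring" (structure) and L :: "('k, 'v) hom_lie" (structure) +
  assumes bracket_closed:
      "\<lbrakk>x \<in> carrier L; y \<in> carrier L\<rbrakk> \<Longrightarrow> bracket L x y \<in> carrier L"
    and bracket_add_left:
      "\<lbrakk>x \<in> carrier L; y \<in> carrier L; z \<in> carrier L\<rbrakk> \<Longrightarrow>
       bracket L (x \<oplus>\<^bsub>L\<^esub> y) z = bracket L x z \<oplus>\<^bsub>L\<^esub> bracket L y z"
    and bracket_add_right:
      "\<lbrakk>x \<in> carrier L; y \<in> carrier L; z \<in> carrier L\<rbrakk> \<Longrightarrow>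
       bracket L x (y \<oplus>\<^bsub>L\<^esub> z) = bracket L x y \<oplus>\<^bsub>L\<^esub> bracket L x z"
    and bracket_smult_left:
      "\<lbrakk>a \<in> carrier R; x \<in> carrier L; y \<in> carrier L\<rbrakk> \<Longrightarrow>
       bracket L (a \<odot>\<^bsub>L\<^esub> x) y = a \<odot>\<^bsub>L\<^esub> bracket L x y"
    and bracket_smult_right:
      "\<lbrakk>a \<in> carrier R; x \<in> carrier L; y \<in> carrier L\<rbrakk> \<Longrightarrow>
       bracket L x (a \<odot>\<^bsub>L\<^esub> y) = a \<odot>\<^bsub>L\<^esub> bracket L x y"
    and bracket_skew:
      "\<lbrakk>x \<in> carrier L; y \<in> carrier L\<rbrakk> \<Longrightarrow> bracket L x y = \<ominus>\<^bsub>L\<^esub> bracket L y x"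
    and twist_closed: "x \<in> carrier L \<Longrightarrow> twist L x \<in> carrier L"
    and twist_add:
      "\<lbrakk>x \<in> carrier L; y \<in> carrier L\<rbrakk> \<Longrightarrow> twist L (x \<oplus>\<^bsub>L\<^esub> y) = twist L x \<oplus>\<^bsub>L\<^esub> twist L y"
    and twist_smult:
      "\<lbrakk>a \<in> carrier R; x \<in> carrier L\<rbrakk> \<Longrightarrow> twist L (a \<odot>\<^bsub>L\<^esub> x) = a \<odot>\<^bsub>L\<^esub> twist L x"
    and hom_jacobi:
      "\<lbrakk>x \<in> carrier L; y \<in> carrier L; z \<in> carrier L\<rbrakk> \<Longrightarrow>
       bracket L (twist L x) (bracket L y z)
         \<oplus>\<^bsub>L\<^esub> bracket L (twist L z) (bracket L x y)
         \<oplus>\<^bsub>L\<^esub> bracket L (twist L y) (bracket L z x) = \<zero>\<^bsub>L\<^esub>"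
    and twist_bracket:
      "\<lbrakk>x \<in> carrier L; y \<in> carrier L\<rbrakk> \<Longrightarrow>
       twist L (bracket L x y) = bracket L (twist L x) (twist L y)"

definition hom_lie_hom ::
  "'k ring \<Rightarrow> ('k, 'v) hom_lie \<Rightarrow> ('k, 'w) hom_lie \<Rightarrow> ('v \<Rightarrow> 'w) set" where
  "hom_lie_hom R L L' = {f \<in> carrier L \<rightarrow> carrier L'.
     (\<forall>x\<in>carrier L. \<forall>y\<in>carrier L. f (x \<oplus>\<^bsub>L\<^esub> y) = f x \<oplus>\<^bsub>L'\<^esub> f y) \<and>
     (\<forall>a\<in>carrier R. \<forall>x\<in>carrier L. f (a \<odot>\<^bsub>L\<^esub> x) = a \<odot>\<^bsub>L'\<^esub> f x) \<and>
     (\<forall>x\<in>carrier L. \<forall>y\<in>carrier L. f (bracket L x y) = bracket L' (f x) (f y)) \<and>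
     (\<forall>x\<in>carrier L. f (twist L x) = twist L' (f x))}"


section \<open>Central extensions\<close>

definition hom_lie_extension ::
  "'k ring \<Rightarrow> ('k, 'm) hom_lie \<Rightarrow> ('m \<Rightarrow> 'g) \<Rightarrow> ('k, 'g) hom_lie \<Rightarrow> ('g \<Rightarrow> 'l) \<Rightarrow>
   ('k, 'l) hom_lie \<Rightarrow> bool" where
  "hom_lie_extension R M i K p L \<longleftrightarrow>
     hom_lie_algebra R M \<and> hom_lie_algebra R K \<and> hom_lie_algebra R L \<and>
     i \<in> hom_lie_hom R M K \<and> p \<in> hom_lie_hom R K L \<and>
     inj_on i (carrier M) \<and>
     i ` carrier M = {x \<in> carrier K. p x = \<zero>\<^bsub>L\<^esub>} \<and>
     p ` carrier K = carrier L"

definition central_extension ::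
  "'k ring \<Rightarrow> ('k, 'm) hom_lie \<Rightarrow> ('m \<Rightarrow> 'g) \<Rightarrow> ('k, 'g) hom_lie \<Rightarrow> ('g \<Rightarrow> 'l) \<Rightarrow>
   ('k, 'l) hom_lie \<Rightarrow> bool" where
  "central_extension R M i K p L \<longleftrightarrow>
     hom_lie_extension R M i K p L \<and>
     (\<forall>m\<in>carrier M. \<forall>x\<in>carrier K. bracket K (i m) x = \<zero>\<^bsub>K\<^esub>)"

definition alpha_central_extension ::
  "'k ring \<Rightarrow> ('k, 'm) hom_lie \<Rightarrow> ('m \<Rightarrow> 'g) \<Rightarrow> ('k, 'g) hom_lie \<Rightarrow> ('g \<Rightarrow> 'l) \<Rightarrow>
   ('k, 'l) hom_lie \<Rightarrow> bool" where
  "alpha_central_extension R M i K p L \<longleftrightarrow>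
     hom_lie_extension R M i K p L \<and>
     (\<forall>m\<in>carrier M. \<forall>x\<in>carrier K. bracket K (i (twist M m)) x = \<zero>\<^bsub>K\<^esub>)"

text \<open>Homomorphisms are functions on carriers, so uniqueness is imposed on their
  \<^const>\<open>extensional\<close> representatives.\<close>

definition unique_hom_over ::
  "'k ring \<Rightarrow> ('k, 'g) hom_lie \<Rightarrow> ('g \<Rightarrow> 'l) \<Rightarrow> ('k, 'h) hom_lie \<Rightarrow> ('h \<Rightarrow> 'l) \<Rightarrow> bool" where
  "unique_hom_over R K p K' p' \<longleftrightarrow>
     (\<exists>!h. h \<in> hom_lie_hom R K K' \<inter> extensional (carrier K) \<and> (\<forall>x\<in>carrier K. p' (h x) = p x))"

text \<open>HOL cannot quantify over types inside a formula, so the two types in which the competing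
  extensions \<open>M' \<rightarrow> K' \<rightarrow> L\<close> are carried are parameters.  A universal property is \<^emph>\<open>concluded\<close> in
  full generality by leaving them as free type variables.  Where it is \<^emph>\<open>assumed\<close>, a single
  sufficiently large type such as \<open>('k, 'g) test\<close> below expresses the property for all types.\<close>

definition universal_central_extension ::
  "'n itself \<Rightarrow> 'h itself \<Rightarrow> 'k ring \<Rightarrow> ('k, 'm) hom_lie \<Rightarrow> ('m \<Rightarrow> 'g) \<Rightarrow> ('k, 'g) hom_lie \<Rightarrow>
   ('g \<Rightarrow> 'l) \<Rightarrow> ('k, 'l) hom_lie \<Rightarrow> bool" where
  "universal_central_extension TM TK R M i K p L \<longleftrightarrow>
     central_extension R M i K p L \<and>
     (\<forall>(M' :: ('k, 'n) hom_lie) i' (K' :: ('k, 'h) hom_lie) p'.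
        central_extension R M' i' K' p' L \<longrightarrow> unique_hom_over R K p K' p')"

definition universal_alpha_central_extension ::
  "'n itself \<Rightarrow> 'h itself \<Rightarrow> 'k ring \<Rightarrow> ('k, 'm) hom_lie \<Rightarrow> ('m \<Rightarrow> 'g) \<Rightarrow> ('k, 'g) hom_lie \<Rightarrow>
   ('g \<Rightarrow> 'l) \<Rightarrow> ('k, 'l) hom_lie \<Rightarrow> bool" where
  "universal_alpha_central_extension TM TK R M i K p L \<longleftrightarrow>
     central_extension R M i K p L \<and>
     (\<forall>(M' :: ('k, 'n) hom_lie) i' (K' :: ('k, 'h) hom_lie) p'.
        alpha_central_extension R M' i' K' p' L \<longrightarrow> unique_hom_over R K p K' p')"

text \<open>This type is infinite and at least as large as \<open>'k\<close> and \<open>'g\<close>.  The universal property of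
  \<open>p : K \<rightarrow> L\<close> (with \<open>K\<close> carried by \<open>'g\<close>) against extensions carried by it is equivalent to that
  against extensions of arbitrary size.  Indeed, let \<open>p' : K' \<rightarrow> L\<close> be any
  (\<open>\<alpha>\<close>-)central extension, and let \<open>K''\<close> be the twist-stable subalgebra of \<open>K'\<close> generated by
  the image of a set-theoretic section of \<open>p'\<close> and the images of at most two given homomorphisms
  \<open>K \<rightarrow> K'\<close>.  Then \<open>K''\<close> has cardinality at most \<open>max |K| |R| \<aleph>\<^sub>0\<close>, so it and its kernel
  have isomorphic copies in this type, and \<open>K'' \<rightarrow> L\<close> is again an (\<open>\<alpha>\<close>-)central extension.
  Existence and uniqueness of the homomorphism to \<open>K'\<close> over \<open>L\<close> follow from those for \<open>K''\<close>.\<close>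

type_synonym ('k, 'g) test = "('g list \<Rightarrow> 'k) set"


section \<open>Exterior powers\<close>

definition free_module :: "'k ring \<Rightarrow> 'b set \<Rightarrow> ('k, 'b \<Rightarrow> 'k) module" where
  "free_module R B =
     \<lparr>carrier = {f. (\<forall>b\<in>B. f b \<in> carrier R) \<and> (\<forall>b. b \<notin> B \<longrightarrow> f b = \<zero>\<^bsub>R\<^esub>) \<and>
                    finite {b. f b \<noteq> \<zero>\<^bsub>R\<^esub>}},
      mult = (\<lambda>_ _. undefined), one = undefined,
      zero = (\<lambda>_. \<zero>\<^bsub>R\<^esub>), add = (\<lambda>f g b. f b \<oplus>\<^bsub>R\<^esub> g b),
      smult = (\<lambda>a f b. a \<otimes>\<^bsub>R\<^esub> f b)\<rparr>"

definition basis_vec :: "'k ring \<Rightarrow> 'b \<Rightarrow> 'b \<Rightarrow> 'k" where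
  "basis_vec R b = (\<lambda>c. if c = b then \<one>\<^bsub>R\<^esub> else \<zero>\<^bsub>R\<^esub>)"

definition lin_extend ::
  "'k ring \<Rightarrow> ('k, 'v) module \<Rightarrow> ('b \<Rightarrow> 'v) \<Rightarrow> ('b \<Rightarrow> 'k) \<Rightarrow> 'v" where
  "lin_extend R V g f = (\<Oplus>\<^bsub>V\<^esub>b\<in>{b. f b \<noteq> \<zero>\<^bsub>R\<^esub>}. f b \<odot>\<^bsub>V\<^esub> g b)"

definition submodule_span :: "'k ring \<Rightarrow> ('k, 'v) module \<Rightarrow> 'v set \<Rightarrow> 'v set" where
  "submodule_span R V S = \<Inter>{N. submodule N R V \<and> S \<subseteq> N}"

definition quot_module :: "('k, 'v) module \<Rightarrow> 'v set \<Rightarrow> ('k, 'v set) module" where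
  "quot_module V N =
     \<lparr>carrier = a_rcosets\<^bsub>V\<^esub> N, mult = (\<lambda>_ _. undefined), one = undefined,
      zero = N, add = set_add V, smult = (\<lambda>a X. \<Union>x\<in>X. N +>\<^bsub>V\<^esub> (a \<odot>\<^bsub>V\<^esub> x))\<rparr>"

definition tuples :: "('k, 'v) hom_lie \<Rightarrow> nat \<Rightarrow> 'v list set" where
  "tuples L n = {xs. length xs = n \<and> set xs \<subseteq> carrier L}"

text \<open>The \<open>n\<close>-th exterior power of \<open>L\<close> is the free vector space on \<open>n\<close>-tuples
  \<open>[x\<^sub>1, \<dots>, x\<^sub>n]\<close> modulo multilinearity and the vanishing of tuples with a repeated entry; the
  coset of \<open>basis_vec R [x\<^sub>1, \<dots>, x\<^sub>n]\<close> is \<open>x\<^sub>1 \<and> \<dots> \<and> x\<^sub>n\<close>.\<close>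

abbreviation tuple_module :: "'k ring \<Rightarrow> ('k, 'v) hom_lie \<Rightarrow> nat \<Rightarrow> ('k, 'v list \<Rightarrow> 'k) module" where
  "tuple_module R L n \<equiv> free_module R (tuples L n)"

definition wedge_relations :: "'k ring \<Rightarrow> ('k, 'v) hom_lie \<Rightarrow> nat \<Rightarrow> ('v list \<Rightarrow> 'k) set" where
  "wedge_relations R L n =
     {basis_vec R (us @ (x \<oplus>\<^bsub>L\<^esub> y) # vs)
        \<ominus>\<^bsub>tuple_module R L n\<^esub>
          (basis_vec R (us @ x # vs) \<oplus>\<^bsub>tuple_module R L n\<^esub> basis_vec R (us @ y # vs)) | us vs x y.
        us @ x # vs \<in> tuples L n \<and> us @ y # vs \<in> tuples L n}
   \<union> {basis_vec R (us @ (a \<odot>\<^bsub>L\<^esub> x) # vs)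
        \<ominus>\<^bsub>tuple_module R L n\<^esub>
          (a \<odot>\<^bsub>tuple_module R L n\<^esub> basis_vec R (us @ x # vs)) | us vs a x.
        a \<in> carrier R \<and> us @ x # vs \<in> tuples L n}
   \<union> {basis_vec R xs | xs. xs \<in> tuples L n \<and> \<not> distinct xs}"

definition wedge_kernel :: "'k ring \<Rightarrow> ('k, 'v) hom_lie \<Rightarrow> nat \<Rightarrow> ('v list \<Rightarrow> 'k) set" where
  "wedge_kernel R L n = submodule_span R (tuple_module R L n) (wedge_relations R L n)"

definition ext_power ::
  "'k ring \<Rightarrow> ('k, 'v) hom_lie \<Rightarrow> nat \<Rightarrow> ('k, ('v list \<Rightarrow> 'k) set) module" where
  "ext_power R L n = quot_module (tuple_module R L n) (wedge_kernel R L n)"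


section \<open>Homology with trivial coefficients\<close>

text \<open>The differential on a tuple.  Indices are 0-based, which does not change the parity of
  \<open>i + j\<close>; \<open>nths xs (- {i, j})\<close> is \<open>xs\<close> with the entries at \<open>i\<close> and \<open>j\<close> deleted.\<close>

definition d_tuple :: "'k ring \<Rightarrow> ('k, 'v) hom_lie \<Rightarrow> 'v list \<Rightarrow> 'v list \<Rightarrow> 'k" where
  "d_tuple R L xs =
     finsum (tuple_module R L (length xs - 1))
       (\<lambda>(i, j). ((\<ominus>\<^bsub>R\<^esub> \<one>\<^bsub>R\<^esub>) [^]\<^bsub>R\<^esub> (i + j)) \<odot>\<^bsub>tuple_module R L (length xs - 1)\<^esub>
          basis_vec R (bracket L (xs ! i) (xs ! j) # map (twist L) (nths xs (- {i, j}))))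
       {(i, j). i < j \<and> j < length xs}"

text \<open>The induced map \<open>d\<^sub>n : \<Lambda>\<^sup>n L \<rightarrow> \<Lambda>\<^sup>n\<^sup>-\<^sup>1 L\<close> on cosets.  The linear extension of \<^const>\<open>d_tuple\<close>
  respects the wedge relations, so all representatives contribute the same coset to the union.
  On degree 0 this is the zero map.\<close>

definition hl_diff ::
  "'k ring \<Rightarrow> ('k, 'v) hom_lie \<Rightarrow> nat \<Rightarrow> ('v list \<Rightarrow> 'k) set \<Rightarrow> ('v list \<Rightarrow> 'k) set" where
  "hl_diff R L n X =
     (\<Union>f\<in>X. wedge_kernel R L (n - 1) +>\<^bsub>tuple_module R L (n - 1)\<^esub>
              lin_extend R (tuple_module R L (n - 1)) (d_tuple R L) f)"

definition hl_cycles ::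
  "'k ring \<Rightarrow> ('k, 'v) hom_lie \<Rightarrow> nat \<Rightarrow> ('v list \<Rightarrow> 'k) set set" where
  "hl_cycles R L n =
     {X \<in> carrier (ext_power R L n). hl_diff R L n X = \<zero>\<^bsub>ext_power R L (n - 1)\<^esub>}"

definition hl_boundaries ::
  "'k ring \<Rightarrow> ('k, 'v) hom_lie \<Rightarrow> nat \<Rightarrow> ('v list \<Rightarrow> 'k) set set" where
  "hl_boundaries R L n = hl_diff R L (n + 1) ` carrier (ext_power R L (n + 1))"

definition hl_homology ::
  "'k ring \<Rightarrow> ('k, 'v) hom_lie \<Rightarrow> nat \<Rightarrow> ('k, ('v list \<Rightarrow> 'k) set set) module" where
  "hl_homology R L n =
     quot_module ((ext_power R L n)\<lparr>carrier := hl_cycles R L n\<rparr>) (hl_boundaries R L n)"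

definition zero_module :: "('k, 'v) module \<Rightarrow> bool" where
  "zero_module V \<longleftrightarrow> carrier V = {\<zero>\<^bsub>V\<^esub>}"

end

theory Submission
  imports Defs
begin

text \<open>
  Both parts rest on a description of the two homology groups by elements. Write
  \<open>\<delta>\<close> for the linear map from formal linear combinations of pairs to
  \<open>K\<close> with \<open>[x, y] \<mapsto> bracket K y x\<close>. The first homology vanishes
  iff all combinations of 1-tuples are wedge relations and boundaries
  (\<open>homology_1_zero_iff\<close>); as \<open>\<Lambda>\<^sup>1 K\<close> is \<open>K\<close>,
  brackets then span \<open>K\<close> (\<open>perfect_if_bd\<close>). The second vanishes iff the
  kernel of \<open>\<delta>\<close> consists of wedge relations and boundaries
  (\<open>homology_2_zero_iff\<close>). The hypothesis on the characteristic makes the bracket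
  alternating, which the differential needs in order to descend to exterior powers.

  Suppose that \<open>H\<^sub>1\<close> and \<open>H\<^sub>2\<close> vanish, and let \<open>p : K
  \<rightarrow> L\<close> and \<open>p' : K' \<rightarrow> L\<close> be central extensions. The
  bracket in \<open>K'\<close> of two elements depends only on their images in \<open>L\<close>, so
  \<open>[x, y] \<mapsto> bracket K' y' x'\<close>, with arbitrary lifts \<open>x'\<close>,
  \<open>y'\<close> of \<open>p x\<close>, \<open>p y\<close>, is a well-defined bilinear map. It
  kills the wedge relations, and it kills boundaries by the Hom-Jacobi identity in
  \<open>K'\<close>. As \<open>H\<^sub>2\<close> vanishes it kills the kernel of
  \<open>\<delta>\<close>, and as \<open>K\<close> is perfect \<open>\<delta>\<close> is onto; so it
  factors through \<open>\<delta>\<close>, and the factor is the required homomorphism \<open>K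
  \<rightarrow> K'\<close> (\<open>lift_along_central_extension\<close>). No linear section of
  \<open>p'\<close> enters. Two such homomorphisms differ by central elements, hence agree on
  brackets and thus everywhere (\<open>perfect_hom_unique\<close>).

  Suppose now that \<open>p : K \<rightarrow> L\<close> is universal
  \<open>\<alpha>\<close>-central, and let \<open>Q\<^sub>n\<close> be the space of combinations of
  \<open>n\<close>-tuples modulo wedge relations and boundaries, that is, \<open>\<Lambda>\<^sup>n
  K\<close> modulo boundaries; the twist of \<open>K\<close> acts on it. A skew bilinear map
  \<open>\<phi>\<close> on \<open>K\<close> with values in \<open>Q\<^sub>n\<close> that satisfies
  the cocycle condition and commutes with the twists makes \<open>K \<times> Q\<^sub>n\<close> a
  Hom-Lie algebra over \<open>K\<close>, and hence over \<open>L\<close>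
  (\<open>cocycle_extension\<close>).

  With \<open>n = 1\<close> and \<open>\<phi> = 0\<close>, both \<open>x \<mapsto> (x, 0)\<close>
  and \<open>x \<mapsto> (x, class of [x])\<close> are homomorphisms over \<open>L\<close>. By
  uniqueness they agree, so \<open>Q\<^sub>1 = 0\<close>, that is, \<open>H\<^sub>1 = 0\<close>
  (\<open>universal_alpha_bd_1\<close>). With \<open>n = 2\<close> and \<open>\<phi> x y = class of
  [y, x]\<close>, the extension over \<open>L\<close> is \<open>\<alpha>\<close>-central: for
  \<open>m\<close> in the kernel of \<open>p\<close>, the boundary of \<open>a \<and> b \<and>
  m\<close> is \<open>- [a, b] \<and> \<alpha> m\<close>, and \<open>K\<close> is perfect. A
  homomorphism from \<open>K\<close> over \<open>L\<close> has the identity as its first component,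
  and its second component \<open>\<sigma>\<close> is linear with \<open>\<sigma> (bracket K x y) =
  \<phi> x y\<close>. So \<open>\<sigma> \<circ> \<delta>\<close> is the projection to
  \<open>Q\<^sub>2\<close>, and the kernel of \<open>\<delta>\<close> consists of relations and
  boundaries; this is \<open>H\<^sub>2 = 0\<close>
  (\<open>universal_alpha_central_homology\<close>).

  These algebras are carried by pairs, whereas the universal property concerns carriers in the type
  of sets of functions on lists. They are moved there along the injection of
  \<open>encode_inj\<close>.
\<close>

section \<open>Linear maps, quotients and free modules\<close>

lemma (in module) submodule_zero: "submodule N R M \<Longrightarrow> \<zero>\<^bsub>M\<^esub> \<in> N"
  using subgroup.one_closed[OF submodule.axioms(1)] by fastforce

text \<open>Both modules are assumed to be modules over \<open>R\<close>. Nothing is said about values of \<open>f\<close> outside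
  the carrier of \<open>V\<close>.\<close>
locale linear_map =
  fixes R :: "('k, 'r) ring_scheme" and V :: "('k, 'v, 'a) module_scheme"
    and W :: "('k, 'w, 'b) module_scheme" and f :: "'v \<Rightarrow> 'w"
  assumes module_domain: "module R V" and module_codomain: "module R W"
    and closed [simp]: "x \<in> carrier V \<Longrightarrow> f x \<in> carrier W"
    and add: "\<lbrakk>x \<in> carrier V; y \<in> carrier V\<rbrakk> \<Longrightarrow> f (x \<oplus>\<^bsub>V\<^esub> y) = f x \<oplus>\<^bsub>W\<^esub> f y"
    and smult: "\<lbrakk>a \<in> carrier R; x \<in> carrier V\<rbrakk> \<Longrightarrow> f (a \<odot>\<^bsub>V\<^esub> x) = a \<odot>\<^bsub>W\<^esub> f x"
begin

lemma zero [simp]: "f \<zero>\<^bsub>V\<^esub> = \<zero>\<^bsub>W\<^esub>"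
proof -
  interpret V: module R V by (rule module_domain)
  interpret W: module R W by (rule module_codomain)
  show ?thesis using smult[of "\<zero>\<^bsub>R\<^esub>" "\<zero>\<^bsub>V\<^esub>"] by simp
qed

lemma neg:
  assumes x: "x \<in> carrier V"
  shows "f (\<ominus>\<^bsub>V\<^esub> x) = \<ominus>\<^bsub>W\<^esub> f x"
proof -
  interpret V: module R V by (rule module_domain)
  interpret W: module R W by (rule module_codomain)
  have "f (\<ominus>\<^bsub>V\<^esub> x) \<oplus>\<^bsub>W\<^esub> f x = \<zero>\<^bsub>W\<^esub>"
    using x by (simp add: V.l_neg flip: add)
  from W.minus_equality[OF this] x show ?thesis by simp
qed

lemma diff:
  assumes "x \<in> carrier V" "y \<in> carrier V"
  shows "f (x \<ominus>\<^bsub>V\<^esub> y) = f x \<ominus>\<^bsub>W\<^esub> f y"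
  using assms abelian_group.a_inv_closed[OF module.axioms(2)[OF module_domain]]
  by (simp add: a_minus_def add neg)

lemma finsum:
  assumes "finite A" "g \<in> A \<rightarrow> carrier V"
  shows "f (finsum V g A) = finsum W (\<lambda>a. f (g a)) A"
proof -
  interpret V: module R V by (rule module_domain)
  interpret W: module R W by (rule module_codomain)
  show ?thesis using assms
  proof (induction A rule: finite_induct)
    case (insert a A)
    then have "g a \<in> carrier V" "g \<in> A \<rightarrow> carrier V" by auto
    then show ?case using insert by (simp add: add Pi_iff)
  qed simp
qed

lemma vimage_submodule:
  assumes "submodule N R W"
  shows "submodule {x \<in> carrier V. f x \<in> N} R V"
proof -
  interpret V: module R V by (rule module_domain)
  interpret W: module R W by (rule module_codomain)
  note sub = W.submoduleE[OF assms] W.submodule_zero[OF assms]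
  show ?thesis by (rule V.submoduleI) (use sub in \<open>simp_all add: neg add smult Collect_subset\<close>)
qed

lemma kernel_submodule: "submodule {x \<in> carrier V. f x = \<zero>\<^bsub>W\<^esub>} R V"
proof -
  interpret V: module R V by (rule module_domain)
  interpret W: module R W by (rule module_codomain)
  show ?thesis by (rule V.submoduleI) (simp_all add: neg add smult Collect_subset)
qed

lemma image_submodule:
  assumes "submodule N R V"
  shows "submodule (f ` N) R W"
proof -
  interpret V: module R V by (rule module_domain)
  interpret W: module R W by (rule module_codomain)
  note sub = V.submoduleE[OF assms]
  have zero_N: "\<zero>\<^bsub>V\<^esub> \<in> N" by (rule V.submodule_zero[OF assms])
  have inN: "x \<in> carrier V" if "x \<in> N" for x using that sub(1) by blast
  show ?thesis
  proof (rule W.submoduleI)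
    show "f ` N \<subseteq> carrier W" using inN by auto
    show "\<zero>\<^bsub>W\<^esub> \<in> f ` N" using zero_N zero by (metis image_eqI)
  next
    fix a assume "a \<in> f ` N"
    then obtain x where x: "x \<in> N" "a = f x" by blast
    then have "\<ominus>\<^bsub>W\<^esub> a = f (\<ominus>\<^bsub>V\<^esub> x)" by (simp add: neg inN)
    then show "\<ominus>\<^bsub>W\<^esub> a \<in> f ` N" using sub(3)[OF x(1)] by (rule image_eqI)
  next
    fix a b assume "a \<in> f ` N" "b \<in> f ` N"
    then obtain x y where x: "x \<in> N" "a = f x" and y: "y \<in> N" "b = f y" by blast
    then have "a \<oplus>\<^bsub>W\<^esub> b = f (x \<oplus>\<^bsub>V\<^esub> y)" by (simp add: add inN)
    then show "a \<oplus>\<^bsub>W\<^esub> b \<in> f ` N" using sub(5)[OF x(1) y(1)] by (rule image_eqI)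
  next
    fix a b assume a: "a \<in> carrier R" and "b \<in> f ` N"
    then obtain x where x: "x \<in> N" "b = f x" by blast
    then have "a \<odot>\<^bsub>W\<^esub> b = f (a \<odot>\<^bsub>V\<^esub> x)" using a by (simp add: smult inN)
    then show "a \<odot>\<^bsub>W\<^esub> b \<in> f ` N" using sub(4)[OF a x(1)] by (rule image_eqI)
  qed
qed

end

lemma (in abelian_group) minus_eq_zero_iff:
  assumes "x \<in> carrier G" "y \<in> carrier G"
  shows "x \<ominus> y = \<zero> \<longleftrightarrow> x = y"
proof
  assume "x \<ominus> y = \<zero>"
  then have "\<ominus> (\<ominus> y) = x" using assms by (intro minus_equality) (auto simp: a_minus_def)
  then show "x = y" using assms by simp
qed (use assms in \<open>simp add: a_minus_def r_neg\<close>)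

lemma (in abelian_group) neg_zero: "\<ominus> \<zero> = \<zero>"
  using minus_equality[of \<zero> \<zero>] by simp

lemma (in abelian_group) minus_zero_right: "x \<in> carrier G \<Longrightarrow> x \<ominus> \<zero> = x"
  by (simp add: a_minus_def neg_zero)

lemma linear_mapI:
  assumes "module R V" "module R W"
    and "\<And>x. x \<in> carrier V \<Longrightarrow> f x \<in> carrier W"
    and "\<And>x y. \<lbrakk>x \<in> carrier V; y \<in> carrier V\<rbrakk> \<Longrightarrow> f (x \<oplus>\<^bsub>V\<^esub> y) = f x \<oplus>\<^bsub>W\<^esub> f y"
    and "\<And>a x. \<lbrakk>a \<in> carrier R; x \<in> carrier V\<rbrakk> \<Longrightarrow> f (a \<odot>\<^bsub>V\<^esub> x) = a \<odot>\<^bsub>W\<^esub> f x"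
  shows "linear_map R V W f"
  using assms by (rule linear_map.intro)

lemma linear_map_comp:
  assumes "linear_map R V W f" "linear_map R W U g"
  shows "linear_map R V U (\<lambda>x. g (f x))"
proof -
  interpret f: linear_map R V W f by fact
  interpret g: linear_map R W U g by fact
  show ?thesis by (rule linear_mapI) (auto simp: f.add g.add f.smult g.smult intro: f.module_domain g.module_codomain)
qed

text \<open>A linear map that kills the kernel of a surjective linear map factors through it.\<close>

lemma linear_map_factor:
  assumes "linear_map R V Q q" "linear_map R V W f"
    and surj: "q ` carrier V = carrier Q"
    and ker: "\<And>x. \<lbrakk>x \<in> carrier V; q x = \<zero>\<^bsub>Q\<^esub>\<rbrakk> \<Longrightarrow> f x = \<zero>\<^bsub>W\<^esub>"
  obtains g where "linear_map R Q W g" "\<And>x. x \<in> carrier V \<Longrightarrow> g (q x) = f x"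
proof -
  interpret q: linear_map R V Q q by fact
  interpret f: linear_map R V W f by fact
  interpret V: module R V by (rule f.module_domain)
  interpret W: module R W by (rule f.module_codomain)
  interpret Q: module R Q by (rule q.module_codomain)
  define g where "g y = f (SOME x. x \<in> carrier V \<and> q x = y)" for y
  have g: "g (q x) = f x" if x: "x \<in> carrier V" for x
  proof -
    define z where "z = (SOME z. z \<in> carrier V \<and> q z = q x)"
    have z: "z \<in> carrier V" "q z = q x"
      unfolding z_def by (rule someI2[of _ x]; use x in auto)+
    have "q (z \<ominus>\<^bsub>V\<^esub> x) = q x \<ominus>\<^bsub>Q\<^esub> q x"
      using q.diff[OF z(1) x] by (simp only: z(2))
    also have "\<dots> = \<zero>\<^bsub>Q\<^esub>" using Q.minus_eq_zero_iff x by simp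
    finally have "f (z \<ominus>\<^bsub>V\<^esub> x) = \<zero>\<^bsub>W\<^esub>" using ker z(1) x by simp
    then have "f z \<ominus>\<^bsub>W\<^esub> f x = \<zero>\<^bsub>W\<^esub>" by (simp only: f.diff[OF z(1) x])
    then have "f z = f x" using z(1) x by (simp add: W.minus_eq_zero_iff)
    then show ?thesis by (simp add: g_def z_def)
  qed
  have lift: "\<exists>x\<in>carrier V. y = q x" if "y \<in> carrier Q" for y
    using that surj by blast
  have "linear_map R Q W g"
  proof (rule linear_mapI)
    fix y assume "y \<in> carrier Q"
    then obtain x where x: "x \<in> carrier V" "y = q x" using lift by blast
    then show "g y \<in> carrier W" by (simp add: g)
    fix y' assume "y' \<in> carrier Q"
    then obtain x' where x': "x' \<in> carrier V" "y' = q x'" using lift by blast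
    have "g (q (x \<oplus>\<^bsub>V\<^esub> x')) = f x \<oplus>\<^bsub>W\<^esub> f x'" using x x' by (simp only: g f.add V.a_closed)
    then show "g (y \<oplus>\<^bsub>Q\<^esub> y') = g y \<oplus>\<^bsub>W\<^esub> g y'"
      using x x' by (simp add: q.add g)
  next
    fix a y assume a: "a \<in> carrier R" and "y \<in> carrier Q"
    then obtain x where x: "x \<in> carrier V" "y = q x" using lift by blast
    have "g (q (a \<odot>\<^bsub>V\<^esub> x)) = a \<odot>\<^bsub>W\<^esub> f x" using x a by (simp only: g f.smult V.smult_closed)
    then show "g (a \<odot>\<^bsub>Q\<^esub> y) = a \<odot>\<^bsub>W\<^esub> g y"
      using x a by (simp add: q.smult g)
  qed (rule q.module_codomain f.module_codomain)+
  with g that show thesis by metis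
qed



subsection \<open>Spans and quotients\<close>

text \<open>Modules without further record fields, the type to which quotients and free modules belong.\<close>
locale plain_module = module R V
  for R :: "'k ring" (structure) and V :: "('k, 'v) module" (structure)
begin

lemma span_least: "\<lbrakk>submodule N R V; S \<subseteq> N\<rbrakk> \<Longrightarrow> submodule_span R V S \<subseteq> N"
  by (auto simp: submodule_span_def)

lemma span_superset: "S \<subseteq> submodule_span R V S"
  by (auto simp: submodule_span_def)

lemma span_submodule:
  assumes "S \<subseteq> carrier V"
  shows "submodule (submodule_span R V S) R V"
proof -
  have "submodule_span R V S \<subseteq> carrier V"
    using assms carrier_is_submodule by (rule span_least[rotated])
  then show ?thesis
    using submoduleE submodule_zero
    by (intro submoduleI) (auto simp: submodule_span_def)
qed

end

text \<open>The quotient of a module \<open>V\<close> by a submodule \<open>N\<close>, with the projection sending \<open>x\<close> to its coset.\<close>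
locale quotient_space = plain_module R V
  for R :: "'k ring" (structure) and V :: "('k, 'v) module" (structure) +
  fixes N :: "'v set"
  assumes N: "submodule N R V"
begin

sublocale N: abelian_subgroup N V
  using submodule.axioms(1)[OF N]
  by (intro abelian_subgroupI3 additive_subgroupI abelian_group_axioms)

abbreviation proj :: "'v \<Rightarrow> 'v set" where "proj x \<equiv> N +>\<^bsub>V\<^esub> x"

abbreviation Q :: "('k, 'v set) module" where "Q \<equiv> quot_module V N"

lemma carrier_quot: "carrier Q = proj ` carrier V"
  by (auto simp: quot_module_def A_RCOSETS_def')

lemma zero_quot: "\<zero>\<^bsub>Q\<^esub> = proj \<zero>\<^bsub>V\<^esub>"
  using N.a_subset by (simp add: quot_module_def)

lemma proj_eq_iff:
  assumes "x \<in> carrier V" "y \<in> carrier V"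
  shows "proj x = proj y \<longleftrightarrow> x \<ominus>\<^bsub>V\<^esub> y \<in> N"
proof -
  have "proj x = proj y \<longleftrightarrow> x \<in> proj y"
    using assms N.a_repr_independence' N.a_rcos_self by blast
  then show ?thesis using assms by (simp add: N.a_rcos_module a_minus_def)
qed

lemma proj_eq_zero_iff:
  assumes "x \<in> carrier V"
  shows "proj x = \<zero>\<^bsub>Q\<^esub> \<longleftrightarrow> x \<in> N"
  using assms proj_eq_iff[of x "\<zero>\<^bsub>V\<^esub>"] by (simp add: zero_quot M.minus_zero_right)

lemma add_quot:
  "\<lbrakk>x \<in> carrier V; y \<in> carrier V\<rbrakk> \<Longrightarrow> proj x \<oplus>\<^bsub>Q\<^esub> proj y = proj (x \<oplus>\<^bsub>V\<^esub> y)"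
  using N.a_rcos_sum by (simp add: quot_module_def)

lemma mem_proj_iff:
  assumes "x \<in> carrier V" shows "y \<in> proj x \<longleftrightarrow> y \<in> carrier V \<and> y \<ominus>\<^bsub>V\<^esub> x \<in> N"
  using assms N.a_elemrcos_carrier[of x y] N.a_rcos_module[of x y] by (auto simp: a_minus_def)

lemma smult_quot:
  assumes a: "a \<in> carrier R" and x: "x \<in> carrier V"
  shows "a \<odot>\<^bsub>Q\<^esub> proj x = proj (a \<odot>\<^bsub>V\<^esub> x)"
proof -
  have "proj (a \<odot>\<^bsub>V\<^esub> y) = proj (a \<odot>\<^bsub>V\<^esub> x)" if "y \<in> proj x" for y
  proof -
    have y: "y \<in> carrier V" "y \<ominus>\<^bsub>V\<^esub> x \<in> N" using that x mem_proj_iff by auto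
    have "a \<odot>\<^bsub>V\<^esub> y \<ominus>\<^bsub>V\<^esub> a \<odot>\<^bsub>V\<^esub> x = a \<odot>\<^bsub>V\<^esub> (y \<ominus>\<^bsub>V\<^esub> x)"
      using a x y(1) by (simp add: a_minus_def smult_r_distr smult_r_minus)
    then show ?thesis using a x y submoduleE(4)[OF N] by (simp add: proj_eq_iff)
  qed
  then have "(\<Union>y\<in>proj x. proj (a \<odot>\<^bsub>V\<^esub> y)) = (\<Union>y\<in>proj x. proj (a \<odot>\<^bsub>V\<^esub> x))"
    by (rule SUP_cong[OF refl])
  also have "\<dots> = proj (a \<odot>\<^bsub>V\<^esub> x)" using N.a_rcos_self[OF x] by blast
  finally show ?thesis by (simp add: quot_module_def)
qed

lemma module_quot: "module R Q"
proof (rule moduleI)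
  show "abelian_group Q"
  proof (rule abelian_groupI)
    fix X assume "X \<in> carrier Q"
    then obtain x where x: "x \<in> carrier V" "X = proj x" by (auto simp: carrier_quot)
    have "proj (\<ominus>\<^bsub>V\<^esub> x) \<in> carrier Q" using x by (auto simp: carrier_quot)
    moreover have "proj (\<ominus>\<^bsub>V\<^esub> x) \<oplus>\<^bsub>Q\<^esub> X = \<zero>\<^bsub>Q\<^esub>"
      using x by (simp add: add_quot zero_quot M.l_neg)
    ultimately show "\<exists>Y\<in>carrier Q. Y \<oplus>\<^bsub>Q\<^esub> X = \<zero>\<^bsub>Q\<^esub>" by blast
  qed (auto simp: carrier_quot add_quot zero_quot M.a_ac)
qed (auto simp: carrier_quot add_quot smult_quot smult_l_distr smult_r_distr smult_assoc1
      intro: R.is_cring)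

lemma proj_linear: "linear_map R V Q proj"
  by (rule linear_mapI)
    (auto simp: carrier_quot add_quot smult_quot intro: module_axioms module_quot)

end


subsection \<open>Free modules\<close>

lemma free_module_simps:
  "zero (free_module R B) = (\<lambda>_. \<zero>\<^bsub>R\<^esub>)"
  "f \<oplus>\<^bsub>free_module R B\<^esub> g = (\<lambda>b. f b \<oplus>\<^bsub>R\<^esub> g b)"
  "a \<odot>\<^bsub>free_module R B\<^esub> f = (\<lambda>b. a \<otimes>\<^bsub>R\<^esub> f b)"
  by (auto simp: free_module_def)

text \<open>The free module on a set \<open>B\<close>: finitely supported functions that vanish off \<open>B\<close>.\<close>
locale free_space = R?: cring R for R :: "'k ring" (structure) and B :: "'b set"
begin

abbreviation F :: "('k, 'b \<Rightarrow> 'k) module" where "F \<equiv> free_module R B"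

lemma carrier_free:
  "f \<in> carrier F \<longleftrightarrow> (\<forall>b. f b \<in> carrier R) \<and> (\<forall>b. b \<notin> B \<longrightarrow> f b = \<zero>) \<and> finite {b. f b \<noteq> \<zero>}"
  unfolding free_module_def by auto

lemma add_support: "{b. f b \<oplus> g b \<noteq> \<zero>} \<subseteq> {b. f b \<noteq> \<zero>} \<union> {b. g b \<noteq> \<zero>}"
  by auto

lemma smult_support: "a \<in> carrier R \<Longrightarrow> {b. a \<otimes> f b \<noteq> \<zero>} \<subseteq> {b. f b \<noteq> \<zero>}"
  by auto

lemma module_free: "module R F"
proof (rule moduleI)
  show "abelian_group F"
  proof (rule abelian_groupI)
    fix f assume f: "f \<in> carrier F"
    have "{b. \<ominus> f b \<noteq> \<zero>} \<subseteq> {b. f b \<noteq> \<zero>}" by auto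
    with f have "(\<lambda>b. \<ominus> f b) \<in> carrier F"
      by (auto simp: carrier_free intro: finite_subset)
    moreover have "(\<lambda>b. \<ominus> f b) \<oplus>\<^bsub>F\<^esub> f = \<zero>\<^bsub>F\<^esub>"
      using f by (auto simp: free_module_simps carrier_free R.l_neg)
    ultimately show "\<exists>g\<in>carrier F. g \<oplus>\<^bsub>F\<^esub> f = \<zero>\<^bsub>F\<^esub>" by blast
  next
    fix f g assume "f \<in> carrier F" "g \<in> carrier F"
    then show "f \<oplus>\<^bsub>F\<^esub> g \<in> carrier F"
      by (auto simp: carrier_free free_module_simps intro: finite_subset[OF add_support])
  qed (auto simp: carrier_free free_module_simps R.a_ac fun_eq_iff)
next
  fix a f assume "a \<in> carrier R" "f \<in> carrier F"
  then show "a \<odot>\<^bsub>F\<^esub> f \<in> carrier F"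
    by (auto simp: carrier_free free_module_simps intro: finite_subset[OF smult_support])
qed (auto simp: carrier_free free_module_simps R.l_distr R.r_distr R.m_assoc fun_eq_iff
      intro: R.is_cring)

sublocale F: plain_module R F
  using module_free by (simp add: plain_module_def)

lemma basis_closed [simp, intro]: "b \<in> B \<Longrightarrow> basis_vec R b \<in> carrier F"
  by (auto simp: carrier_free basis_vec_def)

text \<open>A submodule that contains the basis is everything, by induction on the support.\<close>

lemma basis_spans:
  assumes N: "submodule N R F" and basis: "\<And>b. b \<in> B \<Longrightarrow> basis_vec R b \<in> N"
    and f: "f \<in> carrier F"
  shows "f \<in> N"
proof -
  have "finite {b. f b \<noteq> \<zero>}" using f by (simp add: carrier_free)
  then show ?thesis using f
  proof (induction "{b. f b \<noteq> \<zero>}" arbitrary: f rule: finite_induct)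
    case empty
    then have "f = \<zero>\<^bsub>F\<^esub>" by (auto simp: free_module_simps)
    then show ?case using F.submodule_zero[OF N] by simp
  next
    case (insert b S)
    have fb: "f b \<in> carrier R" "b \<in> B"
      using insert.prems insert.hyps(4) by (auto simp: carrier_free)
    define g where "g = f(b := \<zero>)"
    have supp: "{c. g c \<noteq> \<zero>} = S" using insert.hyps(2,4) by (auto simp: g_def)
    then have g: "g \<in> carrier F"
      using insert.prems insert.hyps(1) by (auto simp: carrier_free g_def)
    have "f = (f b \<odot>\<^bsub>F\<^esub> basis_vec R b) \<oplus>\<^bsub>F\<^esub> g"
      using insert.prems by (auto simp: free_module_simps basis_vec_def g_def carrier_free)
    moreover have "g \<in> N" using insert.hyps(3)[OF supp[symmetric] g] .
    ultimately show ?case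
      using F.submoduleE(4,5)[OF N] basis fb by metis
  qed
qed

lemma linear_map_eqI:
  assumes "linear_map R F V f" "linear_map R F V g"
    and "\<And>b. b \<in> B \<Longrightarrow> f (basis_vec R b) = g (basis_vec R b)" and "x \<in> carrier F"
  shows "f x = g x"
proof -
  interpret f: linear_map R F V f by fact
  interpret g: linear_map R F V g by fact
  have "submodule {x \<in> carrier F. f x = g x} R F"
    by (rule F.submoduleI) (auto simp: f.neg g.neg f.add g.add f.smult g.smult)
  from basis_spans[OF this] show ?thesis using assms(3,4) by auto
qed

lemma lin_extend_superset:
  assumes V: "module R V" and f: "f \<in> carrier F" and g: "g \<in> B \<rightarrow> carrier V"
    and S: "finite S" "{b. f b \<noteq> \<zero>} \<subseteq> S" "S \<subseteq> B"
  shows "lin_extend R V g f = (\<Oplus>\<^bsub>V\<^esub>b\<in>S. f b \<odot>\<^bsub>V\<^esub> g b)"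
proof -
  interpret V: module R V by fact
  show ?thesis unfolding lin_extend_def
    by (rule V.add.finprod_mono_neutral_cong_left) (use S g f in \<open>auto simp: carrier_free Pi_iff subset_iff\<close>)
qed

lemma lin_extend_linear:
  assumes V: "module R V" and g: "g \<in> B \<rightarrow> carrier V"
  shows "linear_map R F V (lin_extend R V g)"
proof -
  interpret V: module R V by fact
  have supp: "finite {b. f b \<noteq> \<zero>}" "{b. f b \<noteq> \<zero>} \<subseteq> B" if "f \<in> carrier F" for f
    using that by (auto simp: carrier_free)
  have coeff: "f b \<in> carrier R" if "f \<in> carrier F" for f b
    using that by (auto simp: carrier_free)
  have fg: "(\<lambda>b. f b \<odot>\<^bsub>V\<^esub> g b) \<in> S \<rightarrow> carrier V" if "f \<in> carrier F" "S \<subseteq> B" for f S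
    using that g coeff by (auto simp: Pi_iff subset_iff)
  show ?thesis
  proof (rule linear_mapI)
    fix f h assume fh: "f \<in> carrier F" "h \<in> carrier F"
    define S where "S = {b. f b \<noteq> \<zero>} \<union> {b. h b \<noteq> \<zero>}"
    have S: "finite S" "S \<subseteq> B" using fh supp by (auto simp: S_def)
    have "lin_extend R V g (f \<oplus>\<^bsub>F\<^esub> h) = (\<Oplus>\<^bsub>V\<^esub>b\<in>S. (f \<oplus>\<^bsub>F\<^esub> h) b \<odot>\<^bsub>V\<^esub> g b)"
      using S F.a_closed[OF fh]
      by (intro lin_extend_superset V g) (auto simp: fh free_module_simps S_def)
    also have "\<dots> = (\<Oplus>\<^bsub>V\<^esub>b\<in>S. f b \<odot>\<^bsub>V\<^esub> g b \<oplus>\<^bsub>V\<^esub> h b \<odot>\<^bsub>V\<^esub> g b)"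
      using S g fh
      by (intro V.add.finprod_cong')
        (auto simp: free_module_simps V.smult_l_distr coeff Pi_iff subset_iff)
    also have "\<dots> = (\<Oplus>\<^bsub>V\<^esub>b\<in>S. f b \<odot>\<^bsub>V\<^esub> g b) \<oplus>\<^bsub>V\<^esub> (\<Oplus>\<^bsub>V\<^esub>b\<in>S. h b \<odot>\<^bsub>V\<^esub> g b)"
      using fg[OF fh(1) S(2)] fg[OF fh(2) S(2)] by (rule V.finsum_addf)
    also have "\<dots> = lin_extend R V g f \<oplus>\<^bsub>V\<^esub> lin_extend R V g h"
      using S fh by (simp add: lin_extend_superset[OF V _ g, of _ S] S_def)
    finally show "lin_extend R V g (f \<oplus>\<^bsub>F\<^esub> h) = lin_extend R V g f \<oplus>\<^bsub>V\<^esub> lin_extend R V g h" .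
  next
    fix a f assume a: "a \<in> carrier R" and f: "f \<in> carrier F"
    define S where "S = {b. f b \<noteq> \<zero>}"
    have S: "finite S" "S \<subseteq> B" using f supp by (auto simp: S_def)
    have "lin_extend R V g (a \<odot>\<^bsub>F\<^esub> f) = (\<Oplus>\<^bsub>V\<^esub>b\<in>S. (a \<odot>\<^bsub>F\<^esub> f) b \<odot>\<^bsub>V\<^esub> g b)"
      using S a F.smult_closed[OF a f]
      by (intro lin_extend_superset V g) (auto simp: f free_module_simps S_def)
    also have "\<dots> = (\<Oplus>\<^bsub>V\<^esub>b\<in>S. a \<odot>\<^bsub>V\<^esub> (f b \<odot>\<^bsub>V\<^esub> g b))"
      using S g f a
      by (intro V.add.finprod_cong')
        (auto simp: free_module_simps V.smult_assoc1 coeff Pi_iff subset_iff)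
    also have "\<dots> = a \<odot>\<^bsub>V\<^esub> lin_extend R V g f"
      using S fg[OF f S(2)] a f
      by (simp add: lin_extend_superset[OF V _ g, of _ S] S_def V.finsum_smult_ldistr)
    finally show "lin_extend R V g (a \<odot>\<^bsub>F\<^esub> f) = a \<odot>\<^bsub>V\<^esub> lin_extend R V g f" .
  next
    fix f assume f: "f \<in> carrier F"
    then show "lin_extend R V g f \<in> carrier V"
      unfolding lin_extend_def by (intro V.finsum_closed fg) (use supp in auto)
  qed (rule V module_free)+
qed

lemma lin_extend_basis:
  assumes V: "module R V" and g: "g \<in> B \<rightarrow> carrier V" and b: "b \<in> B"
  shows "lin_extend R V g (basis_vec R b) = g b"
proof -
  interpret V: module R V by fact
  have "lin_extend R V g (basis_vec R b) = (\<Oplus>\<^bsub>V\<^esub>c\<in>{b}. basis_vec R b c \<odot>\<^bsub>V\<^esub> g c)"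
    using b basis_closed[OF b] by (intro lin_extend_superset V g) (auto simp: basis_vec_def)
  also have "\<dots> = g b" using b g by (auto simp: basis_vec_def Pi_iff)
  finally show ?thesis .
qed

text \<open>The same universal property for targets that carry additional structure.\<close>

lemma free_lift:
  fixes V :: "('k, 'v, 'more) module_scheme"
  assumes "module R V" and g: "g \<in> B \<rightarrow> carrier V"
  obtains h where "linear_map R F V h" "\<And>b. b \<in> B \<Longrightarrow> h (basis_vec R b) = g b"
proof -
  interpret V: module R V by fact
  define U where "U = module.truncate V"
  have U: "carrier U = carrier V" "add U = add V" "zero U = zero V" "smult U = smult V"
    by (simp_all add: U_def module.defs)
  have "module R U"
  proof (rule moduleI)
    show "abelian_group U"
      by (rule abelian_groupI) (auto simp: U V.a_ac V.add.l_inv_ex)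
  qed (auto simp: U V.smult_l_distr V.smult_r_distr V.smult_assoc1 intro: is_cring)
  moreover have "g \<in> B \<rightarrow> carrier U" using g by (simp add: U)
  ultimately have "linear_map R F U (lin_extend R U g)"
      "\<And>b. b \<in> B \<Longrightarrow> lin_extend R U g (basis_vec R b) = g b"
    by (simp_all add: lin_extend_linear lin_extend_basis)
  then have "linear_map R F V (lin_extend R U g)"
    using V.module_axioms by (simp add: linear_map_def U)
  then show thesis using that \<open>\<And>b. b \<in> B \<Longrightarrow> lin_extend R U g (basis_vec R b) = g b\<close> by blast
qed

end


section \<open>Exterior powers and low-degree homology\<close>

context hom_lie_algebra
begin

text \<open>\<open>T n\<close> is the free module on \<open>n\<close>-tuples, \<open>W n\<close> its submodule of wedge relations, so that
  \<open>T n\<close> modulo \<open>W n\<close> is the \<open>n\<close>-th exterior power, and \<open>e xs\<close> is the basis vector of a tuple.\<close>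
abbreviation "T \<equiv> tuple_module R L"
abbreviation "W \<equiv> wedge_kernel R L"
abbreviation e :: "'v list \<Rightarrow> 'v list \<Rightarrow> 'k" where "e \<equiv> basis_vec R"

lemma free_space_tuples: "free_space R"
  by (simp add: free_space_def R.is_cring)

lemma plain_module_tuples: "plain_module R (T n)"
  by (simp add: plain_module_def free_space.module_free free_space_tuples)

lemmas module_tuples = plain_module_tuples[unfolded plain_module_def]

lemma e_closed [simp]: "xs \<in> tuples L n \<Longrightarrow> e xs \<in> carrier (T n)"
  by (rule free_space.basis_closed[OF free_space_tuples])

lemma tuples_Nil [simp]: "[] \<in> tuples L 0"
  by (simp add: tuples_def)

lemma tuples_Cons [simp]: "x # xs \<in> tuples L (Suc n) \<longleftrightarrow> x \<in> carrier L \<and> xs \<in> tuples L n"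
  by (auto simp: tuples_def)

lemma slot_closed:
  assumes "us @ x # vs \<in> tuples L n"
  shows "x \<in> carrier L"
    and "y \<in> carrier L \<Longrightarrow> us @ y # vs \<in> tuples L n"
  using assms by (auto simp: tuples_def)

lemma wedge_relations_closed: "wedge_relations R L n \<subseteq> carrier (T n)"
proof -
  interpret T: module R "T n" by (rule module_tuples)
  show ?thesis
    unfolding wedge_relations_def
    by (auto intro!: T.minus_closed T.a_closed T.smult_closed e_closed intro: slot_closed)
qed

lemma wedge_relations_in: "wedge_relations R L n \<subseteq> W n"
  unfolding wedge_kernel_def by (rule plain_module.span_superset[OF plain_module_tuples])

lemma quotient_space_wedge: "quotient_space R (T n) (W n)"
  unfolding quotient_space_def quotient_space_axioms_def wedge_kernel_def
  using plain_module.span_submodule[OF plain_module_tuples wedge_relations_closed]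
    plain_module_tuples by blast

lemmas wedge_submodule = quotient_space.N[OF quotient_space_wedge]

text \<open>A linear map on tuples that is multilinear and alternating vanishes on the wedge relations.\<close>

lemma wedge_kernel_vanish:
  assumes F: "linear_map R (T n) V F"
    and add: "\<And>us vs x y. \<lbrakk>us @ x # vs \<in> tuples L n; us @ y # vs \<in> tuples L n\<rbrakk> \<Longrightarrow>
      F (e (us @ (x \<oplus>\<^bsub>L\<^esub> y) # vs)) = F (e (us @ x # vs)) \<oplus>\<^bsub>V\<^esub> F (e (us @ y # vs))"
    and smult: "\<And>us vs a x. \<lbrakk>a \<in> carrier R; us @ x # vs \<in> tuples L n\<rbrakk> \<Longrightarrow>
      F (e (us @ (a \<odot>\<^bsub>L\<^esub> x) # vs)) = a \<odot>\<^bsub>V\<^esub> F (e (us @ x # vs))"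
    and alt: "\<And>xs. \<lbrakk>xs \<in> tuples L n; \<not> distinct xs\<rbrakk> \<Longrightarrow> F (e xs) = \<zero>\<^bsub>V\<^esub>"
    and f: "f \<in> W n"
  shows "F f = \<zero>\<^bsub>V\<^esub>"
proof -
  interpret F: linear_map R "T n" V F by (rule F)
  interpret T: module R "T n" by (rule module_tuples)
  interpret V: module R V by (rule F.module_codomain)
  have "wedge_relations R L n \<subseteq> {f \<in> carrier (T n). F f = \<zero>\<^bsub>V\<^esub>}"
  proof
    fix r assume r: "r \<in> wedge_relations R L n"
    then have "F r = \<zero>\<^bsub>V\<^esub>"
      unfolding wedge_relations_def
    proof (elim UnE CollectE exE conjE)
      fix us vs x y assume r: "r = e (us @ (x \<oplus>\<^bsub>L\<^esub> y) # vs) \<ominus>\<^bsub>T n\<^esub> (e (us @ x # vs) \<oplus>\<^bsub>T n\<^esub> e (us @ y # vs))"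
        and t: "us @ x # vs \<in> tuples L n" "us @ y # vs \<in> tuples L n"
      have "us @ (x \<oplus>\<^bsub>L\<^esub> y) # vs \<in> tuples L n"
        using t slot_closed by (metis M.a_closed)
      then show "F r = \<zero>\<^bsub>V\<^esub>"
        using t unfolding r by (simp add: F.diff F.add add V.minus_eq_zero_iff)
    next
      fix us vs a x assume r: "r = e (us @ (a \<odot>\<^bsub>L\<^esub> x) # vs) \<ominus>\<^bsub>T n\<^esub> (a \<odot>\<^bsub>T n\<^esub> e (us @ x # vs))"
        and t: "a \<in> carrier R" "us @ x # vs \<in> tuples L n"
      have "us @ (a \<odot>\<^bsub>L\<^esub> x) # vs \<in> tuples L n"
        using t slot_closed by (metis L.smult_closed)
      then show "F r = \<zero>\<^bsub>V\<^esub>"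
        using t unfolding r by (simp add: F.diff F.smult smult V.minus_eq_zero_iff)
    qed (simp add: alt)
    then show "r \<in> {f \<in> carrier (T n). F f = \<zero>\<^bsub>V\<^esub>}"
      using r wedge_relations_closed by blast
  qed
  then have "W n \<subseteq> {f \<in> carrier (T n). F f = \<zero>\<^bsub>V\<^esub>}"
    unfolding wedge_kernel_def
    by (rule plain_module.span_least[OF plain_module_tuples F.kernel_submodule])
  then show ?thesis using f by blast
qed

text \<open>Conversely, any linear map that vanishes on the wedge relations is multilinear and
  alternating on tuples.\<close>

lemma
  assumes F: "linear_map R (T n) V F" and "\<And>f. f \<in> wedge_relations R L n \<Longrightarrow> F f = \<zero>\<^bsub>V\<^esub>"
  shows vanish_add: "\<And>us vs x y. \<lbrakk>us @ x # vs \<in> tuples L n; us @ y # vs \<in> tuples L n\<rbrakk> \<Longrightarrow>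
      F (e (us @ (x \<oplus>\<^bsub>L\<^esub> y) # vs)) = F (e (us @ x # vs)) \<oplus>\<^bsub>V\<^esub> F (e (us @ y # vs))"
    and vanish_smult: "\<And>us vs a x. \<lbrakk>a \<in> carrier R; us @ x # vs \<in> tuples L n\<rbrakk> \<Longrightarrow>
      F (e (us @ (a \<odot>\<^bsub>L\<^esub> x) # vs)) = a \<odot>\<^bsub>V\<^esub> F (e (us @ x # vs))"
    and vanish_alt: "\<And>xs. \<lbrakk>xs \<in> tuples L n; \<not> distinct xs\<rbrakk> \<Longrightarrow> F (e xs) = \<zero>\<^bsub>V\<^esub>"
proof -
  interpret F: linear_map R "T n" V F by (rule F)
  interpret T: module R "T n" by (rule module_tuples)
  interpret V: module R V by (rule F.module_codomain)
  {
    fix us vs x y assume t: "us @ x # vs \<in> tuples L n" "us @ y # vs \<in> tuples L n"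
    then have s: "us @ (x \<oplus>\<^bsub>L\<^esub> y) # vs \<in> tuples L n" using slot_closed by (metis M.a_closed)
    have "e (us @ (x \<oplus>\<^bsub>L\<^esub> y) # vs) \<ominus>\<^bsub>T n\<^esub> (e (us @ x # vs) \<oplus>\<^bsub>T n\<^esub> e (us @ y # vs)) \<in> wedge_relations R L n"
      unfolding wedge_relations_def using t by blast
    from assms(2)[OF this] s t
    show "F (e (us @ (x \<oplus>\<^bsub>L\<^esub> y) # vs)) = F (e (us @ x # vs)) \<oplus>\<^bsub>V\<^esub> F (e (us @ y # vs))"
      by (simp add: F.diff F.add V.minus_eq_zero_iff)
  next
    fix us vs a x assume t: "a \<in> carrier R" "us @ x # vs \<in> tuples L n"
    then have s: "us @ (a \<odot>\<^bsub>L\<^esub> x) # vs \<in> tuples L n" using slot_closed by (metis L.smult_closed)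
    have "e (us @ (a \<odot>\<^bsub>L\<^esub> x) # vs) \<ominus>\<^bsub>T n\<^esub> (a \<odot>\<^bsub>T n\<^esub> e (us @ x # vs)) \<in> wedge_relations R L n"
      unfolding wedge_relations_def using t by blast
    from assms(2)[OF this] s t
    show "F (e (us @ (a \<odot>\<^bsub>L\<^esub> x) # vs)) = a \<odot>\<^bsub>V\<^esub> F (e (us @ x # vs))"
      by (simp add: F.diff F.smult V.minus_eq_zero_iff)
  next
    fix xs assume t: "xs \<in> tuples L n" "\<not> distinct xs"
    then have "e xs \<in> wedge_relations R L n" unfolding wedge_relations_def by blast
    then show "F (e xs) = \<zero>\<^bsub>V\<^esub>" by (rule assms(2))
  }
qed


subsection \<open>The differential\<close>

text \<open>\<open>D n : T (n + 1) \<rightarrow> T n\<close> is the differential before passing to exterior powers.\<close>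
definition D :: "nat \<Rightarrow> ('v list \<Rightarrow> 'k) \<Rightarrow> 'v list \<Rightarrow> 'k" where
  "D n = lin_extend R (T n) (d_tuple R L)"

lemma face_closed:
  assumes xs: "xs \<in> tuples L (Suc n)" and ij: "i < j" "j < length xs"
  shows "bracket L (xs ! i) (xs ! j) # map (twist L) (nths xs (- {i, j})) \<in> tuples L n"
proof -
  have "{k. k < length xs \<and> k \<in> - {i, j}} = {..<length xs} - {i, j}" by auto
  moreover have "card ({..<length xs} - {i, j}) = length xs - 2"
    using ij by (simp add: card_Diff_subset)
  ultimately have "length (nths xs (- {i, j})) = length xs - 2"
    by (simp add: length_nths)
  moreover have "set (nths xs (- {i, j})) \<subseteq> carrier L"
    using xs set_nths_subset[of xs "- {i, j}"] by (auto simp: tuples_def)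
  moreover have "xs ! i \<in> carrier L" "xs ! j \<in> carrier L"
    using xs ij nth_mem by (auto simp: tuples_def subset_iff)
  ultimately show ?thesis
    using xs ij by (auto simp: tuples_def bracket_closed twist_closed)
qed

lemma sign_closed [simp]: "(\<ominus>\<^bsub>R\<^esub> \<one>\<^bsub>R\<^esub>) [^]\<^bsub>R\<^esub> (k :: nat) \<in> carrier R"
  by simp

lemma d_tuple_closed: "xs \<in> tuples L (Suc n) \<Longrightarrow> d_tuple R L xs \<in> carrier (T n)"
proof -
  assume xs: "xs \<in> tuples L (Suc n)"
  interpret T: module R "T n" by (rule module_tuples)
  have len: "length xs - 1 = n" using xs by (simp add: tuples_def)
  show ?thesis
    unfolding d_tuple_def len
    by (rule T.finsum_closed) (use face_closed[OF xs] in \<open>auto intro!: T.smult_closed e_closed\<close>)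
qed

lemma D_linear: "linear_map R (T (Suc n)) (T n) (D n)"
  unfolding D_def
  by (rule free_space.lin_extend_linear[OF free_space_tuples module_tuples])
    (auto intro: d_tuple_closed)

lemma D_e: "xs \<in> tuples L (Suc n) \<Longrightarrow> D n (e xs) = d_tuple R L xs"
  unfolding D_def
  by (rule free_space.lin_extend_basis[OF free_space_tuples module_tuples])
    (auto intro: d_tuple_closed)

lemma d_tuple_1: "d_tuple R L [x] = \<zero>\<^bsub>T 0\<^esub>"
proof -
  interpret T: module R "T 0" by (rule module_tuples)
  have "{(i, j). i < j \<and> j < length [x]} = {}" by auto
  then show ?thesis by (simp only: d_tuple_def T.finsum_empty list.size) simp
qed

lemma index_pairs_2: "{(i, j). i < j \<and> j < length [x, y]} = {(0, 1)}"
  by (auto simp: less_Suc_eq)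

lemma index_pairs_3: "{(i, j). i < j \<and> j < length [x, y, z]} = {(0, 1), (0, 2), (1, 2)}"
  by (auto simp: less_Suc_eq)

lemma d_tuple_2:
  assumes "x \<in> carrier L" "y \<in> carrier L"
  shows "d_tuple R L [x, y] = \<ominus>\<^bsub>T (Suc 0)\<^esub> e [bracket L x y]"
proof -
  interpret T: module R "T (Suc 0)" by (rule module_tuples)
  have c: "e [bracket L x y] \<in> carrier (T (Suc 0))"
    using assms by (simp add: bracket_closed)
  then show ?thesis
    unfolding d_tuple_def index_pairs_2
    by (simp add: nths_Cons T.smult_l_minus)
qed

lemma d_tuple_3:
  assumes "x \<in> carrier L" "y \<in> carrier L" "z \<in> carrier L"
  shows "d_tuple R L [x, y, z] =
    \<ominus>\<^bsub>T (Suc (Suc 0))\<^esub> e [bracket L x y, twist L z]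
      \<oplus>\<^bsub>T (Suc (Suc 0))\<^esub> (e [bracket L x z, twist L y]
      \<oplus>\<^bsub>T (Suc (Suc 0))\<^esub> \<ominus>\<^bsub>T (Suc (Suc 0))\<^esub> e [bracket L y z, twist L x])"
proof -
  interpret T: module R "T (Suc (Suc 0))" by (rule module_tuples)
  have c: "e [bracket L x y, twist L z] \<in> carrier (T (Suc (Suc 0)))"
    "e [bracket L x z, twist L y] \<in> carrier (T (Suc (Suc 0)))"
    "e [bracket L y z, twist L x] \<in> carrier (T (Suc (Suc 0)))"
    using assms by (simp_all add: bracket_closed twist_closed)
  show ?thesis
    unfolding d_tuple_def index_pairs_3
    using c by (simp add: nths_Cons numeral_2_eq_2 R.l_minus R.r_minus T.smult_l_minus)
qed


text \<open>The class of a formal sum of tuples in the exterior power.\<close>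
abbreviation cls :: "nat \<Rightarrow> ('v list \<Rightarrow> 'k) \<Rightarrow> ('v list \<Rightarrow> 'k) set"
  where "cls n f \<equiv> W n +>\<^bsub>T n\<^esub> f"

lemmas module_ext_power = quotient_space.module_quot[OF quotient_space_wedge, folded ext_power_def]
lemmas cls_linear = quotient_space.proj_linear[OF quotient_space_wedge, folded ext_power_def]
lemmas cls_zero_iff = quotient_space.proj_eq_zero_iff[OF quotient_space_wedge, folded ext_power_def]

lemma cls_relation: "f \<in> wedge_relations R L n \<Longrightarrow> cls n f = \<zero>\<^bsub>ext_power R L n\<^esub>"
  using wedge_relations_in wedge_relations_closed cls_zero_iff by blast

lemmas cls_add = vanish_add[OF cls_linear cls_relation]
lemmas cls_smult = vanish_smult[OF cls_linear cls_relation]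

lemma slot_1: "us @ x # vs \<in> tuples L (Suc 0) \<Longrightarrow> us = [] \<and> vs = []"
  by (auto simp: tuples_def)

lemma slot_2:
  assumes "us @ x # vs \<in> tuples L (Suc (Suc 0))"
  obtains y where "us = []" "vs = [y]" "y \<in> carrier L"
    | y where "us = [y]" "vs = []" "y \<in> carrier L"
proof -
  have "length us + length vs = Suc 0" using assms by (simp add: tuples_def)
  then consider "length us = 0" "length vs = Suc 0" | "length us = Suc 0" "length vs = 0"
    by linarith
  then show thesis using assms that by cases (auto simp: length_Suc_conv tuples_def)
qed

lemma slot_3:
  assumes "us @ x # vs \<in> tuples L (Suc (Suc (Suc 0)))"
  obtains y z where "us = []" "vs = [y, z]" "y \<in> carrier L" "z \<in> carrier L"
    | y z where "us = [y]" "vs = [z]" "y \<in> carrier L" "z \<in> carrier L"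
    | y z where "us = [y, z]" "vs = []" "y \<in> carrier L" "z \<in> carrier L"
proof -
  have "length us + length vs = Suc (Suc 0)" using assms by (simp add: tuples_def)
  then consider "length us = 0" "length vs = Suc (Suc 0)" | "length us = Suc 0" "length vs = Suc 0"
    | "length us = Suc (Suc 0)" "length vs = 0"
    by linarith
  then show thesis using assms that by cases (auto simp: length_Suc_conv tuples_def)
qed

lemma tuples_1E:
  assumes "xs \<in> tuples L (Suc 0)" obtains x where "xs = [x]" "x \<in> carrier L"
  using assms that by (auto simp: tuples_def length_Suc_conv)

lemma tuples_2E:
  assumes "xs \<in> tuples L (Suc (Suc 0))"
  obtains x y where "xs = [x, y]" "x \<in> carrier L" "y \<in> carrier L"
  using assms that by (auto simp: tuples_def length_Suc_conv)

lemma tuples_3E: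
  assumes "xs \<in> tuples L (Suc (Suc (Suc 0)))"
  obtains x y z where "xs = [x, y, z]" "x \<in> carrier L" "y \<in> carrier L" "z \<in> carrier L"
  using assms that by (auto simp: tuples_def length_Suc_conv)

lemma wedge_1_vanish:
  assumes F: "linear_map R (T (Suc 0)) V F"
    and b: "\<And>x. x \<in> carrier L \<Longrightarrow> F (e [x]) = b x"
    and "\<And>x y. \<lbrakk>x \<in> carrier L; y \<in> carrier L\<rbrakk> \<Longrightarrow> b (x \<oplus>\<^bsub>L\<^esub> y) = b x \<oplus>\<^bsub>V\<^esub> b y"
    and "\<And>a x. \<lbrakk>a \<in> carrier R; x \<in> carrier L\<rbrakk> \<Longrightarrow> b (a \<odot>\<^bsub>L\<^esub> x) = a \<odot>\<^bsub>V\<^esub> b x"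
    and f: "f \<in> W (Suc 0)"
  shows "F f = \<zero>\<^bsub>V\<^esub>"
proof (rule wedge_kernel_vanish[OF F _ _ _ f])
  fix xs assume "xs \<in> tuples L (Suc 0)" "\<not> distinct xs"
  then show "F (e xs) = \<zero>\<^bsub>V\<^esub>" by (auto elim!: tuples_1E)
next
  fix us vs x y
  assume t: "us @ x # vs \<in> tuples L (Suc 0)" "us @ y # vs \<in> tuples L (Suc 0)"
  then have "x \<in> carrier L" "y \<in> carrier L" using slot_closed(1) by blast+
  then show "F (e (us @ (x \<oplus>\<^bsub>L\<^esub> y) # vs)) = F (e (us @ x # vs)) \<oplus>\<^bsub>V\<^esub> F (e (us @ y # vs))"
    using slot_1[OF t(1)] by (simp add: assms(2,3))
next
  fix us vs a x
  assume t: "us @ x # vs \<in> tuples L (Suc 0)" and a: "a \<in> carrier R"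
  then have "x \<in> carrier L" using slot_closed(1) by blast
  then show "F (e (us @ (a \<odot>\<^bsub>L\<^esub> x) # vs)) = a \<odot>\<^bsub>V\<^esub> F (e (us @ x # vs))"
    using a slot_1[OF t] by (simp add: assms(2,4))
qed

lemma wedge_2_vanish:
  assumes F: "linear_map R (T (Suc (Suc 0))) V F"
    and b: "\<And>x y. \<lbrakk>x \<in> carrier L; y \<in> carrier L\<rbrakk> \<Longrightarrow> F (e [x, y]) = b x y"
    and add: "\<And>x y z. \<lbrakk>x \<in> carrier L; y \<in> carrier L; z \<in> carrier L\<rbrakk> \<Longrightarrow> b (x \<oplus>\<^bsub>L\<^esub> y) z = b x z \<oplus>\<^bsub>V\<^esub> b y z"
      "\<And>x y z. \<lbrakk>x \<in> carrier L; y \<in> carrier L; z \<in> carrier L\<rbrakk> \<Longrightarrow> b z (x \<oplus>\<^bsub>L\<^esub> y) = b z x \<oplus>\<^bsub>V\<^esub> b z y"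
    and smult: "\<And>a x y. \<lbrakk>a \<in> carrier R; x \<in> carrier L; y \<in> carrier L\<rbrakk> \<Longrightarrow> b (a \<odot>\<^bsub>L\<^esub> x) y = a \<odot>\<^bsub>V\<^esub> b x y"
      "\<And>a x y. \<lbrakk>a \<in> carrier R; x \<in> carrier L; y \<in> carrier L\<rbrakk> \<Longrightarrow> b y (a \<odot>\<^bsub>L\<^esub> x) = a \<odot>\<^bsub>V\<^esub> b y x"
    and alt: "\<And>x. x \<in> carrier L \<Longrightarrow> b x x = \<zero>\<^bsub>V\<^esub>"
    and f: "f \<in> W (Suc (Suc 0))"
  shows "F f = \<zero>\<^bsub>V\<^esub>"
proof (rule wedge_kernel_vanish[OF F _ _ _ f])
  fix xs assume "xs \<in> tuples L (Suc (Suc 0))" "\<not> distinct xs"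
  then show "F (e xs) = \<zero>\<^bsub>V\<^esub>" by (auto elim!: tuples_2E simp: b alt)
next
  fix us vs x y
  assume t: "us @ x # vs \<in> tuples L (Suc (Suc 0))" "us @ y # vs \<in> tuples L (Suc (Suc 0))"
  then have "x \<in> carrier L" "y \<in> carrier L" using slot_closed(1) by blast+
  then show "F (e (us @ (x \<oplus>\<^bsub>L\<^esub> y) # vs)) = F (e (us @ x # vs)) \<oplus>\<^bsub>V\<^esub> F (e (us @ y # vs))"
    by (cases rule: slot_2[OF t(1)]) (simp_all add: b add)
next
  fix us vs a x
  assume t: "us @ x # vs \<in> tuples L (Suc (Suc 0))" and a: "a \<in> carrier R"
  then have "x \<in> carrier L" using slot_closed(1) by blast
  then show "F (e (us @ (a \<odot>\<^bsub>L\<^esub> x) # vs)) = a \<odot>\<^bsub>V\<^esub> F (e (us @ x # vs))"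
    using a by (cases rule: slot_2[OF t]) (simp_all add: b smult)
qed

lemma D_0: 
  assumes "f \<in> carrier (T (Suc 0))" shows "D 0 f = \<zero>\<^bsub>T 0\<^esub>"
proof -
  interpret D: linear_map R "T (Suc 0)" "T 0" "D 0" by (rule D_linear)
  have "f \<in> {f \<in> carrier (T (Suc 0)). D 0 f = \<zero>\<^bsub>T 0\<^esub>}"
    by (rule free_space.basis_spans[OF free_space_tuples D.kernel_submodule _ assms])
      (auto elim!: tuples_1E simp: D_e d_tuple_1)
  then show ?thesis by simp
qed

lemma
  shows cls_1_closed: "x \<in> carrier L \<Longrightarrow> cls (Suc 0) (e [x]) \<in> carrier (ext_power R L (Suc 0))"
    and cls_1_add: "\<lbrakk>x \<in> carrier L; y \<in> carrier L\<rbrakk> \<Longrightarrow>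
      cls (Suc 0) (e [x \<oplus>\<^bsub>L\<^esub> y]) = cls (Suc 0) (e [x]) \<oplus>\<^bsub>ext_power R L (Suc 0)\<^esub> cls (Suc 0) (e [y])"
    and cls_1_smult: "\<lbrakk>a \<in> carrier R; x \<in> carrier L\<rbrakk> \<Longrightarrow>
      cls (Suc 0) (e [a \<odot>\<^bsub>L\<^esub> x]) = a \<odot>\<^bsub>ext_power R L (Suc 0)\<^esub> cls (Suc 0) (e [x])"
  using cls_add[where us = "[]" and vs = "[]" and n = "Suc 0" and x = x and y = y]
    cls_smult[where us = "[]" and vs = "[]" and n = "Suc 0" and x = x and a = a]
  by (simp_all add: linear_map.closed[OF cls_linear])

end

text \<open>Skew-symmetry gives \<open>[x, x] = 0\<close> only if \<open>2\<close> is invertible. The differential respects repeated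
  entries, and hence exterior powers, because of this identity.\<close>
locale hom_lie_alternating = hom_lie_algebra +
  assumes bracket_self: "x \<in> carrier L \<Longrightarrow> bracket L x x = \<zero>\<^bsub>L\<^esub>"
begin

lemma D_1_wedge:
  assumes f: "f \<in> W (Suc (Suc 0))"
  shows "D (Suc 0) f \<in> W (Suc 0)"
proof -
  let ?E = "ext_power R L (Suc 0)"
  let ?c = "\<lambda>x. cls (Suc 0) (e [x])"
  interpret E: module R ?E by (rule module_ext_power)
  interpret c: linear_map R "T (Suc 0)" ?E "cls (Suc 0)" by (rule cls_linear)
  have c_add: "?c (x \<oplus>\<^bsub>L\<^esub> y) = ?c x \<oplus>\<^bsub>?E\<^esub> ?c y" if "x \<in> carrier L" "y \<in> carrier L" for x y
    using that by (rule cls_1_add)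
  have c_smult: "?c (a \<odot>\<^bsub>L\<^esub> x) = a \<odot>\<^bsub>?E\<^esub> ?c x" if "a \<in> carrier R" "x \<in> carrier L" for a x
    using that by (rule cls_1_smult)
  have c_zero: "?c \<zero>\<^bsub>L\<^esub> = \<zero>\<^bsub>?E\<^esub>"
    using c_smult[of "\<zero>\<^bsub>R\<^esub>" "\<zero>\<^bsub>L\<^esub>"] cls_1_closed by simp
  have "cls (Suc 0) (D (Suc 0) f) = \<zero>\<^bsub>?E\<^esub>"
    by (rule wedge_2_vanish[OF linear_map_comp[OF D_linear cls_linear] _ _ _ _ _ _ f,
        of "\<lambda>x y. \<ominus>\<^bsub>?E\<^esub> ?c (bracket L x y)"])
      (simp_all add: D_e d_tuple_2 c.neg bracket_closed bracket_add_left bracket_add_right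
        bracket_smult_left bracket_smult_right bracket_self c_add c_smult c_zero
        E.minus_add E.smult_r_minus E.neg_zero cls_1_closed)
  moreover have "D (Suc 0) f \<in> carrier (T (Suc 0))"
    using f wedge_submodule linear_map.closed[OF D_linear] module.submoduleE(1)[OF module_tuples]
    by blast
  ultimately show ?thesis by (simp add: cls_zero_iff)
qed

end


context hom_lie_algebra
begin

lemma wedge_3_vanish:
  assumes F: "linear_map R (T (Suc (Suc (Suc 0)))) V F"
    and t: "\<And>x y z. \<lbrakk>x \<in> carrier L; y \<in> carrier L; z \<in> carrier L\<rbrakk> \<Longrightarrow> F (e [x, y, z]) = t x y z"
    and add: "\<And>x x' y z. \<lbrakk>x \<in> carrier L; x' \<in> carrier L; y \<in> carrier L; z \<in> carrier L\<rbrakk> \<Longrightarrow>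
        t (x \<oplus>\<^bsub>L\<^esub> x') y z = t x y z \<oplus>\<^bsub>V\<^esub> t x' y z"
      "\<And>x x' y z. \<lbrakk>x \<in> carrier L; x' \<in> carrier L; y \<in> carrier L; z \<in> carrier L\<rbrakk> \<Longrightarrow>
        t y (x \<oplus>\<^bsub>L\<^esub> x') z = t y x z \<oplus>\<^bsub>V\<^esub> t y x' z"
      "\<And>x x' y z. \<lbrakk>x \<in> carrier L; x' \<in> carrier L; y \<in> carrier L; z \<in> carrier L\<rbrakk> \<Longrightarrow>
        t y z (x \<oplus>\<^bsub>L\<^esub> x') = t y z x \<oplus>\<^bsub>V\<^esub> t y z x'"
    and smult: "\<And>a x y z. \<lbrakk>a \<in> carrier R; x \<in> carrier L; y \<in> carrier L; z \<in> carrier L\<rbrakk> \<Longrightarrow>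
        t (a \<odot>\<^bsub>L\<^esub> x) y z = a \<odot>\<^bsub>V\<^esub> t x y z"
      "\<And>a x y z. \<lbrakk>a \<in> carrier R; x \<in> carrier L; y \<in> carrier L; z \<in> carrier L\<rbrakk> \<Longrightarrow>
        t y (a \<odot>\<^bsub>L\<^esub> x) z = a \<odot>\<^bsub>V\<^esub> t y x z"
      "\<And>a x y z. \<lbrakk>a \<in> carrier R; x \<in> carrier L; y \<in> carrier L; z \<in> carrier L\<rbrakk> \<Longrightarrow>
        t y z (a \<odot>\<^bsub>L\<^esub> x) = a \<odot>\<^bsub>V\<^esub> t y z x"
    and alt: "\<And>x y. \<lbrakk>x \<in> carrier L; y \<in> carrier L\<rbrakk> \<Longrightarrow> t x x y = \<zero>\<^bsub>V\<^esub>"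
      "\<And>x y. \<lbrakk>x \<in> carrier L; y \<in> carrier L\<rbrakk> \<Longrightarrow> t x y x = \<zero>\<^bsub>V\<^esub>"
      "\<And>x y. \<lbrakk>x \<in> carrier L; y \<in> carrier L\<rbrakk> \<Longrightarrow> t y x x = \<zero>\<^bsub>V\<^esub>"
    and f: "f \<in> W (Suc (Suc (Suc 0)))"
  shows "F f = \<zero>\<^bsub>V\<^esub>"
proof (rule wedge_kernel_vanish[OF F _ _ _ f])
  fix xs assume "xs \<in> tuples L (Suc (Suc (Suc 0)))" "\<not> distinct xs"
  then show "F (e xs) = \<zero>\<^bsub>V\<^esub>" by (auto elim!: tuples_3E simp: t alt)
next
  fix us vs x y
  assume s: "us @ x # vs \<in> tuples L (Suc (Suc (Suc 0)))" "us @ y # vs \<in> tuples L (Suc (Suc (Suc 0)))"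
  then have "x \<in> carrier L" "y \<in> carrier L" using slot_closed(1) by blast+
  then show "F (e (us @ (x \<oplus>\<^bsub>L\<^esub> y) # vs)) = F (e (us @ x # vs)) \<oplus>\<^bsub>V\<^esub> F (e (us @ y # vs))"
    by (cases rule: slot_3[OF s(1)]) (simp_all add: t add)
next
  fix us vs a x
  assume s: "us @ x # vs \<in> tuples L (Suc (Suc (Suc 0)))" and a: "a \<in> carrier R"
  then have "x \<in> carrier L" using slot_closed(1) by blast
  then show "F (e (us @ (a \<odot>\<^bsub>L\<^esub> x) # vs)) = a \<odot>\<^bsub>V\<^esub> F (e (us @ x # vs))"
    using a by (cases rule: slot_3[OF s]) (simp_all add: t smult)
qed

lemma
  assumes F: "linear_map R (T (Suc (Suc 0))) V F"
    and rel: "\<And>r. r \<in> wedge_relations R L (Suc (Suc 0)) \<Longrightarrow> F r = \<zero>\<^bsub>V\<^esub>"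
    and xz: "x \<in> carrier L" "z \<in> carrier L"
  shows alternating_2_closed: "F (e [x, z]) \<in> carrier V"
    and alternating_2_alt: "F (e [x, x]) = \<zero>\<^bsub>V\<^esub>"
    and alternating_2_add_left: "y \<in> carrier L \<Longrightarrow> F (e [x \<oplus>\<^bsub>L\<^esub> y, z]) = F (e [x, z]) \<oplus>\<^bsub>V\<^esub> F (e [y, z])"
    and alternating_2_add_right: "y \<in> carrier L \<Longrightarrow> F (e [z, x \<oplus>\<^bsub>L\<^esub> y]) = F (e [z, x]) \<oplus>\<^bsub>V\<^esub> F (e [z, y])"
    and alternating_2_smult_left: "a \<in> carrier R \<Longrightarrow> F (e [a \<odot>\<^bsub>L\<^esub> x, z]) = a \<odot>\<^bsub>V\<^esub> F (e [x, z])"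
    and alternating_2_smult_right: "a \<in> carrier R \<Longrightarrow> F (e [z, a \<odot>\<^bsub>L\<^esub> x]) = a \<odot>\<^bsub>V\<^esub> F (e [z, x])"
  using xz
    vanish_add[OF F rel, where us = "[]" and vs = "[z]" and x = x and y = y]
    vanish_add[OF F rel, where us = "[z]" and vs = "[]" and x = x and y = y]
    vanish_smult[OF F rel, where us = "[]" and vs = "[z]" and x = x and a = a]
    vanish_smult[OF F rel, where us = "[z]" and vs = "[]" and x = x and a = a]
    vanish_alt[OF F rel, where xs = "[x, x]"]
  by (simp_all add: linear_map.closed[OF F])

lemma alternating_2_skew:
  assumes F: "linear_map R (T (Suc (Suc 0))) V F"
    and rel: "\<And>r. r \<in> wedge_relations R L (Suc (Suc 0)) \<Longrightarrow> F r = \<zero>\<^bsub>V\<^esub>"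
    and xy: "x \<in> carrier L" "y \<in> carrier L"
  shows "F (e [x, y]) = \<ominus>\<^bsub>V\<^esub> F (e [y, x])"
proof -
  interpret V: module R V by (rule linear_map.module_codomain[OF F])
  note alt = alternating_2_alt[OF F rel] and cl = alternating_2_closed[OF F rel]
    and add_left = alternating_2_add_left[OF F rel] and add_right = alternating_2_add_right[OF F rel]
  have "\<zero>\<^bsub>V\<^esub> = F (e [x \<oplus>\<^bsub>L\<^esub> y, x \<oplus>\<^bsub>L\<^esub> y])"
    using xy by (simp add: alt[of "x \<oplus>\<^bsub>L\<^esub> y" x])
  also have "\<dots> = (F (e [x, x]) \<oplus>\<^bsub>V\<^esub> F (e [y, x])) \<oplus>\<^bsub>V\<^esub> (F (e [x, y]) \<oplus>\<^bsub>V\<^esub> F (e [y, y]))"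
    using xy by (simp only: add_left add_right M.a_closed)
  also have "\<dots> = F (e [x, y]) \<oplus>\<^bsub>V\<^esub> F (e [y, x])"
    using xy cl by (simp add: alt[of x x] alt[of y y] V.a_comm)
  finally have "F (e [x, y]) \<oplus>\<^bsub>V\<^esub> F (e [y, x]) = \<zero>\<^bsub>V\<^esub>" by simp
  from V.minus_equality[OF this] xy cl show ?thesis by simp
qed

lemmas cls_2_closed = alternating_2_closed[OF cls_linear cls_relation]
lemmas cls_2_add_left = alternating_2_add_left[OF cls_linear cls_relation]
lemmas cls_2_add_right = alternating_2_add_right[OF cls_linear cls_relation]
lemmas cls_2_smult_left = alternating_2_smult_left[OF cls_linear cls_relation]
lemmas cls_2_smult_right = alternating_2_smult_right[OF cls_linear cls_relation]


subsection \<open>Homology in terms of tuples\<close>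

text \<open>Boundaries in degree \<open>n\<close>, pulled back to tuples: the submodule of \<open>T n\<close> generated by the wedge
  relations and the differentials of \<open>(n + 1)\<close>-tuples.\<close>
definition bd :: "nat \<Rightarrow> ('v list \<Rightarrow> 'k) set" where
  "bd n = submodule_span R (T n) (wedge_relations R L n \<union> d_tuple R L ` tuples L (Suc n))"

lemma bd_generators_closed:
  "wedge_relations R L n \<union> d_tuple R L ` tuples L (Suc n) \<subseteq> carrier (T n)"
  using wedge_relations_closed d_tuple_closed by (auto simp: subset_iff)

lemma bd_submodule: "submodule (bd n) R (T n)"
  unfolding bd_def by (rule plain_module.span_submodule[OF plain_module_tuples bd_generators_closed])

lemma bd_generators:
  "wedge_relations R L n \<union> d_tuple R L ` tuples L (Suc n) \<subseteq> bd n"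
  unfolding bd_def by (rule plain_module.span_superset[OF plain_module_tuples])

lemma bd_relation: "r \<in> wedge_relations R L n \<Longrightarrow> r \<in> bd n"
  by (rule subsetD[OF bd_generators UnI1])

lemma bd_d_tuple: "xs \<in> tuples L (Suc n) \<Longrightarrow> d_tuple R L xs \<in> bd n"
  by (rule subsetD[OF bd_generators UnI2], rule imageI)

lemma bd_least:
  assumes N: "submodule N R (T n)" and "\<And>r. r \<in> wedge_relations R L n \<Longrightarrow> r \<in> N"
    and "\<And>xs. xs \<in> tuples L (Suc n) \<Longrightarrow> d_tuple R L xs \<in> N"
  shows "bd n \<subseteq> N"
  unfolding bd_def
  by (rule plain_module.span_least[OF plain_module_tuples N]) (use assms(2,3) in \<open>auto simp only: Un_iff image_iff\<close>)

text \<open>An element of \<open>T n\<close> lies in \<open>bd n\<close> iff its class in the exterior power is a boundary.\<close>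
lemma bd_iff:
  assumes f: "f \<in> carrier (T n)"
  shows "f \<in> bd n \<longleftrightarrow> cls n f \<in> (\<lambda>g. cls n (D n g)) ` carrier (T (Suc n))"
proof
  interpret T: module R "T n" by (rule module_tuples)
  interpret c: linear_map R "T n" "ext_power R L n" "cls n" by (rule cls_linear)
  interpret D: linear_map R "T (Suc n)" "T n" "D n" by (rule D_linear)
  interpret cD: linear_map R "T (Suc n)" "ext_power R L n" "\<lambda>g. cls n (D n g)"
    by (rule linear_map_comp[OF D_linear cls_linear])
  let ?I = "(\<lambda>g. cls n (D n g)) ` carrier (T (Suc n))"
  have I: "submodule ?I R (ext_power R L n)"
    by (rule cD.image_submodule[OF module.carrier_is_submodule[OF module_tuples]])
  {
    have "bd n \<subseteq> {f \<in> carrier (T n). cls n f \<in> ?I}"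
    proof (rule bd_least[OF c.vimage_submodule[OF I]])
      fix r assume "r \<in> wedge_relations R L n"
      then show "r \<in> {f \<in> carrier (T n). cls n f \<in> ?I}"
        using wedge_relations_closed module.submodule_zero[OF module_ext_power I]
        by (auto simp: cls_relation)
    next
      fix xs assume xs: "xs \<in> tuples L (Suc n)"
      then have "cls n (D n (e xs)) \<in> ?I" by (intro imageI e_closed)
      then show "d_tuple R L xs \<in> {f \<in> carrier (T n). cls n f \<in> ?I}"
        using xs by (simp add: D_e d_tuple_closed)
    qed
    then show "cls n f \<in> ?I" if "f \<in> bd n" using that by blast
  next
    assume "cls n f \<in> ?I"
    then obtain g where g: "g \<in> carrier (T (Suc n))" "cls n f = cls n (D n g)" by blast
    then have "f \<ominus>\<^bsub>T n\<^esub> D n g \<in> W n"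
      using f quotient_space.proj_eq_iff[OF quotient_space_wedge] by simp
    moreover have "W n \<subseteq> bd n"
      unfolding wedge_kernel_def
      by (rule plain_module.span_least[OF plain_module_tuples bd_submodule])
        (use bd_relation in blast)
    moreover have "g \<in> {g \<in> carrier (T (Suc n)). D n g \<in> bd n}"
      by (rule free_space.basis_spans[OF free_space_tuples D.vimage_submodule[OF bd_submodule] _ g(1)])
        (simp add: D_e bd_d_tuple)
    ultimately have "(f \<ominus>\<^bsub>T n\<^esub> D n g) \<oplus>\<^bsub>T n\<^esub> D n g \<in> bd n"
      using T.submoduleE(5)[OF bd_submodule] by blast
    then show "f \<in> bd n" using f g(1) by (simp add: a_minus_def T.a_assoc T.l_neg)
  }
qed

lemma carrier_ext_power: "carrier (ext_power R L n) = cls n ` carrier (T n)"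
  unfolding ext_power_def by (rule quotient_space.carrier_quot[OF quotient_space_wedge])

lemma hl_diff_cls:
  assumes W: "\<And>h. h \<in> W (Suc n) \<Longrightarrow> D n h \<in> W n" and f: "f \<in> carrier (T (Suc n))"
  shows "hl_diff R L (Suc n) (cls (Suc n) f) = cls n (D n f)"
proof -
  interpret D: linear_map R "T (Suc n)" "T n" "D n" by (rule D_linear)
  have "cls n (D n h) = cls n (D n f)" if "h \<in> cls (Suc n) f" for h
  proof -
    have h: "h \<in> carrier (T (Suc n))" "h \<ominus>\<^bsub>T (Suc n)\<^esub> f \<in> W (Suc n)"
      using that quotient_space.mem_proj_iff[OF quotient_space_wedge f] by auto
    then have "D n h \<ominus>\<^bsub>T n\<^esub> D n f \<in> W n" using W[OF h(2)] by (simp only: D.diff[OF h(1) f])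
    then show ?thesis
      using quotient_space.proj_eq_iff[OF quotient_space_wedge] h f by simp
  qed
  then have "(\<Union>h\<in>cls (Suc n) f. cls n (D n h)) = (\<Union>h\<in>cls (Suc n) f. cls n (D n f))"
    by (rule SUP_cong[OF refl])
  moreover have "f \<in> cls (Suc n) f"
    using f module.submodule_zero[OF module_tuples wedge_submodule]
      abelian_group.minus_eq_zero_iff[OF module.axioms(2)[OF module_tuples] f f]
    by (simp add: quotient_space.mem_proj_iff[OF quotient_space_wedge])
  ultimately show ?thesis
    unfolding hl_diff_def by (auto simp: D_def)
qed

text \<open>Homology vanishes iff every cycle lies in the span of relations and boundaries of tuples.\<close>

lemma homology_zero_iff:
  assumes W: "\<And>h. h \<in> W (Suc n) \<Longrightarrow> D n h \<in> W n"
    and W': "\<And>h. h \<in> W (Suc (Suc n)) \<Longrightarrow> D (Suc n) h \<in> W (Suc n)"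
  shows "zero_module (hl_homology R L (Suc n)) \<longleftrightarrow>
    (\<forall>f\<in>carrier (T (Suc n)). D n f \<in> W n \<longrightarrow> f \<in> bd (Suc n))"
proof -
  let ?E = "ext_power R L (Suc n)"
  let ?Z = "hl_cycles R L (Suc n)" and ?B = "hl_boundaries R L (Suc n)"
  interpret E: module R ?E by (rule module_ext_power)
  interpret D: linear_map R "T (Suc n)" "T n" "D n" by (rule D_linear)
  interpret cD: linear_map R "T (Suc (Suc n))" ?E "\<lambda>g. cls (Suc n) (D (Suc n) g)"
    by (rule linear_map_comp[OF D_linear cls_linear])
  have cycle_iff: "hl_diff R L (Suc n) (cls (Suc n) f) = \<zero>\<^bsub>ext_power R L n\<^esub> \<longleftrightarrow> D n f \<in> W n"
    if "f \<in> carrier (T (Suc n))" for f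
    using that by (simp add: hl_diff_cls[OF W] cls_zero_iff)
  have "?Z = cls (Suc n) ` {f \<in> carrier (T (Suc n)).
      hl_diff R L (Suc n) (cls (Suc n) f) = \<zero>\<^bsub>ext_power R L n\<^esub>}"
    unfolding hl_cycles_def carrier_ext_power by fastforce
  also have "{f \<in> carrier (T (Suc n)). hl_diff R L (Suc n) (cls (Suc n) f) = \<zero>\<^bsub>ext_power R L n\<^esub>}
      = {f \<in> carrier (T (Suc n)). D n f \<in> W n}"
    by (intro Collect_cong conj_cong refl cycle_iff)
  finally have Z: "?Z = cls (Suc n) ` {f \<in> carrier (T (Suc n)). D n f \<in> W n}" .
  have B: "?B = (\<lambda>g. cls (Suc n) (D (Suc n) g)) ` carrier (T (Suc (Suc n)))"
    unfolding hl_boundaries_def carrier_ext_power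
    by (simp add: image_image hl_diff_cls[OF W'] cong: image_cong)
  have "submodule ?B R ?E"
    unfolding B by (rule cD.image_submodule[OF module.carrier_is_submodule[OF module_tuples]])
  then have sub: "subgroup ?B (add_monoid ?E)" by (rule submodule.axioms(1))
  have coset: "?B +>\<^bsub>?E\<^esub> X = ?B \<longleftrightarrow> X \<in> ?B" if "X \<in> carrier ?E" for X
    using that sub E.a_coset_join1 E.a_coset_join2 by blast
  have Z_carrier: "?Z \<subseteq> carrier ?E" by (auto simp: hl_cycles_def)
  have Z_zero: "\<zero>\<^bsub>?E\<^esub> \<in> ?Z"
    unfolding Z
    using linear_map.zero[OF cls_linear, of "Suc n"] D.zero
      module.submodule_zero[OF module_tuples wedge_submodule]
    by (intro image_eqI[of _ _ "\<zero>\<^bsub>T (Suc n)\<^esub>"])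
      (simp_all add: abelian_monoid.zero_closed[OF abelian_group.axioms(1)[OF module.axioms(2)[OF module_tuples]]])
  have "carrier (hl_homology R L (Suc n)) = (\<lambda>X. ?B +>\<^bsub>?E\<^esub> X) ` ?Z"
    unfolding hl_homology_def quot_module_def
    by (auto simp: A_RCOSETS_def' a_r_coset_def')
  moreover have "zero (hl_homology R L (Suc n)) = ?B"
    by (simp add: hl_homology_def quot_module_def)
  ultimately have "zero_module (hl_homology R L (Suc n)) \<longleftrightarrow> (\<lambda>X. ?B +>\<^bsub>?E\<^esub> X) ` ?Z = {?B}"
    by (simp add: zero_module_def)
  also have "\<dots> \<longleftrightarrow> (\<forall>X\<in>?Z. ?B +>\<^bsub>?E\<^esub> X = ?B)"
    using Z_zero by (auto simp only: image_iff set_eq_iff singleton_iff image_subset_iff)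
  also have "\<dots> \<longleftrightarrow> ?Z \<subseteq> ?B"
    using coset Z_carrier by (simp add: subset_iff Ball_def)
  also have "\<dots> \<longleftrightarrow> (\<forall>f\<in>carrier (T (Suc n)). D n f \<in> W n \<longrightarrow> f \<in> bd (Suc n))"
    unfolding Z B by (auto simp: bd_iff)
  finally show ?thesis .
qed

end

context hom_lie_alternating
begin

lemma D_2_wedge:
  assumes f: "f \<in> W (Suc (Suc (Suc 0)))"
  shows "D (Suc (Suc 0)) f \<in> W (Suc (Suc 0))"
proof -
  let ?E = "ext_power R L (Suc (Suc 0))"
  let ?c = "\<lambda>x y. cls (Suc (Suc 0)) (e [x, y])"
  interpret E: module R ?E by (rule module_ext_power)
  interpret T: module R "T (Suc (Suc 0))" by (rule module_tuples)
  interpret c: linear_map R "T (Suc (Suc 0))" ?E "cls (Suc (Suc 0))" by (rule cls_linear)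
  have c_closed: "?c x y \<in> carrier ?E" if "x \<in> carrier L" "y \<in> carrier L" for x y
    using that by (simp add: cls_2_closed)
  have c_zero: "?c \<zero>\<^bsub>L\<^esub> x = \<zero>\<^bsub>?E\<^esub>" if "x \<in> carrier L" for x
    using cls_2_smult_left[of "\<zero>\<^bsub>L\<^esub>" x "\<zero>\<^bsub>R\<^esub>"] c_closed that by simp
  have c_neg: "?c (bracket L x y) z = \<ominus>\<^bsub>?E\<^esub> ?c (bracket L y x) z"
    if xyz: "x \<in> carrier L" "y \<in> carrier L" "z \<in> carrier L" for x y z
  proof -
    have "?c (bracket L x y) z \<oplus>\<^bsub>?E\<^esub> ?c (bracket L y x) z = ?c (bracket L x y \<oplus>\<^bsub>L\<^esub> bracket L y x) z"
      using xyz by (simp add: cls_2_add_left bracket_closed)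
    also have "bracket L x y \<oplus>\<^bsub>L\<^esub> bracket L y x = \<zero>\<^bsub>L\<^esub>"
      using xyz bracket_skew[of x y] by (simp add: M.l_neg bracket_closed)
    finally show ?thesis
      using xyz E.minus_equality[of "?c (bracket L x y) z" "?c (bracket L y x) z"] c_zero c_closed
      by (simp add: bracket_closed)
  qed
  note [simp] = bracket_closed twist_closed
  note simps = D_e d_tuple_3 c.neg c.add bracket_add_left bracket_add_right
        bracket_smult_left bracket_smult_right bracket_self
        cls_2_add_left cls_2_add_right cls_2_smult_left cls_2_smult_right c_zero c_closed
        E.minus_add E.smult_r_minus E.smult_r_distr E.neg_zero twist_add twist_smult
        E.l_neg E.r_neg
  \<comment> \<open>In each argument the differential is a sum of three additive terms; this regroups them.\<close>
  have ac: "(a \<oplus>\<^bsub>?E\<^esub> a') \<oplus>\<^bsub>?E\<^esub> ((b \<oplus>\<^bsub>?E\<^esub> b') \<oplus>\<^bsub>?E\<^esub> (d \<oplus>\<^bsub>?E\<^esub> d')) =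
      (a \<oplus>\<^bsub>?E\<^esub> (b \<oplus>\<^bsub>?E\<^esub> d)) \<oplus>\<^bsub>?E\<^esub> (a' \<oplus>\<^bsub>?E\<^esub> (b' \<oplus>\<^bsub>?E\<^esub> d'))"
    if "a \<in> carrier ?E" "a' \<in> carrier ?E" "b \<in> carrier ?E" "b' \<in> carrier ?E" "d \<in> carrier ?E" "d' \<in> carrier ?E"
    for a a' b b' d d'
    using that by (simp add: E.a_ac)
  have "cls (Suc (Suc 0)) (D (Suc (Suc 0)) f) = \<zero>\<^bsub>?E\<^esub>"
  proof (rule wedge_3_vanish[OF linear_map_comp[OF D_linear cls_linear] _ _ _ _ _ _ _ _ _ _ f,
        of "\<lambda>x y z. \<ominus>\<^bsub>?E\<^esub> ?c (bracket L x y) (twist L z) \<oplus>\<^bsub>?E\<^esub>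
          (?c (bracket L x z) (twist L y) \<oplus>\<^bsub>?E\<^esub> \<ominus>\<^bsub>?E\<^esub> ?c (bracket L y z) (twist L x))"])
    fix x y assume "x \<in> carrier L" "y \<in> carrier L"
    then show "\<ominus>\<^bsub>?E\<^esub> ?c (bracket L x y) (twist L x) \<oplus>\<^bsub>?E\<^esub>
          (?c (bracket L x x) (twist L y) \<oplus>\<^bsub>?E\<^esub> \<ominus>\<^bsub>?E\<^esub> ?c (bracket L y x) (twist L x)) = \<zero>\<^bsub>?E\<^esub>"
      using c_neg[of x y "twist L x"] by (simp add: simps)
  qed (simp_all add: simps ac)
  moreover have "D (Suc (Suc 0)) f \<in> carrier (T (Suc (Suc 0)))"
    using f wedge_submodule linear_map.closed[OF D_linear] module.submoduleE(1)[OF module_tuples]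
    by blast
  ultimately show ?thesis by (simp add: cls_zero_iff)
qed

end


section \<open>Homomorphisms, kernels and transport of structure\<close>

lemma hom_lie_homD:
  assumes "f \<in> hom_lie_hom R L L'"
  shows "\<And>x. x \<in> carrier L \<Longrightarrow> f x \<in> carrier L'"
    and "\<And>x y. \<lbrakk>x \<in> carrier L; y \<in> carrier L\<rbrakk> \<Longrightarrow> f (x \<oplus>\<^bsub>L\<^esub> y) = f x \<oplus>\<^bsub>L'\<^esub> f y"
    and "\<And>a x. \<lbrakk>a \<in> carrier R; x \<in> carrier L\<rbrakk> \<Longrightarrow> f (a \<odot>\<^bsub>L\<^esub> x) = a \<odot>\<^bsub>L'\<^esub> f x"
    and "\<And>x y. \<lbrakk>x \<in> carrier L; y \<in> carrier L\<rbrakk> \<Longrightarrow> f (bracket L x y) = bracket L' (f x) (f y)"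
    and "\<And>x. x \<in> carrier L \<Longrightarrow> f (twist L x) = twist L' (f x)"
  using assms by (auto simp: hom_lie_hom_def)

lemma hom_lie_homI:
  assumes "\<And>x. x \<in> carrier L \<Longrightarrow> f x \<in> carrier L'"
    and "\<And>x y. \<lbrakk>x \<in> carrier L; y \<in> carrier L\<rbrakk> \<Longrightarrow> f (x \<oplus>\<^bsub>L\<^esub> y) = f x \<oplus>\<^bsub>L'\<^esub> f y"
    and "\<And>a x. \<lbrakk>a \<in> carrier R; x \<in> carrier L\<rbrakk> \<Longrightarrow> f (a \<odot>\<^bsub>L\<^esub> x) = a \<odot>\<^bsub>L'\<^esub> f x"
    and "\<And>x y. \<lbrakk>x \<in> carrier L; y \<in> carrier L\<rbrakk> \<Longrightarrow> f (bracket L x y) = bracket L' (f x) (f y)"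
    and "\<And>x. x \<in> carrier L \<Longrightarrow> f (twist L x) = twist L' (f x)"
  shows "f \<in> hom_lie_hom R L L'"
  using assms by (simp add: hom_lie_hom_def)

lemma hom_lie_hom_comp:
  assumes "f \<in> hom_lie_hom R L L'" "g \<in> hom_lie_hom R L' L''"
  shows "(\<lambda>x. g (f x)) \<in> hom_lie_hom R L L''"
  using assms by (intro hom_lie_homI) (simp_all add: hom_lie_homD)

lemma hom_lie_modules: "hom_lie_algebra R L \<Longrightarrow> module R L"
  by (simp add: hom_lie_algebra_def)

lemma hom_lie_hom_linear:
  assumes "hom_lie_algebra R L" "hom_lie_algebra R L'" "f \<in> hom_lie_hom R L L'"
  shows "linear_map R L L' f"
  using assms by (intro linear_mapI hom_lie_modules) (simp_all add: hom_lie_homD)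

text \<open>The kernel of a homomorphism is a Hom-Lie algebra with the restricted operations.\<close>
lemma hom_lie_kernel:
  assumes L: "hom_lie_algebra R L" and L': "hom_lie_algebra R L'" and f: "f \<in> hom_lie_hom R L L'"
  shows "hom_lie_algebra R (L\<lparr>carrier := {x \<in> carrier L. f x = \<zero>\<^bsub>L'\<^esub>}\<rparr>)"
proof -
  let ?N = "{x \<in> carrier L. f x = \<zero>\<^bsub>L'\<^esub>}"
  interpret L: hom_lie_algebra R L by (rule L)
  interpret L': hom_lie_algebra R L' by (rule L')
  interpret f: linear_map R L L' f by (rule hom_lie_hom_linear[OF L L' f])
  have mod: "module R (L\<lparr>carrier := ?N\<rparr>)"
    by (rule submodule.submodule_is_module[OF f.kernel_submodule f.module_domain])
  have zero_bracket: "bracket L' \<zero>\<^bsub>L'\<^esub> \<zero>\<^bsub>L'\<^esub> = \<zero>\<^bsub>L'\<^esub>"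
    using L'.bracket_smult_left[of "\<zero>\<^bsub>R\<^esub>" "\<zero>\<^bsub>L'\<^esub>" "\<zero>\<^bsub>L'\<^esub>"] by (simp add: L'.bracket_closed)
  have zero_twist: "twist L' \<zero>\<^bsub>L'\<^esub> = \<zero>\<^bsub>L'\<^esub>"
    using L'.twist_smult[of "\<zero>\<^bsub>R\<^esub>" "\<zero>\<^bsub>L'\<^esub>"] by (simp add: L'.twist_closed)
  have neg: "\<ominus>\<^bsub>L\<lparr>carrier := ?N\<rparr>\<^esub> x = \<ominus>\<^bsub>L\<^esub> x" if x: "x \<in> ?N" for x
  proof -
    interpret N: module R "L\<lparr>carrier := ?N\<rparr>" by (rule mod)
    have "\<ominus>\<^bsub>L\<^esub> x \<in> ?N" using L.M.a_inv_closed f.neg that L'.M.neg_zero by simp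
    then show ?thesis
      using N.minus_equality[of "\<ominus>\<^bsub>L\<^esub> x" x] x by (simp add: L.M.l_neg)
  qed
  have br: "bracket L x y \<in> ?N" if "x \<in> ?N" "y \<in> ?N" for x y
    using that by (simp add: hom_lie_homD(4)[OF f] zero_bracket L.bracket_closed)
  show ?thesis
    unfolding hom_lie_algebra_def hom_lie_algebra_axioms_def
  proof (intro conjI allI impI)
    fix x y assume "x \<in> carrier (L\<lparr>carrier := ?N\<rparr>)" "y \<in> carrier (L\<lparr>carrier := ?N\<rparr>)"
    then have xy: "x \<in> ?N" "y \<in> ?N" by simp_all
    then show "bracket (L\<lparr>carrier := ?N\<rparr>) x y = \<ominus>\<^bsub>L\<lparr>carrier := ?N\<rparr>\<^esub> bracket (L\<lparr>carrier := ?N\<rparr>) y x"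
      using neg[OF br[OF xy(2,1)]] L.bracket_skew[of x y] by simp
  qed (use L.R.field_axioms mod in \<open>simp_all add: hom_lie_homD[OF f] zero_bracket zero_twist
      L.bracket_closed L.bracket_add_left L.bracket_add_right L.bracket_smult_left
      L.bracket_smult_right L.twist_closed L.twist_add L.twist_smult L.hom_jacobi L.twist_bracket\<close>)
qed

text \<open>Transport of structure along an injection.\<close>

definition transport :: "('v \<Rightarrow> 'w) \<Rightarrow> ('k, 'v) hom_lie \<Rightarrow> ('k, 'w) hom_lie" where
  "transport \<iota> L = (let \<kappa> = inv_into (carrier L) \<iota> in
     \<lparr>carrier = \<iota> ` carrier L, mult = (\<lambda>_ _. undefined), one = undefined,
      zero = \<iota> \<zero>\<^bsub>L\<^esub>, add = (\<lambda>a b. \<iota> (\<kappa> a \<oplus>\<^bsub>L\<^esub> \<kappa> b)), smult = (\<lambda>c a. \<iota> (c \<odot>\<^bsub>L\<^esub> \<kappa> a)),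
      bracket = (\<lambda>a b. \<iota> (bracket L (\<kappa> a) (\<kappa> b))), twist = (\<lambda>a. \<iota> (twist L (\<kappa> a)))\<rparr>)"

lemma
  assumes L: "hom_lie_algebra R L" and inj: "inj_on \<iota> (carrier L)"
  shows transport_hom_lie: "hom_lie_algebra R (transport \<iota> L)"
    and transport_to: "\<iota> \<in> hom_lie_hom R L (transport \<iota> L)"
    and transport_from: "inv_into (carrier L) \<iota> \<in> hom_lie_hom R (transport \<iota> L) L"
    and transport_carrier: "carrier (transport \<iota> L) = \<iota> ` carrier L"
proof -
  interpret L: hom_lie_algebra R L by (rule L)
  let ?U = "transport \<iota> L" and ?k = "inv_into (carrier L) \<iota>"
  have k [simp]: "?k (\<iota> x) = x" if "x \<in> carrier L" for x
    using inj that by (rule inv_into_f_f)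
  note closed = L.bracket_closed L.twist_closed
  have U: "carrier ?U = \<iota> ` carrier L" "zero ?U = \<iota> \<zero>\<^bsub>L\<^esub>"
    "\<And>x y. \<lbrakk>x \<in> carrier L; y \<in> carrier L\<rbrakk> \<Longrightarrow> \<iota> x \<oplus>\<^bsub>?U\<^esub> \<iota> y = \<iota> (x \<oplus>\<^bsub>L\<^esub> y)"
    "\<And>c x. x \<in> carrier L \<Longrightarrow> c \<odot>\<^bsub>?U\<^esub> \<iota> x = \<iota> (c \<odot>\<^bsub>L\<^esub> x)"
    "\<And>x y. \<lbrakk>x \<in> carrier L; y \<in> carrier L\<rbrakk> \<Longrightarrow> bracket ?U (\<iota> x) (\<iota> y) = \<iota> (bracket L x y)"
    "\<And>x. x \<in> carrier L \<Longrightarrow> twist ?U (\<iota> x) = \<iota> (twist L x)"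
    by (simp_all add: transport_def Let_def)
  have mod: "module R ?U"
  proof (rule moduleI)
    show "abelian_group ?U"
    proof (rule abelian_groupI)
      fix a assume "a \<in> carrier ?U"
      then obtain x where "x \<in> carrier L" "a = \<iota> x" by (auto simp: U)
      then show "\<exists>b\<in>carrier ?U. b \<oplus>\<^bsub>?U\<^esub> a = \<zero>\<^bsub>?U\<^esub>"
        by (intro bexI[of _ "\<iota> (\<ominus>\<^bsub>L\<^esub> x)"]) (simp_all add: U L.M.l_neg)
    qed (auto simp: U L.M.a_ac)
  qed (auto simp: U L.smult_l_distr L.smult_r_distr L.smult_assoc1 intro: L.R.is_cring)
  interpret U: module R ?U by (rule mod)
  have neg: "\<ominus>\<^bsub>?U\<^esub> \<iota> x = \<iota> (\<ominus>\<^bsub>L\<^esub> x)" if "x \<in> carrier L" for x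
    using that by (intro U.minus_equality) (simp_all add: U L.M.l_neg)
  show "hom_lie_algebra R ?U"
    unfolding hom_lie_algebra_def hom_lie_algebra_axioms_def
  proof (intro conjI allI impI)
    fix a b assume "a \<in> carrier ?U" "b \<in> carrier ?U"
    then obtain x y where xy: "x \<in> carrier L" "y \<in> carrier L" "a = \<iota> x" "b = \<iota> y" by (auto simp: U)
    then show "bracket ?U a b = \<ominus>\<^bsub>?U\<^esub> bracket ?U b a"
      using L.bracket_skew[of x y] by (simp add: U neg closed)
  qed (use L.R.field_axioms mod in \<open>auto simp: U closed
      L.bracket_add_left L.bracket_add_right L.bracket_smult_left
      L.bracket_smult_right L.twist_add L.twist_smult L.hom_jacobi L.twist_bracket\<close>)
  show "\<iota> \<in> hom_lie_hom R L ?U"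
    by (rule hom_lie_homI) (simp_all add: U)
  show "?k \<in> hom_lie_hom R ?U L"
    by (rule hom_lie_homI) (auto simp: U closed)
  show "carrier ?U = \<iota> ` carrier L" by (rule U(1))
qed


section \<open>Extensions by cocycles\<close>

text \<open>The extension of \<open>K\<close> by a module \<open>V\<close> with endomorphism \<open>\<beta>\<close> and trivial bracket, defined by a
  bilinear map \<open>\<phi>\<close> from \<open>K\<close> to \<open>V\<close>. The fields that modules do not use are left undefined.\<close>
definition cocycle_extension ::
  "('k, 'v) hom_lie \<Rightarrow> ('k, 'w) module \<Rightarrow> ('w \<Rightarrow> 'w) \<Rightarrow> ('v \<Rightarrow> 'v \<Rightarrow> 'w) \<Rightarrow> ('k, 'v \<times> 'w) hom_lie"
  where
  "cocycle_extension K V \<beta> \<phi> =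
     \<lparr>carrier = carrier K \<times> carrier V, mult = (\<lambda>_ _. undefined), one = undefined,
      zero = (\<zero>\<^bsub>K\<^esub>, \<zero>\<^bsub>V\<^esub>), add = (\<lambda>(x, a) (y, b). (x \<oplus>\<^bsub>K\<^esub> y, a \<oplus>\<^bsub>V\<^esub> b)),
      smult = (\<lambda>c (x, a). (c \<odot>\<^bsub>K\<^esub> x, c \<odot>\<^bsub>V\<^esub> a)),
      bracket = (\<lambda>(x, a) (y, b). (bracket K x y, \<phi> x y)),
      twist = (\<lambda>(x, a). (twist K x, \<beta> a))\<rparr>"

lemma cocycle_extension_simps:
  "carrier (cocycle_extension K V \<beta> \<phi>) = carrier K \<times> carrier V"
  "zero (cocycle_extension K V \<beta> \<phi>) = (\<zero>\<^bsub>K\<^esub>, \<zero>\<^bsub>V\<^esub>)"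
  "(x, a) \<oplus>\<^bsub>cocycle_extension K V \<beta> \<phi>\<^esub> (y, b) = (x \<oplus>\<^bsub>K\<^esub> y, a \<oplus>\<^bsub>V\<^esub> b)"
  "c \<odot>\<^bsub>cocycle_extension K V \<beta> \<phi>\<^esub> (x, a) = (c \<odot>\<^bsub>K\<^esub> x, c \<odot>\<^bsub>V\<^esub> a)"
  "bracket (cocycle_extension K V \<beta> \<phi>) (x, a) (y, b) = (bracket K x y, \<phi> x y)"
  "twist (cocycle_extension K V \<beta> \<phi>) (x, a) = (twist K x, \<beta> a)"
  by (simp_all add: cocycle_extension_def)

lemma cocycle_extension_hom_lie:
  assumes K: "hom_lie_algebra R K" and \<beta>: "linear_map R V V \<beta>"
    and closed: "\<And>x y. \<lbrakk>x \<in> carrier K; y \<in> carrier K\<rbrakk> \<Longrightarrow> \<phi> x y \<in> carrier V"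
    and add: "\<And>x y z. \<lbrakk>x \<in> carrier K; y \<in> carrier K; z \<in> carrier K\<rbrakk> \<Longrightarrow> \<phi> (x \<oplus>\<^bsub>K\<^esub> y) z = \<phi> x z \<oplus>\<^bsub>V\<^esub> \<phi> y z"
      "\<And>x y z. \<lbrakk>x \<in> carrier K; y \<in> carrier K; z \<in> carrier K\<rbrakk> \<Longrightarrow> \<phi> x (y \<oplus>\<^bsub>K\<^esub> z) = \<phi> x y \<oplus>\<^bsub>V\<^esub> \<phi> x z"
    and smult: "\<And>a x y. \<lbrakk>a \<in> carrier R; x \<in> carrier K; y \<in> carrier K\<rbrakk> \<Longrightarrow> \<phi> (a \<odot>\<^bsub>K\<^esub> x) y = a \<odot>\<^bsub>V\<^esub> \<phi> x y"
      "\<And>a x y. \<lbrakk>a \<in> carrier R; x \<in> carrier K; y \<in> carrier K\<rbrakk> \<Longrightarrow> \<phi> x (a \<odot>\<^bsub>K\<^esub> y) = a \<odot>\<^bsub>V\<^esub> \<phi> x y"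
    and skew: "\<And>x y. \<lbrakk>x \<in> carrier K; y \<in> carrier K\<rbrakk> \<Longrightarrow> \<phi> x y = \<ominus>\<^bsub>V\<^esub> \<phi> y x"
    and cocycle: "\<And>x y z. \<lbrakk>x \<in> carrier K; y \<in> carrier K; z \<in> carrier K\<rbrakk> \<Longrightarrow>
      \<phi> (twist K x) (bracket K y z) \<oplus>\<^bsub>V\<^esub> \<phi> (twist K z) (bracket K x y)
        \<oplus>\<^bsub>V\<^esub> \<phi> (twist K y) (bracket K z x) = \<zero>\<^bsub>V\<^esub>"
    and twist: "\<And>x y. \<lbrakk>x \<in> carrier K; y \<in> carrier K\<rbrakk> \<Longrightarrow> \<beta> (\<phi> x y) = \<phi> (twist K x) (twist K y)"
  shows "hom_lie_algebra R (cocycle_extension K V \<beta> \<phi>)"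
proof -
  interpret K: hom_lie_algebra R K by (rule K)
  interpret \<beta>: linear_map R V V \<beta> by (rule \<beta>)
  interpret V: module R V by (rule \<beta>.module_domain)
  let ?F = "cocycle_extension K V \<beta> \<phi>"
  note F = cocycle_extension_simps
  note kclosed = K.bracket_closed K.twist_closed
  have mod: "module R ?F"
  proof (rule moduleI)
    show "abelian_group ?F"
    proof (rule abelian_groupI)
      fix u assume "u \<in> carrier ?F"
      then obtain x a where "x \<in> carrier K" "a \<in> carrier V" "u = (x, a)" by (auto simp: F)
      then show "\<exists>w\<in>carrier ?F. w \<oplus>\<^bsub>?F\<^esub> u = \<zero>\<^bsub>?F\<^esub>"
        by (intro bexI[of _ "(\<ominus>\<^bsub>K\<^esub> x, \<ominus>\<^bsub>V\<^esub> a)"]) (simp_all add: F K.M.l_neg V.l_neg)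
    qed (auto simp: F K.M.a_ac V.a_ac)
  qed (auto simp: F K.smult_l_distr K.smult_r_distr K.smult_assoc1
        V.smult_l_distr V.smult_r_distr V.smult_assoc1 intro: K.R.is_cring)
  interpret F: module R ?F by (rule mod)
  have neg: "\<ominus>\<^bsub>?F\<^esub> (x, a) = (\<ominus>\<^bsub>K\<^esub> x, \<ominus>\<^bsub>V\<^esub> a)" if "x \<in> carrier K" "a \<in> carrier V" for x a
    using that by (intro F.minus_equality) (simp_all add: F K.M.l_neg V.l_neg)
  show ?thesis
    unfolding hom_lie_algebra_def hom_lie_algebra_axioms_def
  proof (intro conjI allI impI)
    fix u w assume "u \<in> carrier ?F" "w \<in> carrier ?F"
    then obtain x a y b where xy: "x \<in> carrier K" "a \<in> carrier V" "u = (x, a)"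
      "y \<in> carrier K" "b \<in> carrier V" "w = (y, b)" by (auto simp: F)
    then show "bracket ?F u w = \<ominus>\<^bsub>?F\<^esub> bracket ?F w u"
      using K.bracket_skew[of x y] skew[of x y] by (simp add: F neg kclosed closed)
  qed (use K.R.field_axioms mod in \<open>auto simp: F closed add smult cocycle twist kclosed \<beta>.add \<beta>.smult
      K.bracket_add_left K.bracket_add_right K.bracket_smult_left
      K.bracket_smult_right K.twist_add K.twist_smult K.hom_jacobi K.twist_bracket\<close>)
qed


section \<open>Test objects of other types\<close>

text \<open>The universal property holds against every \<open>\<alpha>\<close>-central \<open>q : F \<rightarrow> L\<close> whose carrier injects into
  the type of test objects: transport \<open>F\<close>, and take as kernel the kernel of the transported map.\<close>
lemma universal_alpha_centralD:
  fixes F :: "('k, 'h) hom_lie" and \<iota> :: "'h \<Rightarrow> 't"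
  assumes univ: "universal_alpha_central_extension TYPE('t) TYPE('t) R M i K p L"
    and F: "hom_lie_algebra R F" and q: "q \<in> hom_lie_hom R F L" and surj: "q ` carrier F = carrier L"
    and central: "\<And>m x. \<lbrakk>m \<in> carrier F; q m = \<zero>\<^bsub>L\<^esub>; x \<in> carrier F\<rbrakk> \<Longrightarrow>
      bracket F (twist F m) x = \<zero>\<^bsub>F\<^esub>"
    and inj: "inj_on \<iota> (carrier F)"
  shows "\<exists>h\<in>hom_lie_hom R K F. \<forall>x\<in>carrier K. q (h x) = p x"
    and "\<And>h h' x. \<lbrakk>h \<in> hom_lie_hom R K F; h' \<in> hom_lie_hom R K F;
        \<And>x. x \<in> carrier K \<Longrightarrow> q (h x) = p x; \<And>x. x \<in> carrier K \<Longrightarrow> q (h' x) = p x;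
        x \<in> carrier K\<rbrakk> \<Longrightarrow> h x = h' x"
proof -
  let ?F = "transport \<iota> F" and ?k = "inv_into (carrier F) \<iota>"
  let ?q = "\<lambda>y. q (?k y)"
  let ?N = "{x \<in> carrier ?F. ?q x = \<zero>\<^bsub>L\<^esub>}"
  let ?M = "?F\<lparr>carrier := ?N\<rparr>"
  note t = transport_hom_lie[OF F inj] transport_to[OF F inj] transport_from[OF F inj]
    transport_carrier[OF F inj]
  interpret F: hom_lie_algebra R F by (rule F)
  have k [simp]: "?k (\<iota> x) = x" if "x \<in> carrier F" for x
    using inj that by (rule inv_into_f_f)
  have K: "hom_lie_algebra R K" and L: "hom_lie_algebra R L"
    using univ by (simp_all add: universal_alpha_central_extension_def central_extension_def hom_lie_extension_def)
  have q': "?q \<in> hom_lie_hom R ?F L" by (rule hom_lie_hom_comp[OF t(3) q])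
  have "alpha_central_extension R ?M (\<lambda>x. x) ?F ?q L"
    unfolding alpha_central_extension_def hom_lie_extension_def
  proof (intro conjI ballI)
    show "hom_lie_algebra R ?M" by (rule hom_lie_kernel[OF t(1) L q'])
    show "(\<lambda>x. x) \<in> hom_lie_hom R ?M ?F" by (simp add: hom_lie_hom_def)
    show "?q ` carrier ?F = carrier L"
      unfolding t(4) surj[symmetric] by (auto simp: image_image)
    fix m x assume "m \<in> carrier ?M" "x \<in> carrier ?F"
    then obtain m' x' where m': "m' \<in> carrier F" "q m' = \<zero>\<^bsub>L\<^esub>" "m = \<iota> m'"
      and x': "x' \<in> carrier F" "x = \<iota> x'" by (auto simp: t(4))
    have "\<iota> (bracket F (twist F m') x') = bracket ?F (twist ?F m) x"
      using m' x' by (simp add: hom_lie_homD[OF t(2)] F.twist_closed)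
    then show "bracket ?F (twist ?M m) x = \<zero>\<^bsub>?F\<^esub>"
      using central[OF m'(1,2) x'(1)] linear_map.zero[OF hom_lie_hom_linear[OF F t(1,2)]] by simp
  qed (use t(1) L q' in auto)
  then have u: "unique_hom_over R K p ?F ?q"
    using univ by (simp add: universal_alpha_central_extension_def)
  then obtain h where h: "h \<in> hom_lie_hom R K ?F" "\<forall>x\<in>carrier K. ?q (h x) = p x"
    unfolding unique_hom_over_def by blast
  then show "\<exists>h\<in>hom_lie_hom R K F. \<forall>x\<in>carrier K. q (h x) = p x"
    using hom_lie_hom_comp[OF h(1) t(3)] by (intro bexI[of _ "\<lambda>x. ?k (h x)"])
  fix h h' x
  assume hh: "h \<in> hom_lie_hom R K F" "h' \<in> hom_lie_hom R K F"
    "\<And>x. x \<in> carrier K \<Longrightarrow> q (h x) = p x" "\<And>x. x \<in> carrier K \<Longrightarrow> q (h' x) = p x"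
    and x: "x \<in> carrier K"
  interpret K: hom_lie_algebra R K by (rule K)
  have ext: "restrict (\<lambda>x. \<iota> (g x)) (carrier K) \<in> hom_lie_hom R K ?F \<inter> extensional (carrier K) \<and>
      (\<forall>x\<in>carrier K. ?q (restrict (\<lambda>x. \<iota> (g x)) (carrier K) x) = p x)"
    if g: "g \<in> hom_lie_hom R K F" "\<And>x. x \<in> carrier K \<Longrightarrow> q (g x) = p x" for g
  proof (intro conjI IntI ballI)
    show "restrict (\<lambda>x. \<iota> (g x)) (carrier K) \<in> hom_lie_hom R K ?F"
      using hom_lie_homD[OF hom_lie_hom_comp[OF g(1) t(2)]]
      by (intro hom_lie_homI) (simp_all add: K.bracket_closed K.twist_closed)
  qed (use g hom_lie_homD(1)[OF g(1)] in auto)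
  have "restrict (\<lambda>x. \<iota> (h x)) (carrier K) = restrict (\<lambda>x. \<iota> (h' x)) (carrier K)"
    using u ext[OF hh(1,3)] ext[OF hh(2,4)] unfolding unique_hom_over_def by blast
  then have "\<iota> (h x) = \<iota> (h' x)" using x by (metis restrict_apply')
  then show "h x = h' x"
    using inj x hom_lie_homD(1)[OF hh(1)] hom_lie_homD(1)[OF hh(2)] by (auto dest: inj_onD)
qed


section \<open>Perfectness and the vanishing of homology\<close>

context hom_lie_algebra
begin

text \<open>\<open>L\<close> is spanned by its brackets. The condition is stated as a principle of induction over
  submodules, the form in which it is applied.\<close>
definition perfect :: bool where
  "perfect \<longleftrightarrow> (\<forall>N. submodule N R L \<longrightarrow>
     (\<forall>x\<in>carrier L. \<forall>y\<in>carrier L. bracket L x y \<in> N) \<longrightarrow> carrier L \<subseteq> N)"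

lemma perfectD:
  assumes "perfect" "submodule N R L"
    and "\<And>x y. \<lbrakk>x \<in> carrier L; y \<in> carrier L\<rbrakk> \<Longrightarrow> bracket L x y \<in> N" and "x \<in> carrier L"
  shows "x \<in> N"
  using assms unfolding perfect_def by (meson subsetD)

text \<open>The first exterior power is \<open>L\<close> itself.\<close>
lemma wedge_1_iso:
  obtains s where "linear_map R (T (Suc 0)) L s" "\<And>x. x \<in> carrier L \<Longrightarrow> s (e [x]) = x"
    "\<And>g. g \<in> carrier (T (Suc 0)) \<Longrightarrow> g \<in> W (Suc 0) \<longleftrightarrow> s g = \<zero>\<^bsub>L\<^esub>"
proof -
  have "hd \<in> tuples L (Suc 0) \<rightarrow> carrier L" by (auto elim!: tuples_1E)
  from free_space.free_lift[OF free_space_tuples module_axioms this]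
  obtain s where s: "linear_map R (T (Suc 0)) L s"
    and "\<And>xs. xs \<in> tuples L (Suc 0) \<Longrightarrow> s (e xs) = hd xs" by blast
  then have s_e: "s (e [x]) = x" if "x \<in> carrier L" for x using that by simp
  interpret s: linear_map R "T (Suc 0)" L s by (rule s)
  have "linear_map R L (ext_power R L (Suc 0)) (\<lambda>x. cls (Suc 0) (e [x]))"
    using cls_1_closed cls_1_add cls_1_smult by (intro linear_mapI module_axioms module_ext_power)
  then interpret j: linear_map R L "ext_power R L (Suc 0)" "\<lambda>x. cls (Suc 0) (e [x])" .
  have js: "cls (Suc 0) (e [s g]) = cls (Suc 0) g" if "g \<in> carrier (T (Suc 0))" for g
    by (rule free_space.linear_map_eqI[OF free_space_tuples
          linear_map_comp[OF s j.linear_map_axioms] cls_linear _ that])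
      (auto elim!: tuples_1E simp: s_e)
  have "g \<in> W (Suc 0) \<longleftrightarrow> s g = \<zero>\<^bsub>L\<^esub>" if g: "g \<in> carrier (T (Suc 0))" for g
  proof
    assume "g \<in> W (Suc 0)"
    from wedge_1_vanish[OF s s_e _ _ this] show "s g = \<zero>\<^bsub>L\<^esub>" by simp
  next
    assume "s g = \<zero>\<^bsub>L\<^esub>"
    then have "cls (Suc 0) g = \<zero>\<^bsub>ext_power R L (Suc 0)\<^esub>" using js[OF g] j.zero by simp
    then show "g \<in> W (Suc 0)" using g by (simp add: cls_zero_iff)
  qed
  with s s_e that show thesis by blast
qed

text \<open>The differential in degree 2, followed by the identification of the first exterior power with
  \<open>L\<close>. It sends \<open>x \<and> y\<close> to \<open>- [x, y]\<close>, that is, to \<open>[y, x]\<close>.\<close>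
lemma wedge_2_bracket:
  obtains \<delta> where "linear_map R (T (Suc (Suc 0))) L \<delta>"
    "\<And>x y. \<lbrakk>x \<in> carrier L; y \<in> carrier L\<rbrakk> \<Longrightarrow> \<delta> (e [x, y]) = bracket L y x"
    "\<And>f. f \<in> carrier (T (Suc (Suc 0))) \<Longrightarrow> D (Suc 0) f \<in> W (Suc 0) \<longleftrightarrow> \<delta> f = \<zero>\<^bsub>L\<^esub>"
proof -
  obtain s where s: "linear_map R (T (Suc 0)) L s" "\<And>x. x \<in> carrier L \<Longrightarrow> s (e [x]) = x"
    "\<And>g. g \<in> carrier (T (Suc 0)) \<Longrightarrow> g \<in> W (Suc 0) \<longleftrightarrow> s g = \<zero>\<^bsub>L\<^esub>"
    using wedge_1_iso by metis
  show thesis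
  proof (rule that[of "\<lambda>f. s (D (Suc 0) f)"])
    show "linear_map R (T (Suc (Suc 0))) L (\<lambda>f. s (D (Suc 0) f))"
      by (rule linear_map_comp[OF D_linear s(1)])
    fix x y assume xy: "x \<in> carrier L" "y \<in> carrier L"
    then have "s (D (Suc 0) (e [x, y])) = s (\<ominus>\<^bsub>T (Suc 0)\<^esub> e [bracket L x y])"
      by (simp add: D_e d_tuple_2)
    also have "\<dots> = \<ominus>\<^bsub>L\<^esub> bracket L x y"
      using xy by (simp add: linear_map.neg[OF s(1)] s(2) bracket_closed)
    also have "\<dots> = bracket L y x" using xy bracket_skew[of y x] by simp
    finally show "s (D (Suc 0) (e [x, y])) = bracket L y x" .
  next
    fix f assume "f \<in> carrier (T (Suc (Suc 0)))"
    then show "D (Suc 0) f \<in> W (Suc 0) \<longleftrightarrow> s (D (Suc 0) f) = \<zero>\<^bsub>L\<^esub>"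
      by (intro s(3) linear_map.closed[OF D_linear])
  qed
qed

lemma bracket_span_surj:
  assumes perfect and \<delta>: "linear_map R (T (Suc (Suc 0))) L \<delta>"
    "\<And>x y. \<lbrakk>x \<in> carrier L; y \<in> carrier L\<rbrakk> \<Longrightarrow> \<delta> (e [x, y]) = bracket L y x"
  shows "\<delta> ` carrier (T (Suc (Suc 0))) = carrier L"
proof
  interpret \<delta>: linear_map R "T (Suc (Suc 0))" L \<delta> by (rule \<delta>)
  show "\<delta> ` carrier (T (Suc (Suc 0))) \<subseteq> carrier L" using \<delta>.closed by blast
  have "bracket L y x \<in> \<delta> ` carrier (T (Suc (Suc 0)))" if "x \<in> carrier L" "y \<in> carrier L" for x y
    using that by (intro image_eqI[of _ _ "e [x, y]"]) (simp_all add: \<delta>(2))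
  then show "carrier L \<subseteq> \<delta> ` carrier (T (Suc (Suc 0)))"
    using perfectD[OF \<open>perfect\<close>
        \<delta>.image_submodule[OF module.carrier_is_submodule[OF module_tuples]]] by blast
qed

lemma perfect_if_bd:
  assumes bd: "carrier (T (Suc 0)) \<subseteq> bd (Suc 0)"
  shows perfect
  unfolding perfect_def
proof (intro allI impI subsetI)
  fix N x assume N: "submodule N R L" and br: "\<forall>x\<in>carrier L. \<forall>y\<in>carrier L. bracket L x y \<in> N"
    and x: "x \<in> carrier L"
  obtain s where s: "linear_map R (T (Suc 0)) L s" "\<And>x. x \<in> carrier L \<Longrightarrow> s (e [x]) = x"
    "\<And>g. g \<in> carrier (T (Suc 0)) \<Longrightarrow> g \<in> W (Suc 0) \<longleftrightarrow> s g = \<zero>\<^bsub>L\<^esub>"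
    using wedge_1_iso by metis
  have "bd (Suc 0) \<subseteq> {g \<in> carrier (T (Suc 0)). s g \<in> N}"
  proof (rule bd_least[OF linear_map.vimage_submodule[OF s(1) N]])
    fix r assume r: "r \<in> wedge_relations R L (Suc 0)"
    then have "r \<in> carrier (T (Suc 0))" "r \<in> W (Suc 0)"
      using wedge_relations_closed wedge_relations_in by blast+
    then show "r \<in> {g \<in> carrier (T (Suc 0)). s g \<in> N}"
      using s(3) submodule_zero[OF N] by simp
  next
    fix xs assume xs: "xs \<in> tuples L (Suc (Suc 0))"
    then obtain y z where yz: "xs = [y, z]" "y \<in> carrier L" "z \<in> carrier L"
      by (rule tuples_2E)
    have "s (d_tuple R L xs) = \<ominus>\<^bsub>L\<^esub> bracket L y z"
      using yz by (simp add: d_tuple_2 linear_map.neg[OF s(1)] s(2) bracket_closed)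
    then have "s (d_tuple R L xs) \<in> N" using yz br submoduleE(3)[OF N] by simp
    then show "d_tuple R L xs \<in> {g \<in> carrier (T (Suc 0)). s g \<in> N}"
      using d_tuple_closed[OF xs] by simp
  qed
  moreover have "e [x] \<in> carrier (T (Suc 0))" using x by simp
  ultimately have "s (e [x]) \<in> N" using bd by blast
  then show "x \<in> N" using s(2)[OF x] by simp
qed

end

context hom_lie_alternating
begin

lemma homology_1_zero_iff:
  "zero_module (hl_homology R L 1) \<longleftrightarrow> carrier (T (Suc 0)) \<subseteq> bd (Suc 0)"
proof -
  have z: "\<zero>\<^bsub>T 0\<^esub> \<in> W 0" by (rule module.submodule_zero[OF module_tuples wedge_submodule])
  have "D 0 h \<in> W 0" if "h \<in> carrier (T (Suc 0))" for h using that z by (simp add: D_0)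
  moreover have "h \<in> carrier (T (Suc 0))" if "h \<in> W (Suc 0)" for h
    using that module.submoduleE(1)[OF module_tuples wedge_submodule] by blast
  ultimately show ?thesis
    using homology_zero_iff[of 0] D_1_wedge by (simp add: subset_iff Ball_def)
qed

lemma homology_2_zero_iff:
  assumes "\<And>f. f \<in> carrier (T (Suc (Suc 0))) \<Longrightarrow> D (Suc 0) f \<in> W (Suc 0) \<longleftrightarrow> \<delta> f = \<zero>\<^bsub>L\<^esub>"
  shows "zero_module (hl_homology R L 2) \<longleftrightarrow>
    (\<forall>f\<in>carrier (T (Suc (Suc 0))). \<delta> f = \<zero>\<^bsub>L\<^esub> \<longrightarrow> f \<in> bd (Suc (Suc 0)))"
  using homology_zero_iff[OF D_1_wedge D_2_wedge] assms by (simp add: numeral_2_eq_2)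

end


section \<open>Lifting homomorphisms along central extensions\<close>

lemma central_bracket_left:
  assumes ext: "central_extension R M' i' K' p' L"
    and u: "u \<in> carrier K'" "u' \<in> carrier K'" "p' u = p' u'" and w: "w \<in> carrier K'"
  shows "bracket K' u w = bracket K' u' w"
proof -
  have K': "hom_lie_algebra R K'" and L: "hom_lie_algebra R L" and p': "p' \<in> hom_lie_hom R K' L"
    and ker: "i' ` carrier M' = {x \<in> carrier K'. p' x = \<zero>\<^bsub>L\<^esub>}"
    and central: "\<And>m x. \<lbrakk>m \<in> carrier M'; x \<in> carrier K'\<rbrakk> \<Longrightarrow> bracket K' (i' m) x = \<zero>\<^bsub>K'\<^esub>"
    using ext by (simp_all add: central_extension_def hom_lie_extension_def)
  interpret K': hom_lie_algebra R K' by (rule K')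
  interpret L: hom_lie_algebra R L by (rule L)
  interpret p': linear_map R K' L p' by (rule hom_lie_hom_linear[OF K' L p'])
  have d: "u \<ominus>\<^bsub>K'\<^esub> u' \<in> carrier K'" using u by simp
  have "p' (u \<ominus>\<^bsub>K'\<^esub> u') = p' u' \<ominus>\<^bsub>L\<^esub> p' u'" using p'.diff[OF u(1,2)] u(3) by simp
  also have "\<dots> = \<zero>\<^bsub>L\<^esub>" using u(2) L.M.minus_eq_zero_iff by simp
  finally have "u \<ominus>\<^bsub>K'\<^esub> u' \<in> i' ` carrier M'" unfolding ker using d by simp
  then obtain m where "m \<in> carrier M'" "u \<ominus>\<^bsub>K'\<^esub> u' = i' m" by blast
  then have "bracket K' (u \<ominus>\<^bsub>K'\<^esub> u') w = \<zero>\<^bsub>K'\<^esub>" using central w by simp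
  moreover have "(u \<ominus>\<^bsub>K'\<^esub> u') \<oplus>\<^bsub>K'\<^esub> u' = u"
    using u(1,2) by (simp add: a_minus_def K'.M.a_assoc K'.M.l_neg)
  then have "bracket K' u w = bracket K' (u \<ominus>\<^bsub>K'\<^esub> u') w \<oplus>\<^bsub>K'\<^esub> bracket K' u' w"
    using K'.bracket_add_left[OF d u(2) w] by simp
  ultimately show ?thesis using u w by (simp add: K'.bracket_closed)
qed

text \<open>In a central extension a bracket depends only on the images of its arguments.\<close>
lemma central_bracket_cong:
  assumes ext: "central_extension R M' i' K' p' L"
    and u: "u \<in> carrier K'" "u' \<in> carrier K'" "p' u = p' u'"
    and w: "w \<in> carrier K'" "w' \<in> carrier K'" "p' w = p' w'"
  shows "bracket K' u w = bracket K' u' w'"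
proof -
  interpret K': hom_lie_algebra R K'
    using ext by (simp add: central_extension_def hom_lie_extension_def)
  have "bracket K' u w = bracket K' u' w" using ext u w(1) by (rule central_bracket_left)
  also have "\<dots> = \<ominus>\<^bsub>K'\<^esub> bracket K' w u'" using u w by (intro K'.bracket_skew)
  also have "bracket K' w u' = bracket K' w' u'" using ext w u(2) by (rule central_bracket_left)
  also have "\<ominus>\<^bsub>K'\<^esub> bracket K' w' u' = bracket K' u' w'"
    using u w by (intro K'.bracket_skew[symmetric])
  finally show ?thesis .
qed

text \<open>Two lifts of a homomorphism along a central extension differ by central elements, so they
  agree on brackets.\<close>

lemma perfect_hom_unique:
  assumes K: "hom_lie_algebra R K" "hom_lie_algebra.perfect R K"
    and ext: "central_extension R M' i' K' p' L"
    and h: "h \<in> hom_lie_hom R K K'" and h': "h' \<in> hom_lie_hom R K K'"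
    and over: "\<And>x. x \<in> carrier K \<Longrightarrow> p' (h x) = p' (h' x)" and x: "x \<in> carrier K"
  shows "h x = h' x"
proof -
  interpret K: hom_lie_algebra R K by (rule K)
  have K': "hom_lie_algebra R K'" and L: "hom_lie_algebra R L" and p': "p' \<in> hom_lie_hom R K' L"
    using ext by (simp_all add: central_extension_def hom_lie_extension_def)
  interpret K': hom_lie_algebra R K' by (rule K')
  interpret L: hom_lie_algebra R L by (rule L)
  interpret h: linear_map R K K' h by (rule hom_lie_hom_linear[OF K(1) K' h])
  interpret h': linear_map R K K' h' by (rule hom_lie_hom_linear[OF K(1) K' h'])
  interpret p': linear_map R K' L p' by (rule hom_lie_hom_linear[OF K' L p'])
  have sub: "submodule {x \<in> carrier K. h x = h' x} R K"
    by (rule K.submoduleI) (auto simp: h.neg h'.neg h.add h'.add h.smult h'.smult)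
  have "x \<in> {x \<in> carrier K. h x = h' x}"
  proof (rule K.perfectD[OF K(2) sub _ x])
    fix y z assume yz: "y \<in> carrier K" "z \<in> carrier K"
    then have "bracket K' (h y) (h z) = bracket K' (h' y) (h' z)"
      using over by (intro central_bracket_cong[OF ext]) simp_all
    then show "bracket K y z \<in> {x \<in> carrier K. h x = h' x}"
      using yz by (simp add: hom_lie_homD(4)[OF h] hom_lie_homD(4)[OF h'] K.bracket_closed)
  qed
  then show ?thesis by simp
qed


lemma central_extensionD:
  assumes "central_extension R M i K p L"
  shows "hom_lie_algebra R M" "hom_lie_algebra R K" "hom_lie_algebra R L"
    and "i \<in> hom_lie_hom R M K" "p \<in> hom_lie_hom R K L"
    and "i ` carrier M = {x \<in> carrier K. p x = \<zero>\<^bsub>L\<^esub>}" "p ` carrier K = carrier L"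
    and "\<And>m x. \<lbrakk>m \<in> carrier M; x \<in> carrier K\<rbrakk> \<Longrightarrow> bracket K (i m) x = \<zero>\<^bsub>K\<^esub>"
  using assms by (simp_all add: central_extension_def hom_lie_extension_def)

lemma central_kernel:
  assumes ext: "central_extension R M i K p L"
    and "x \<in> carrier K" "p x = \<zero>\<^bsub>L\<^esub>" "y \<in> carrier K"
  shows "bracket K x y = \<zero>\<^bsub>K\<^esub>"
proof -
  have "x \<in> i ` carrier M" using assms by (simp add: central_extensionD(6)[OF ext])
  then show ?thesis using central_extensionD(8)[OF ext _ assms(4)] by blast
qed

lemma central_twist:
  assumes ext: "central_extension R M i K p L"
    and x: "x \<in> carrier K" "p x = \<zero>\<^bsub>L\<^esub>" and y: "y \<in> carrier K"
  shows "bracket K (twist K x) y = \<zero>\<^bsub>K\<^esub>"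
proof -
  interpret K: hom_lie_algebra R K by (rule central_extensionD(2)[OF ext])
  interpret L: hom_lie_algebra R L by (rule central_extensionD(3)[OF ext])
  have "p (twist K x) = twist L \<zero>\<^bsub>L\<^esub>"
    using hom_lie_homD(5)[OF central_extensionD(5)[OF ext] x(1)] x(2) by simp
  also have "\<dots> = \<zero>\<^bsub>L\<^esub>"
    using L.twist_smult[of "\<zero>\<^bsub>R\<^esub>" "\<zero>\<^bsub>L\<^esub>"] by (simp add: L.twist_closed)
  finally show ?thesis using central_kernel[OF ext K.twist_closed[OF x(1)] _ y] by simp
qed

text \<open>Any homomorphism from a perfect algebra with vanishing second homology lifts along any central
  extension of its target.\<close>
theorem lift_along_central_extension:
  assumes K: "hom_lie_alternating R K" and perfect: "hom_lie_algebra.perfect R K"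
    and H2: "zero_module (hl_homology R K 2)"
    and K': "hom_lie_alternating R K'" and ext: "central_extension R M' i' K' p' L"
    and p: "p \<in> hom_lie_hom R K L"
  obtains h where "h \<in> hom_lie_hom R K K'" "\<And>x. x \<in> carrier K \<Longrightarrow> p' (h x) = p x"
proof -
  interpret K: hom_lie_alternating R K by (rule K)
  interpret K': hom_lie_alternating R K' by (rule K')
  interpret L: hom_lie_algebra R L by (rule central_extensionD(3)[OF ext])
  note homs = K.hom_lie_algebra_axioms K'.hom_lie_algebra_axioms L.hom_lie_algebra_axioms
  note p' = central_extensionD(5)[OF ext]
  interpret p: linear_map R K L p by (rule hom_lie_hom_linear[OF homs(1,3) p])
  interpret p': linear_map R K' L p' by (rule hom_lie_hom_linear[OF homs(2,3) p'])
  note [simp] = K.bracket_closed K.twist_closed K'.bracket_closed K'.twist_closed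
  note pb = hom_lie_homD(4)[OF p] and pt = hom_lie_homD(5)[OF p]
    and pb' = hom_lie_homD(4)[OF p'] and pt' = hom_lie_homD(5)[OF p']
  note cong = central_bracket_cong[OF ext]
  \<comment> \<open>A set-theoretic lift of \<open>p\<close>; the choice disappears inside brackets.\<close>
  define l where "l x = (SOME y. y \<in> carrier K' \<and> p' y = p x)" for x
  have l: "l x \<in> carrier K'" "p' (l x) = p x" if "x \<in> carrier K" for x
  proof -
    have "p x \<in> p' ` carrier K'" unfolding central_extensionD(7)[OF ext] using that by simp
    then have "\<exists>y. y \<in> carrier K' \<and> p' y = p x" by (metis imageE)
    then have "l x \<in> carrier K' \<and> p' (l x) = p x" unfolding l_def by (rule someI_ex)
    then show "l x \<in> carrier K'" "p' (l x) = p x" by auto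
  qed
  \<comment> \<open>The arguments are interchanged to match \<open>\<delta> (e [x, y]) = bracket K y x\<close> below.\<close>
  define b where "b x y = bracket K' (l y) (l x)" for x y
  have b: "b x y = bracket K' y' x'"
    if "x \<in> carrier K" "y \<in> carrier K" "x' \<in> carrier K'" "y' \<in> carrier K'" "p' x' = p x" "p' y' = p y"
    for x y x' y'
    unfolding b_def using that l by (intro cong) simp_all
  have b_closed: "b x y \<in> carrier K'" if "x \<in> carrier K" "y \<in> carrier K" for x y
    using that by (simp add: b_def l)
  obtain \<delta> where \<delta>: "linear_map R (K.T (Suc (Suc 0))) K \<delta>"
    "\<And>x y. \<lbrakk>x \<in> carrier K; y \<in> carrier K\<rbrakk> \<Longrightarrow> \<delta> (K.e [x, y]) = bracket K y x"
    "\<And>f. f \<in> carrier (K.T (Suc (Suc 0))) \<Longrightarrow> K.D (Suc 0) f \<in> K.W (Suc 0) \<longleftrightarrow> \<delta> f = \<zero>\<^bsub>K\<^esub>"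
    using K.wedge_2_bracket by metis
  have "(\<lambda>xs. b (xs ! 0) (xs ! 1)) \<in> tuples K (Suc (Suc 0)) \<rightarrow> carrier K'"
    using b_closed by (auto elim!: K.tuples_2E)
  from free_space.free_lift[OF K.free_space_tuples K'.module_axioms this]
  obtain \<Phi> where \<Phi>: "linear_map R (K.T (Suc (Suc 0))) K' \<Phi>"
    and "\<And>xs. xs \<in> tuples K (Suc (Suc 0)) \<Longrightarrow> \<Phi> (K.e xs) = b (xs ! 0) (xs ! 1)" by blast
  then have \<Phi>_e: "\<Phi> (K.e [x, y]) = b x y" if "x \<in> carrier K" "y \<in> carrier K" for x y
    using that by simp
  interpret \<Phi>: linear_map R "K.T (Suc (Suc 0))" K' \<Phi> by (rule \<Phi>)
  have b_add1: "b (x \<oplus>\<^bsub>K\<^esub> y) z = b x z \<oplus>\<^bsub>K'\<^esub> b y z"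
    if "x \<in> carrier K" "y \<in> carrier K" "z \<in> carrier K" for x y z
    using that b[of "x \<oplus>\<^bsub>K\<^esub> y" z "l x \<oplus>\<^bsub>K'\<^esub> l y" "l z"]
    by (simp add: l p.add p'.add K'.bracket_add_right b_def)
  have b_add2: "b z (x \<oplus>\<^bsub>K\<^esub> y) = b z x \<oplus>\<^bsub>K'\<^esub> b z y"
    if "x \<in> carrier K" "y \<in> carrier K" "z \<in> carrier K" for x y z
    using that b[of z "x \<oplus>\<^bsub>K\<^esub> y" "l z" "l x \<oplus>\<^bsub>K'\<^esub> l y"]
    by (simp add: l p.add p'.add K'.bracket_add_left b_def)
  have b_smult1: "b (a \<odot>\<^bsub>K\<^esub> x) y = a \<odot>\<^bsub>K'\<^esub> b x y"
    if "a \<in> carrier R" "x \<in> carrier K" "y \<in> carrier K" for a x y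
    using that b[of "a \<odot>\<^bsub>K\<^esub> x" y "a \<odot>\<^bsub>K'\<^esub> l x" "l y"]
    by (simp add: l p.smult p'.smult K'.bracket_smult_right b_def)
  have b_smult2: "b y (a \<odot>\<^bsub>K\<^esub> x) = a \<odot>\<^bsub>K'\<^esub> b y x"
    if "a \<in> carrier R" "x \<in> carrier K" "y \<in> carrier K" for a x y
    using that b[of y "a \<odot>\<^bsub>K\<^esub> x" "l y" "a \<odot>\<^bsub>K'\<^esub> l x"]
    by (simp add: l p.smult p'.smult K'.bracket_smult_left b_def)
  have \<Phi>_W: "\<Phi> f = \<zero>\<^bsub>K'\<^esub>" if "f \<in> K.W (Suc (Suc 0))" for f
    by (rule K.wedge_2_vanish[OF \<Phi> \<Phi>_e b_add1 b_add2 b_smult1 b_smult2 _ that])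
      (simp_all add: b_def l K'.bracket_self)
  have \<Phi>_d: "\<Phi> (d_tuple R K [x, y, z]) = \<zero>\<^bsub>K'\<^esub>"
    if xyz: "x \<in> carrier K" "y \<in> carrier K" "z \<in> carrier K" for x y z
  proof -
    interpret T: module R "K.T (Suc (Suc 0))" by (rule K.module_tuples)
    have face: "b (bracket K u v) (twist K w) = bracket K' (twist K' (l w)) (bracket K' (l u) (l v))"
      if "u \<in> carrier K" "v \<in> carrier K" "w \<in> carrier K" for u v w
      using that by (intro b) (simp_all add: l pb pt pb' pt')
    let ?j = "\<lambda>u v w. bracket K' (twist K' (l u)) (bracket K' (l v) (l w))"
    have neg: "?j y x z = \<ominus>\<^bsub>K'\<^esub> ?j y z x"
      using xyz K'.bracket_skew[of "l x" "l z"]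
        K'.bracket_smult_right[of "\<ominus>\<^bsub>R\<^esub> \<one>\<^bsub>R\<^esub>" "twist K' (l y)" "bracket K' (l z) (l x)"]
      by (simp add: l K'.smult_l_minus)
    have jac: "?j x y z \<oplus>\<^bsub>K'\<^esub> ?j z x y \<oplus>\<^bsub>K'\<^esub> ?j y z x = \<zero>\<^bsub>K'\<^esub>"
      using xyz by (intro K'.hom_jacobi) (simp_all add: l)
    have "\<Phi> (d_tuple R K [x, y, z]) = \<ominus>\<^bsub>K'\<^esub> ?j z x y \<oplus>\<^bsub>K'\<^esub> (?j y x z \<oplus>\<^bsub>K'\<^esub> \<ominus>\<^bsub>K'\<^esub> ?j x y z)"
      using xyz by (simp add: K.d_tuple_3 \<Phi>.add \<Phi>.neg \<Phi>_e face)
    also have "\<dots> = \<ominus>\<^bsub>K'\<^esub> (?j x y z \<oplus>\<^bsub>K'\<^esub> ?j z x y \<oplus>\<^bsub>K'\<^esub> ?j y z x)"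
      unfolding neg using xyz by (simp add: l K'.M.minus_add K'.M.a_ac)
    finally show ?thesis by (simp add: jac K'.M.neg_zero)
  qed
  have "K.bd (Suc (Suc 0)) \<subseteq> {f \<in> carrier (K.T (Suc (Suc 0))). \<Phi> f = \<zero>\<^bsub>K'\<^esub>}"
  proof (rule K.bd_least[OF \<Phi>.kernel_submodule])
    fix r assume "r \<in> wedge_relations R K (Suc (Suc 0))"
    then show "r \<in> {f \<in> carrier (K.T (Suc (Suc 0))). \<Phi> f = \<zero>\<^bsub>K'\<^esub>}"
      using K.wedge_relations_closed K.wedge_relations_in \<Phi>_W by blast
  next
    fix xs assume "xs \<in> tuples K (Suc (Suc (Suc 0)))"
    then show "d_tuple R K xs \<in> {f \<in> carrier (K.T (Suc (Suc 0))). \<Phi> f = \<zero>\<^bsub>K'\<^esub>}"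
      using K.d_tuple_closed[of xs "Suc (Suc 0)"] by (auto elim!: K.tuples_3E simp: \<Phi>_d)
  qed
  then have ker: "\<Phi> f = \<zero>\<^bsub>K'\<^esub>" if "f \<in> carrier (K.T (Suc (Suc 0)))" "\<delta> f = \<zero>\<^bsub>K\<^esub>" for f
  proof -
    have "zero_module (hl_homology R K 2) \<longleftrightarrow>
        (\<forall>f\<in>carrier (K.T (Suc (Suc 0))). \<delta> f = \<zero>\<^bsub>K\<^esub> \<longrightarrow> f \<in> K.bd (Suc (Suc 0)))"
      by (rule K.homology_2_zero_iff) (rule \<delta>(3))
    with H2 that have "f \<in> K.bd (Suc (Suc 0))" by blast
    with \<open>K.bd (Suc (Suc 0)) \<subseteq> _\<close> show ?thesis by blast
  qed
  obtain h where h: "linear_map R K K' h"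
    "\<And>f. f \<in> carrier (K.T (Suc (Suc 0))) \<Longrightarrow> h (\<delta> f) = \<Phi> f"
    using linear_map_factor[OF \<delta>(1) \<Phi> K.bracket_span_surj[OF perfect \<delta>(1,2)] ker] by metis
  interpret h: linear_map R K K' h by (rule h(1))
  have h_br: "h (bracket K x y) = bracket K' (l x) (l y)" if "x \<in> carrier K" "y \<in> carrier K" for x y
    using that h(2)[of "K.e [y, x]"] by (simp add: \<delta>(2) \<Phi>_e b_def)
  have over: "p' (h x) = p x" if x: "x \<in> carrier K" for x
  proof -
    have "submodule {x \<in> carrier K. p' (h x) = p x} R K"
      by (rule K.submoduleI) (auto simp: h.neg p.neg p'.neg h.add p.add p'.add h.smult p.smult p'.smult)
    from K.perfectD[OF perfect this _ x] show ?thesis by (simp add: h_br l pb pb')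
  qed
  have h_twist: "h (twist K x) = twist K' (h x)" if x: "x \<in> carrier K" for x
  proof -
    have zero: "twist K \<zero>\<^bsub>K\<^esub> = \<zero>\<^bsub>K\<^esub>" "twist K' \<zero>\<^bsub>K'\<^esub> = \<zero>\<^bsub>K'\<^esub>"
      using K.twist_smult[of "\<zero>\<^bsub>R\<^esub>" "\<zero>\<^bsub>K\<^esub>"] K'.twist_smult[of "\<zero>\<^bsub>R\<^esub>" "\<zero>\<^bsub>K'\<^esub>"] by simp_all
    have "linear_map R K K' (\<lambda>x. h (twist K x))"
      by (rule linear_mapI)
        (simp_all add: K.twist_add K.twist_smult h.add h.smult K.module_axioms K'.module_axioms)
    then interpret l1: linear_map R K K' "\<lambda>x. h (twist K x)" .
    have "linear_map R K K' (\<lambda>x. twist K' (h x))"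
      by (rule linear_mapI)
        (simp_all add: K'.twist_add K'.twist_smult h.add h.smult K.module_axioms K'.module_axioms)
    then interpret l2: linear_map R K K' "\<lambda>x. twist K' (h x)" .
    have sub: "submodule {x \<in> carrier K. h (twist K x) = twist K' (h x)} R K"
      by (rule K.submoduleI)
        (auto simp: l1.neg l2.neg l1.add l2.add l1.smult l2.smult zero h.zero)
    have "x \<in> {x \<in> carrier K. h (twist K x) = twist K' (h x)}"
    proof (rule K.perfectD[OF perfect sub _ x])
      fix y z assume yz: "y \<in> carrier K" "z \<in> carrier K"
      have "h (twist K (bracket K y z)) = bracket K' (l (twist K y)) (l (twist K z))"
        using yz by (simp add: K.twist_bracket h_br)
      also have "\<dots> = bracket K' (twist K' (l y)) (twist K' (l z))"
        using yz by (intro cong) (simp_all add: l pt pt')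
      also have "\<dots> = twist K' (h (bracket K y z))"
        using yz by (simp add: K'.twist_bracket h_br l)
      finally show "bracket K y z \<in> {x \<in> carrier K. h (twist K x) = twist K' (h x)}"
        using yz by simp
    qed
    then show ?thesis by simp
  qed
  have "h \<in> hom_lie_hom R K K'"
  proof (rule hom_lie_homI)
    fix x y assume xy: "x \<in> carrier K" "y \<in> carrier K"
    have "bracket K' (l x) (l y) = bracket K' (h x) (h y)"
      using xy by (intro cong) (simp_all add: l over)
    then show "h (bracket K x y) = bracket K' (h x) (h y)" using xy by (simp add: h_br)
  qed (simp_all add: h.add h.smult h_twist)
  with over that show thesis by blast
qed

lemma universal_centralI:
  fixes M :: "('k, 'm) hom_lie" and K :: "('k, 'g) hom_lie" and L :: "('k, 'l) hom_lie"
  assumes ext: "central_extension R M i K p L" and K: "hom_lie_alternating R K"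
    and alt: "\<And>K' :: ('k, 'h) hom_lie. hom_lie_algebra R K' \<Longrightarrow> hom_lie_alternating R K'"
    and H1: "zero_module (hl_homology R K 1)" and H2: "zero_module (hl_homology R K 2)"
  shows "universal_central_extension TYPE('n) TYPE('h) R M i K p L"
  unfolding universal_central_extension_def
proof (intro conjI allI impI ext)
  fix M' :: "('k, 'n) hom_lie" and i' and K' :: "('k, 'h) hom_lie" and p'
  assume ext': "central_extension R M' i' K' p' L"
  interpret K: hom_lie_alternating R K by (rule K)
  have perfect: "hom_lie_algebra.perfect R K"
    by (rule K.perfect_if_bd[OF K.homology_1_zero_iff[THEN iffD1, OF H1]])
  have K': "hom_lie_alternating R K'" by (rule alt[OF central_extensionD(2)[OF ext']])
  obtain h where h: "h \<in> hom_lie_hom R K K'" "\<And>x. x \<in> carrier K \<Longrightarrow> p' (h x) = p x"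
    using lift_along_central_extension[OF K perfect H2 K' ext' central_extensionD(5)[OF ext]] by metis
  let ?h = "restrict h (carrier K)"
  have h_res: "?h \<in> hom_lie_hom R K K'"
    using hom_lie_homD[OF h(1)] by (intro hom_lie_homI) (simp_all add: K.bracket_closed K.twist_closed)
  show "unique_hom_over R K p K' p'"
    unfolding unique_hom_over_def
  proof (rule ex1I[of _ ?h])
    show "?h \<in> hom_lie_hom R K K' \<inter> extensional (carrier K) \<and> (\<forall>x\<in>carrier K. p' (?h x) = p x)"
      using h_res h(2) by simp
    fix g assume g: "g \<in> hom_lie_hom R K K' \<inter> extensional (carrier K) \<and> (\<forall>x\<in>carrier K. p' (g x) = p x)"
    show "g = ?h"
    proof (rule extensionalityI[of _ "carrier K"])
      fix x assume "x \<in> carrier K"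
      then show "g x = ?h x"
        using g h(2)
        by (intro perfect_hom_unique[OF K.hom_lie_algebra_axioms perfect ext' _ h_res]) simp_all
    qed (use g in auto)
  qed
qed


section \<open>Tuples modulo boundaries\<close>

context hom_lie_algebra
begin

text \<open>The quotient of \<open>T n\<close> by \<open>bd n\<close>, that is, the \<open>n\<close>-th exterior power modulo boundaries, and the
  projection to it.\<close>
abbreviation Qb :: "nat \<Rightarrow> ('k, ('v list \<Rightarrow> 'k) set) module" where
  "Qb n \<equiv> quot_module (T n) (bd n)"

abbreviation qb :: "nat \<Rightarrow> ('v list \<Rightarrow> 'k) \<Rightarrow> ('v list \<Rightarrow> 'k) set" where
  "qb n f \<equiv> bd n +>\<^bsub>T n\<^esub> f"

lemma quotient_space_bd: "quotient_space R (T n) (bd n)"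
  using plain_module_tuples bd_submodule
  by (simp add: quotient_space_def quotient_space_axioms_def)

lemmas module_Qb = quotient_space.module_quot[OF quotient_space_bd]
lemmas qb_linear = quotient_space.proj_linear[OF quotient_space_bd]
lemmas qb_zero_iff = quotient_space.proj_eq_zero_iff[OF quotient_space_bd]
lemmas qb_surj = quotient_space.carrier_quot[OF quotient_space_bd, symmetric]

lemma qb_relation: "r \<in> wedge_relations R L n \<Longrightarrow> qb n r = \<zero>\<^bsub>Qb n\<^esub>"
  using qb_zero_iff bd_relation wedge_relations_closed by blast

lemma qb_d_tuple: "xs \<in> tuples L (Suc n) \<Longrightarrow> qb n (d_tuple R L xs) = \<zero>\<^bsub>Qb n\<^esub>"
  using qb_zero_iff bd_d_tuple d_tuple_closed by blast

lemma map_twist_tuples: "xs \<in> tuples L n \<Longrightarrow> map (twist L) xs \<in> tuples L n"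
  by (auto simp: tuples_def twist_closed)

lemma d_tuple_twist:
  assumes A: "linear_map R (T n) (T n) A" "\<And>xs. xs \<in> tuples L n \<Longrightarrow> A (e xs) = e (map (twist L) xs)"
    and xs: "xs \<in> tuples L (Suc n)"
  shows "A (d_tuple R L xs) = d_tuple R L (map (twist L) xs)"
proof -
  interpret A: linear_map R "T n" "T n" A by (rule A)
  interpret T: module R "T n" by (rule module_tuples)
  let ?I = "{(i, j). i < j \<and> j < length xs}"
  let ?f = "\<lambda>xs i j. bracket L (xs ! i) (xs ! j) # map (twist L) (nths xs (- {i, j}))"
  let ?g = "\<lambda>xs (i, j). ((\<ominus>\<^bsub>R\<^esub> \<one>\<^bsub>R\<^esub>) [^]\<^bsub>R\<^esub> (i + j)) \<odot>\<^bsub>T n\<^esub> e (?f xs i j)"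
  have len: "length xs - 1 = n" "length (map (twist L) xs) - 1 = n" using xs by (simp_all add: tuples_def)
  have fin: "finite ?I"
    by (rule finite_subset[of _ "{..<length xs} \<times> {..<length xs}"]) auto
  have face: "?f ys i j \<in> tuples L n" if "ys \<in> tuples L (Suc n)" "i < j" "j < length ys" for ys i j
    using that by (rule face_closed)
  have closed: "?g ys \<in> ?I \<rightarrow> carrier (T n)" if "ys \<in> tuples L (Suc n)" "length ys = length xs" for ys
    using face[OF that(1)] that(2) by (auto intro!: T.smult_closed e_closed)
  have twist_face: "map (twist L) (?f xs i j) = ?f (map (twist L) xs) i j" if "i < j" "j < length xs" for i j
  proof -
    have "xs ! i \<in> carrier L" "xs ! j \<in> carrier L"
      using xs that nth_mem by (auto simp: tuples_def subset_iff)
    then show ?thesis using that by (simp add: twist_bracket nths_map)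
  qed
  have "A (d_tuple R L xs) = finsum (T n) (\<lambda>ij. A (?g xs ij)) ?I"
    unfolding d_tuple_def len by (rule A.finsum[OF fin closed[OF xs refl]])
  also have "\<dots> = finsum (T n) (?g (map (twist L) xs)) ?I"
  proof (rule T.add.finprod_cong')
    show "?g (map (twist L) xs) \<in> ?I \<rightarrow> carrier (T n)"
      by (rule closed[OF map_twist_tuples[OF xs]]) simp
    fix ij assume "ij \<in> ?I"
    then obtain i j where ij: "ij = (i, j)" "i < j" "j < length xs" by auto
    then have "A (?g xs ij) = ((\<ominus>\<^bsub>R\<^esub> \<one>\<^bsub>R\<^esub>) [^]\<^bsub>R\<^esub> (i + j)) \<odot>\<^bsub>T n\<^esub> e (map (twist L) (?f xs i j))"
      using face[OF xs ij(2,3)] by (simp only: prod.case A.smult[OF sign_closed e_closed] A(2))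
    then show "A (?g xs ij) = ?g (map (twist L) xs) ij"
      by (simp only: twist_face[OF ij(2,3)] ij(1) prod.case)
  qed simp
  also have "\<dots> = d_tuple R L (map (twist L) xs)"
    unfolding d_tuple_def len by simp
  finally show ?thesis .
qed

text \<open>The twist of \<open>L\<close> acts on tuples modulo boundaries.\<close>

lemma twist_on_Qb:
  obtains \<beta> where "linear_map R (Qb n) (Qb n) \<beta>"
    "\<And>xs. xs \<in> tuples L n \<Longrightarrow> \<beta> (qb n (e xs)) = qb n (e (map (twist L) xs))"
proof -
  have "(\<lambda>xs. e (map (twist L) xs)) \<in> tuples L n \<rightarrow> carrier (T n)"
    using map_twist_tuples by auto
  from free_space.free_lift[OF free_space_tuples module_tuples this]
  obtain A where A: "linear_map R (T n) (T n) A"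
    "\<And>xs. xs \<in> tuples L n \<Longrightarrow> A (e xs) = e (map (twist L) xs)" by blast
  let ?F = "\<lambda>f. qb n (A f)"
  have F: "linear_map R (T n) (Qb n) ?F" by (rule linear_map_comp[OF A(1) qb_linear])
  have slot: "map (twist L) (us @ x # vs) = map (twist L) us @ twist L x # map (twist L) vs" for us x vs
    by simp
  have W: "?F f = \<zero>\<^bsub>Qb n\<^esub>" if "f \<in> W n" for f
  proof (rule wedge_kernel_vanish[OF F _ _ _ that])
    fix us vs x y assume t: "us @ x # vs \<in> tuples L n" "us @ y # vs \<in> tuples L n"
    have xy: "x \<in> carrier L" "y \<in> carrier L" using t slot_closed(1) by blast+
    have s: "us @ (x \<oplus>\<^bsub>L\<^esub> y) # vs \<in> tuples L n" using t xy slot_closed(2) by simp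
    note t' = map_twist_tuples[OF t(1), unfolded slot] map_twist_tuples[OF t(2), unfolded slot]
    show "?F (e (us @ (x \<oplus>\<^bsub>L\<^esub> y) # vs)) = ?F (e (us @ x # vs)) \<oplus>\<^bsub>Qb n\<^esub> ?F (e (us @ y # vs))"
      using vanish_add[OF qb_linear qb_relation t'] by (simp only: A(2) t s slot twist_add[OF xy])
  next
    fix us vs a x assume a: "a \<in> carrier R" and t: "us @ x # vs \<in> tuples L n"
    have x: "x \<in> carrier L" using t slot_closed(1) by blast
    have s: "us @ (a \<odot>\<^bsub>L\<^esub> x) # vs \<in> tuples L n" using t a x slot_closed(2) by simp
    note t' = map_twist_tuples[OF t, unfolded slot]
    show "?F (e (us @ (a \<odot>\<^bsub>L\<^esub> x) # vs)) = a \<odot>\<^bsub>Qb n\<^esub> ?F (e (us @ x # vs))"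
      using vanish_smult[OF qb_linear qb_relation a t'] by (simp only: A(2) t s slot twist_smult[OF a x])
  next
    fix xs assume xs: "xs \<in> tuples L n" "\<not> distinct xs"
    then have "\<not> distinct (map (twist L) xs)" by (simp add: distinct_map)
    with vanish_alt[OF qb_linear qb_relation map_twist_tuples[OF xs(1)]] xs(1)
    show "?F (e xs) = \<zero>\<^bsub>Qb n\<^esub>" by (simp add: A(2))
  qed
  have "bd n \<subseteq> {f \<in> carrier (T n). ?F f = \<zero>\<^bsub>Qb n\<^esub>}"
  proof (rule bd_least[OF linear_map.kernel_submodule[OF F]])
    fix r assume "r \<in> wedge_relations R L n"
    then show "r \<in> {f \<in> carrier (T n). ?F f = \<zero>\<^bsub>Qb n\<^esub>}"
      using wedge_relations_closed wedge_relations_in W by blast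
  next
    fix xs assume xs: "xs \<in> tuples L (Suc n)"
    then show "d_tuple R L xs \<in> {f \<in> carrier (T n). ?F f = \<zero>\<^bsub>Qb n\<^esub>}"
      using qb_d_tuple[OF map_twist_tuples[OF xs]] by (simp add: d_tuple_twist[OF A xs] d_tuple_closed)
  qed
  then have ker: "?F f = \<zero>\<^bsub>Qb n\<^esub>" if "f \<in> carrier (T n)" "qb n f = \<zero>\<^bsub>Qb n\<^esub>" for f
    using that qb_zero_iff by blast
  obtain \<beta> where \<beta>: "linear_map R (Qb n) (Qb n) \<beta>"
    "\<And>f. f \<in> carrier (T n) \<Longrightarrow> \<beta> (qb n f) = qb n (A f)"
    using linear_map_factor[OF qb_linear F qb_surj ker] by metis
  show thesis
  proof (rule that[OF \<beta>(1)])
    fix xs assume "xs \<in> tuples L n"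
    then show "\<beta> (qb n (e xs)) = qb n (e (map (twist L) xs))" by (simp add: \<beta>(2) A(2))
  qed
qed

text \<open>Pairs of an element of \<open>L\<close> and a class of \<open>n\<close>-tuples can be encoded as sets of functions on
  lists: the element is recorded by a basis vector at a list that is longer than \<open>n\<close>.\<close>

lemma encode_inj:
  "inj_on (\<lambda>(x, X). insert (e (replicate (Suc n) x)) X) (carrier L \<times> carrier (Qb n))"
proof -
  have X: "X \<subseteq> carrier (T n)" if "X \<in> carrier (Qb n)" for X
    using that quotient_space.mem_proj_iff[OF quotient_space_bd] unfolding qb_surj[symmetric] by blast
  have e: "e (replicate (Suc n) x) \<notin> carrier (T n)" for x
  proof
    assume "e (replicate (Suc n) x) \<in> carrier (T n)"
    moreover have "replicate (Suc n) x \<notin> tuples L n" by (simp add: tuples_def)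
    ultimately have "e (replicate (Suc n) x) (replicate (Suc n) x) = \<zero>\<^bsub>R\<^esub>"
      unfolding free_space.carrier_free[OF free_space_tuples] by blast
    then show False by (simp add: basis_vec_def)
  qed
  have e_inj: "xs = ys" if "e xs = e ys" for xs ys
    using fun_cong[OF that, of xs] by (simp add: basis_vec_def split: if_splits)
  show ?thesis
  proof (rule inj_onI, clarify)
    fix x X y Y
    assume XY: "X \<in> carrier (Qb n)" "Y \<in> carrier (Qb n)"
      and eq: "insert (e (replicate (Suc n) x)) X = insert (e (replicate (Suc n) y)) Y"
    have "X = insert (e (replicate (Suc n) x)) X \<inter> carrier (T n)" using X[OF XY(1)] e[of x] by blast
    also have "\<dots> = insert (e (replicate (Suc n) y)) Y \<inter> carrier (T n)" by (simp only: eq)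
    also have "\<dots> = Y" using X[OF XY(2)] e[of y] by blast
    finally have "X = Y" .
    moreover have "e (replicate (Suc n) x) = e (replicate (Suc n) y)"
      using eq e[of x] X[OF XY(2)] by blast
    then have "x = y" using e_inj by force
    ultimately show "x = y \<and> X = Y" by blast
  qed
qed

end


section \<open>Homology of a universal alpha-central extension\<close>

text \<open>The universal property, applied to the extension of \<open>L\<close> obtained from a cocycle on \<open>K\<close> with
  values in tuples modulo boundaries.\<close>

lemma universal_alpha_cocycle:
  fixes K :: "('k, 'g) hom_lie"
  assumes univ: "universal_alpha_central_extension TYPE(('k, 'g) test) TYPE(('k, 'g) test) R M i K p L"
    and F: "hom_lie_algebra R (cocycle_extension K (hom_lie_algebra.Qb R K n) \<beta> \<phi>)"
    and central: "\<And>x y. \<lbrakk>x \<in> carrier K; p x = \<zero>\<^bsub>L\<^esub>; y \<in> carrier K\<rbrakk> \<Longrightarrow>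
      \<phi> (twist K x) y = \<zero>\<^bsub>hom_lie_algebra.Qb R K n\<^esub>"
  shows "\<exists>h\<in>hom_lie_hom R K (cocycle_extension K (hom_lie_algebra.Qb R K n) \<beta> \<phi>).
      \<forall>x\<in>carrier K. p (fst (h x)) = p x"
    and "\<And>h h' x. \<lbrakk>h \<in> hom_lie_hom R K (cocycle_extension K (hom_lie_algebra.Qb R K n) \<beta> \<phi>);
        h' \<in> hom_lie_hom R K (cocycle_extension K (hom_lie_algebra.Qb R K n) \<beta> \<phi>);
        \<And>x. x \<in> carrier K \<Longrightarrow> p (fst (h x)) = p x; \<And>x. x \<in> carrier K \<Longrightarrow> p (fst (h' x)) = p x;
        x \<in> carrier K\<rbrakk> \<Longrightarrow> h x = h' x"
proof -
  have ext: "central_extension R M i K p L"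
    using univ by (simp add: universal_alpha_central_extension_def)
  note ext_simps = central_extensionD[OF ext]
  interpret K: hom_lie_algebra R K by (rule ext_simps(2))
  let ?F = "cocycle_extension K (K.Qb n) \<beta> \<phi>"
  let ?\<iota> = "\<lambda>(x, X). insert (K.e (replicate (Suc n) x)) X"
  let ?q = "\<lambda>u. p (fst u)"
  note S = cocycle_extension_simps
  have "fst \<in> hom_lie_hom R ?F K"
    by (rule hom_lie_homI) (auto simp: S)
  then have q: "?q \<in> hom_lie_hom R ?F L"
    by (rule hom_lie_hom_comp) (rule ext_simps(5))
  have zero: "\<zero>\<^bsub>K.Qb n\<^esub> \<in> carrier (K.Qb n)"
    by (simp add: abelian_monoid.zero_closed[OF abelian_group.axioms(1)[OF module.axioms(2)[OF K.module_Qb]]])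
  have surj: "?q ` carrier ?F = carrier L"
    unfolding ext_simps(7)[symmetric] using zero by (force simp: S)
  have cent: "bracket ?F (twist ?F m) x = \<zero>\<^bsub>?F\<^esub>"
    if m: "m \<in> carrier ?F" "?q m = \<zero>\<^bsub>L\<^esub>" and x: "x \<in> carrier ?F" for m x
  proof -
    obtain y a z b where y: "m = (y, a)" "y \<in> carrier K" and z: "x = (z, b)" "z \<in> carrier K"
      using m(1) x by (auto simp: S)
    have py: "p y = \<zero>\<^bsub>L\<^esub>" using m(2) y by simp
    have "bracket K (twist K y) z = \<zero>\<^bsub>K\<^esub>"
      using central_twist[OF ext y(2) py z(2)] .
    then show ?thesis using central[OF y(2) py z(2)] y z by (simp add: S)
  qed
  have inj: "inj_on ?\<iota> (carrier ?F)"
    unfolding S by (rule K.encode_inj)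
  show "\<exists>h\<in>hom_lie_hom R K ?F. \<forall>x\<in>carrier K. p (fst (h x)) = p x"
    by (rule universal_alpha_centralD(1)[OF univ F q surj cent inj])
  show "h x = h' x" if "h \<in> hom_lie_hom R K ?F" "h' \<in> hom_lie_hom R K ?F"
    "\<And>x. x \<in> carrier K \<Longrightarrow> p (fst (h x)) = p x" "\<And>x. x \<in> carrier K \<Longrightarrow> p (fst (h' x)) = p x"
    "x \<in> carrier K" for h h' x
    by (rule universal_alpha_centralD(2)[OF univ F q surj cent inj that])
qed

text \<open>The trivial cocycle with values in 1-tuples modulo boundaries admits two homomorphisms over \<open>L\<close>,
  namely \<open>h0\<close> and \<open>h1\<close> below, so every 1-tuple is a boundary.\<close>
lemma universal_alpha_bd_1:
  fixes K :: "('k, 'g) hom_lie"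
  assumes univ: "universal_alpha_central_extension TYPE(('k, 'g) test) TYPE(('k, 'g) test) R M i K p L"
  shows "carrier (hom_lie_algebra.T R K (Suc 0)) \<subseteq> hom_lie_algebra.bd R K (Suc 0)"
proof -
  have ext: "central_extension R M i K p L"
    using univ by (simp add: universal_alpha_central_extension_def)
  interpret K: hom_lie_algebra R K by (rule central_extensionD(2)[OF ext])
  let ?V = "K.Qb (Suc 0)"
  let ?q = "\<lambda>x. K.qb (Suc 0) (K.e [x])"
  interpret V: module R ?V by (rule K.module_Qb)
  interpret q: linear_map R "K.T (Suc 0)" ?V "K.qb (Suc 0)" by (rule K.qb_linear)
  obtain \<beta> where \<beta>: "linear_map R ?V ?V \<beta>"
    "\<And>xs. xs \<in> tuples K (Suc 0) \<Longrightarrow> \<beta> (K.qb (Suc 0) (K.e xs)) = K.qb (Suc 0) (K.e (map (twist K) xs))"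
    using K.twist_on_Qb by metis
  interpret \<beta>: linear_map R ?V ?V \<beta> by (rule \<beta>(1))
  let ?F = "cocycle_extension K ?V \<beta> (\<lambda>_ _. \<zero>\<^bsub>?V\<^esub>)"
  note S = cocycle_extension_simps
  have F: "hom_lie_algebra R ?F"
    by (rule cocycle_extension_hom_lie[OF K.hom_lie_algebra_axioms \<beta>(1)]) (simp_all add: V.neg_zero)
  have q_bracket: "?q (bracket K x y) = \<zero>\<^bsub>?V\<^esub>" if "x \<in> carrier K" "y \<in> carrier K" for x y
  proof -
    have "K.qb (Suc 0) (d_tuple R K [x, y]) = \<zero>\<^bsub>?V\<^esub>" using that by (intro K.qb_d_tuple) simp
    then have "\<ominus>\<^bsub>?V\<^esub> ?q (bracket K x y) = \<zero>\<^bsub>?V\<^esub>"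
      using that by (simp add: K.d_tuple_2 q.neg K.bracket_closed)
    then have "\<ominus>\<^bsub>?V\<^esub> (\<ominus>\<^bsub>?V\<^esub> ?q (bracket K x y)) = \<zero>\<^bsub>?V\<^esub>" by (simp only: V.neg_zero)
    then show ?thesis using that by (simp add: K.bracket_closed)
  qed
  have h0: "(\<lambda>x. (x, \<zero>\<^bsub>?V\<^esub>)) \<in> hom_lie_hom R K ?F"
    by (rule hom_lie_homI) (simp_all add: S)
  have h1: "(\<lambda>x. (x, ?q x)) \<in> hom_lie_hom R K ?F"
  proof (rule hom_lie_homI)
    fix x y assume "x \<in> carrier K" "y \<in> carrier K"
    then show "(x \<oplus>\<^bsub>K\<^esub> y, ?q (x \<oplus>\<^bsub>K\<^esub> y)) = (x, ?q x) \<oplus>\<^bsub>?F\<^esub> (y, ?q y)"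
      using K.vanish_add[OF K.qb_linear K.qb_relation, where us = "[]" and vs = "[]" and x = x and y = y and n = "Suc 0"]
      by (simp add: S)
  next
    fix a x assume "a \<in> carrier R" "x \<in> carrier K"
    then show "(a \<odot>\<^bsub>K\<^esub> x, ?q (a \<odot>\<^bsub>K\<^esub> x)) = a \<odot>\<^bsub>?F\<^esub> (x, ?q x)"
      using K.vanish_smult[OF K.qb_linear K.qb_relation, where us = "[]" and vs = "[]" and x = x and a = a and n = "Suc 0"]
      by (simp add: S)
  qed (simp_all add: S q_bracket \<beta>(2))
  have "(x, \<zero>\<^bsub>?V\<^esub>) = (x, ?q x)" if "x \<in> carrier K" for x
    by (rule universal_alpha_cocycle(2)[OF univ F _ h0 h1]) (simp_all add: that)
  then have e: "K.e [x] \<in> K.bd (Suc 0)" if "x \<in> carrier K" for x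
    using that K.qb_zero_iff[of "K.e [x]" "Suc 0"] by simp
  show ?thesis
  proof
    fix f assume "f \<in> carrier (K.T (Suc 0))"
    then show "f \<in> K.bd (Suc 0)"
      by (rule free_space.basis_spans[OF K.free_space_tuples K.bd_submodule, rotated])
        (auto elim!: K.tuples_1E simp: e)
  qed
qed

theorem universal_alpha_central_homology:
  fixes K :: "('k, 'g) hom_lie"
  assumes univ: "universal_alpha_central_extension TYPE(('k, 'g) test) TYPE(('k, 'g) test) R M i K p L"
    and K: "hom_lie_alternating R K"
  shows "zero_module (hl_homology R K 1)" and "zero_module (hl_homology R K 2)"
proof -
  have ext: "central_extension R M i K p L"
    using univ by (simp add: universal_alpha_central_extension_def)
  interpret K: hom_lie_alternating R K by (rule K)
  note bd_1 = universal_alpha_bd_1[OF univ]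
  show "zero_module (hl_homology R K 1)"
    using bd_1 by (rule K.homology_1_zero_iff[THEN iffD2])
  have perfect: "K.perfect" by (rule K.perfect_if_bd[OF bd_1])
  let ?n = "Suc (Suc 0)"
  let ?V = "K.Qb ?n"
  \<comment> \<open>The order of the entries makes \<open>\<sigma> \<circ> \<delta>\<close> below equal to the projection, without a sign.\<close>
  let ?\<phi> = "\<lambda>x y. K.qb ?n (K.e [y, x])"
  interpret V: module R ?V by (rule K.module_Qb)
  interpret q: linear_map R "K.T ?n" ?V "K.qb ?n" by (rule K.qb_linear)
  note S = cocycle_extension_simps
  note [simp] = K.bracket_closed K.twist_closed
  note closed = K.alternating_2_closed[OF K.qb_linear K.qb_relation]
    and add_left = K.alternating_2_add_left[OF K.qb_linear K.qb_relation]
    and add_right = K.alternating_2_add_right[OF K.qb_linear K.qb_relation]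
    and smult_left = K.alternating_2_smult_left[OF K.qb_linear K.qb_relation]
    and smult_right = K.alternating_2_smult_right[OF K.qb_linear K.qb_relation]
    and skew = K.alternating_2_skew[OF K.qb_linear K.qb_relation]
  obtain \<beta> where \<beta>: "linear_map R ?V ?V \<beta>"
    "\<And>xs. xs \<in> tuples K ?n \<Longrightarrow> \<beta> (K.qb ?n (K.e xs)) = K.qb ?n (K.e (map (twist K) xs))"
    using K.twist_on_Qb by metis
  let ?F = "cocycle_extension K ?V \<beta> ?\<phi>"
  have zero_left: "K.qb ?n (K.e [\<zero>\<^bsub>K\<^esub>, z]) = \<zero>\<^bsub>?V\<^esub>" if "z \<in> carrier K" for z
    using smult_left[of "\<zero>\<^bsub>K\<^esub>" z "\<zero>\<^bsub>R\<^esub>"] closed that by simp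
  \<comment> \<open>The differential of \<open>x \<and> y \<and> z\<close> is a boundary.\<close>
  have boundary: "\<ominus>\<^bsub>?V\<^esub> ?\<phi> (twist K z) (bracket K x y) \<oplus>\<^bsub>?V\<^esub> (?\<phi> (twist K y) (bracket K x z)
      \<oplus>\<^bsub>?V\<^esub> \<ominus>\<^bsub>?V\<^esub> ?\<phi> (twist K x) (bracket K y z)) = \<zero>\<^bsub>?V\<^esub>"
    if xyz: "x \<in> carrier K" "y \<in> carrier K" "z \<in> carrier K" for x y z
  proof -
    interpret T: module R "K.T ?n" by (rule K.module_tuples)
    have "K.qb ?n (d_tuple R K [x, y, z]) = \<zero>\<^bsub>?V\<^esub>" using xyz by (intro K.qb_d_tuple) simp
    then show ?thesis using xyz by (simp add: K.d_tuple_3 q.add q.neg)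
  qed
  have F: "hom_lie_algebra R ?F"
  proof (rule cocycle_extension_hom_lie[OF K.hom_lie_algebra_axioms \<beta>(1)])
    fix x y z assume xyz: "x \<in> carrier K" "y \<in> carrier K" "z \<in> carrier K"
    have "bracket K z x \<oplus>\<^bsub>K\<^esub> bracket K x z = \<zero>\<^bsub>K\<^esub>"
      using xyz K.bracket_skew[of z x] by (simp add: K.M.l_neg)
    then have "?\<phi> (twist K y) (bracket K x z) \<oplus>\<^bsub>?V\<^esub> ?\<phi> (twist K y) (bracket K z x) = \<zero>\<^bsub>?V\<^esub>"
      using xyz add_left[of "bracket K z x" "twist K y" "bracket K x z"] zero_left[of "twist K y"]
      by (simp add: closed V.a_comm)
    then have neg: "?\<phi> (twist K y) (bracket K x z) = \<ominus>\<^bsub>?V\<^esub> ?\<phi> (twist K y) (bracket K z x)"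
      using xyz V.minus_equality[of "?\<phi> (twist K y) (bracket K x z)" "?\<phi> (twist K y) (bracket K z x)"]
      by (simp add: closed)
    let ?s = "?\<phi> (twist K x) (bracket K y z) \<oplus>\<^bsub>?V\<^esub> ?\<phi> (twist K z) (bracket K x y)
        \<oplus>\<^bsub>?V\<^esub> ?\<phi> (twist K y) (bracket K z x)"
    have s: "?s \<in> carrier ?V" using xyz by (simp add: closed)
    have "\<ominus>\<^bsub>?V\<^esub> ?s = \<zero>\<^bsub>?V\<^esub>"
      using boundary[OF xyz] unfolding neg using xyz by (simp add: closed V.minus_add V.a_ac)
    then have "\<ominus>\<^bsub>?V\<^esub> (\<ominus>\<^bsub>?V\<^esub> ?s) = \<zero>\<^bsub>?V\<^esub>" by (simp only: V.neg_zero)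
    then show "?s = \<zero>\<^bsub>?V\<^esub>" using s by simp
  next
    fix x y assume "x \<in> carrier K" "y \<in> carrier K"
    then show "?\<phi> x y = \<ominus>\<^bsub>?V\<^esub> ?\<phi> y x" by (intro skew) simp_all
  qed (simp_all add: closed add_left add_right smult_left smult_right \<beta>(2))
  have central: "?\<phi> (twist K x) y = \<zero>\<^bsub>?V\<^esub>"
    if x: "x \<in> carrier K" "p x = \<zero>\<^bsub>L\<^esub>" and y: "y \<in> carrier K" for x y
  proof -
    have "linear_map R K ?V (?\<phi> (twist K x))"
      by (rule linear_mapI[OF K.module_axioms K.module_Qb]) (simp_all add: x closed add_left smult_left)
    then interpret l: linear_map R K ?V "?\<phi> (twist K x)" .
    have "y \<in> {y \<in> carrier K. ?\<phi> (twist K x) y = \<zero>\<^bsub>?V\<^esub>}"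
    proof (rule K.perfectD[OF perfect l.kernel_submodule _ y])
      fix a b assume ab: "a \<in> carrier K" "b \<in> carrier K"
      \<comment> \<open>Apply \<open>boundary\<close> to \<open>a\<close>, \<open>b\<close>, \<open>x\<close>: only the term with \<open>[a, b]\<close> survives.\<close>
      have "bracket K a x = \<zero>\<^bsub>K\<^esub>" "bracket K b x = \<zero>\<^bsub>K\<^esub>"
        using K.bracket_skew[of a x] K.bracket_skew[of b x] x ab
        by (simp_all add: central_kernel[OF ext] K.M.neg_zero)
      then have "\<ominus>\<^bsub>?V\<^esub> ?\<phi> (twist K x) (bracket K a b) = \<zero>\<^bsub>?V\<^esub>"
        using boundary[OF ab x(1)] x ab by (simp add: zero_left closed V.neg_zero)
      then have "\<ominus>\<^bsub>?V\<^esub> (\<ominus>\<^bsub>?V\<^esub> ?\<phi> (twist K x) (bracket K a b)) = \<zero>\<^bsub>?V\<^esub>" by (simp only: V.neg_zero)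
      then show "bracket K a b \<in> {y \<in> carrier K. ?\<phi> (twist K x) y = \<zero>\<^bsub>?V\<^esub>}"
        using x ab by (simp add: closed)
    qed
    then show ?thesis by simp
  qed
  have "\<exists>h\<in>hom_lie_hom R K ?F. \<forall>x\<in>carrier K. p (fst (h x)) = p x"
    by (rule universal_alpha_cocycle(1)[OF univ F]) (rule central)
  then obtain h where h: "h \<in> hom_lie_hom R K ?F" "\<And>x. x \<in> carrier K \<Longrightarrow> p (fst (h x)) = p x"
    by (elim bexE) simp
  have fst: "fst \<in> hom_lie_hom R ?F K" by (rule hom_lie_homI) (auto simp: S)
  have snd: "linear_map R ?F ?V snd"
    by (rule linear_mapI[OF hom_lie_modules[OF F] K.module_Qb]) (auto simp: S)
  \<comment> \<open>The first component and the identity are both homomorphisms over \<open>L\<close>.\<close>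
  have id: "fst (h x) = x" if x: "x \<in> carrier K" for x
  proof (rule perfect_hom_unique[OF K.hom_lie_algebra_axioms perfect ext _ _ _ x])
    show "(\<lambda>x. fst (h x)) \<in> hom_lie_hom R K K" by (rule hom_lie_hom_comp[OF h(1) fst])
    show "(\<lambda>x. x) \<in> hom_lie_hom R K K" by (simp add: hom_lie_hom_def)
  qed (rule h(2))
  let ?\<sigma> = "\<lambda>x. snd (h x)"
  have \<sigma>: "linear_map R K ?V ?\<sigma>"
    by (rule linear_map_comp[OF hom_lie_hom_linear[OF K.hom_lie_algebra_axioms F h(1)] snd])
  have \<sigma>_bracket: "?\<sigma> (bracket K x y) = ?\<phi> x y" if "x \<in> carrier K" "y \<in> carrier K" for x y
  proof -
    have hx: "h x = (x, ?\<sigma> x)" and hy: "h y = (y, ?\<sigma> y)" using id that by (simp_all add: prod_eq_iff)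
    have "?\<sigma> (bracket K x y) = snd (bracket ?F (x, ?\<sigma> x) (y, ?\<sigma> y))"
      unfolding hom_lie_homD(4)[OF h(1) that] by (simp only: hx[symmetric] hy[symmetric])
    then show ?thesis by (simp add: S)
  qed
  obtain \<delta> where \<delta>: "linear_map R (K.T ?n) K \<delta>"
    "\<And>x y. \<lbrakk>x \<in> carrier K; y \<in> carrier K\<rbrakk> \<Longrightarrow> \<delta> (K.e [x, y]) = bracket K y x"
    "\<And>f. f \<in> carrier (K.T ?n) \<Longrightarrow> K.D (Suc 0) f \<in> K.W (Suc 0) \<longleftrightarrow> \<delta> f = \<zero>\<^bsub>K\<^esub>"
    using K.wedge_2_bracket by metis
  have \<sigma>\<delta>: "?\<sigma> (\<delta> f) = K.qb ?n f" if "f \<in> carrier (K.T ?n)" for f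
    by (rule free_space.linear_map_eqI[OF K.free_space_tuples linear_map_comp[OF \<delta>(1) \<sigma>] K.qb_linear _ that])
      (auto elim!: K.tuples_2E simp: \<delta>(2) \<sigma>_bracket)
  have "f \<in> K.bd ?n" if f: "f \<in> carrier (K.T ?n)" "\<delta> f = \<zero>\<^bsub>K\<^esub>" for f
  proof -
    have "K.qb ?n f = \<zero>\<^bsub>?V\<^esub>" using \<sigma>\<delta>[OF f(1)] f(2) linear_map.zero[OF \<sigma>] by simp
    then show ?thesis using f(1) by (simp add: K.qb_zero_iff)
  qed
  moreover have "zero_module (hl_homology R K 2) \<longleftrightarrow>
      (\<forall>f\<in>carrier (K.T ?n). \<delta> f = \<zero>\<^bsub>K\<^esub> \<longrightarrow> f \<in> K.bd ?n)"
    by (rule K.homology_2_zero_iff) (rule \<delta>(3))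
  ultimately show "zero_module (hl_homology R K 2)" by blast
qed

section \<open>Characteristic other than two\<close>

lemma hom_lie_alternating_if_char:
  assumes L: "hom_lie_algebra R L" and char: "ring_char R \<noteq> 2"
  shows "hom_lie_alternating R L"
proof -
  interpret L: hom_lie_algebra R L by (rule L)
  let ?two = "\<one>\<^bsub>R\<^esub> \<oplus>\<^bsub>R\<^esub> \<one>\<^bsub>R\<^esub>"
  have two: "?two \<noteq> \<zero>\<^bsub>R\<^esub>"
  proof
    assume "?two = \<zero>\<^bsub>R\<^esub>"
    then have 2: "(2::nat) > 0 \<and> [(2::nat)] \<cdot>\<^bsub>R\<^esub> \<one>\<^bsub>R\<^esub> = \<zero>\<^bsub>R\<^esub>"
      by (simp add: numeral_2_eq_2)
    have 1: "[Suc 0] \<cdot>\<^bsub>R\<^esub> \<one>\<^bsub>R\<^esub> \<noteq> \<zero>\<^bsub>R\<^esub>" by simp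
    have "(LEAST n::nat. n > 0 \<and> [n] \<cdot>\<^bsub>R\<^esub> \<one>\<^bsub>R\<^esub> = \<zero>\<^bsub>R\<^esub>) = 2"
    proof (rule Least_equality[of _ 2])
      show "(2::nat) > 0 \<and> [(2::nat)] \<cdot>\<^bsub>R\<^esub> \<one>\<^bsub>R\<^esub> = \<zero>\<^bsub>R\<^esub>" by (rule 2)
      fix m :: nat assume m: "m > 0 \<and> [m] \<cdot>\<^bsub>R\<^esub> \<one>\<^bsub>R\<^esub> = \<zero>\<^bsub>R\<^esub>"
      then have "m \<noteq> Suc 0" using 1 by auto
      then show "2 \<le> m" using m by linarith
    qed
    moreover have "\<exists>n::nat. n > 0 \<and> [n] \<cdot>\<^bsub>R\<^esub> \<one>\<^bsub>R\<^esub> = \<zero>\<^bsub>R\<^esub>" using 2 by (rule exI[of _ 2])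
    ultimately have "ring_char R = 2" unfolding ring_char_def by (simp only: if_True)
    with char show False by simp
  qed
  have "bracket L x x = \<zero>\<^bsub>L\<^esub>" if x: "x \<in> carrier L" for x
  proof -
    let ?b = "bracket L x x"
    have b: "?b \<in> carrier L" using x L.bracket_closed by simp
    have "?two \<odot>\<^bsub>L\<^esub> ?b = ?b \<oplus>\<^bsub>L\<^esub> ?b" using b by (simp add: L.smult_l_distr)
    also have "\<dots> = ?b \<oplus>\<^bsub>L\<^esub> \<ominus>\<^bsub>L\<^esub> ?b" using L.bracket_skew[OF x x] by simp
    also have "\<dots> = \<zero>\<^bsub>L\<^esub>" using b by (rule L.M.r_neg)
    finally have 0: "?two \<odot>\<^bsub>L\<^esub> ?b = \<zero>\<^bsub>L\<^esub>" .
    have "?two \<in> Units R" using two by (simp add: L.R.field_Units)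
    then have inv: "inv\<^bsub>R\<^esub> ?two \<in> carrier R" "inv\<^bsub>R\<^esub> ?two \<otimes>\<^bsub>R\<^esub> ?two = \<one>\<^bsub>R\<^esub>"
      by (rule L.R.Units_inv_closed, rule L.R.Units_l_inv)
    have "?b = (inv\<^bsub>R\<^esub> ?two \<otimes>\<^bsub>R\<^esub> ?two) \<odot>\<^bsub>L\<^esub> ?b" using b by (simp only: inv L.smult_one)
    also have "\<dots> = inv\<^bsub>R\<^esub> ?two \<odot>\<^bsub>L\<^esub> (?two \<odot>\<^bsub>L\<^esub> ?b)"
      using inv(1) b by (intro L.smult_assoc1) simp_all
    also have "\<dots> = \<zero>\<^bsub>L\<^esub>" unfolding 0 using inv(1) by simp
    finally show ?thesis .
  qed
  then show ?thesis
    using L by (simp add: hom_lie_alternating_def hom_lie_alternating_axioms_def)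
qed

theorem corollary4p12:
  fixes R :: "'k ring"
    and M :: "('k, 'm) hom_lie" and K :: "('k, 'g) hom_lie" and L :: "('k, 'l) hom_lie"
    and i :: "'m \<Rightarrow> 'g" and p :: "'g \<Rightarrow> 'l"
  assumes "field R" and "ring_char R \<noteq> 2"
  shows "(universal_alpha_central_extension TYPE(('k, 'g) test) TYPE(('k, 'g) test) R M i K p L \<longrightarrow>
            zero_module (hl_homology R K 1) \<and> zero_module (hl_homology R K 2))
       \<and> (central_extension R M i K p L \<and>
          zero_module (hl_homology R K 1) \<and> zero_module (hl_homology R K 2) \<longrightarrow>
            universal_central_extension TYPE('n) TYPE('h) R M i K p L)"
proof (intro conjI impI)
  assume univ: "universal_alpha_central_extension TYPE(('k, 'g) test) TYPE(('k, 'g) test) R M i K p L"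
  then have "central_extension R M i K p L" by (simp add: universal_alpha_central_extension_def)
  then have K: "hom_lie_alternating R K"
    by (intro hom_lie_alternating_if_char central_extensionD(2) assms)
  show "zero_module (hl_homology R K 1)" "zero_module (hl_homology R K 2)"
    by (rule universal_alpha_central_homology[OF univ K])+
next
  assume "central_extension R M i K p L \<and>
    zero_module (hl_homology R K 1) \<and> zero_module (hl_homology R K 2)"
  then show "universal_central_extension TYPE('n) TYPE('h) R M i K p L"
    by (intro universal_centralI hom_lie_alternating_if_char assms)
      (auto dest: central_extensionD(2))
qed

end
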